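(* Let $n\ge2$ and $0\le k\le n-1$ be integers, and let $f$ be a smooth positive function on $\mathbb{S}^n$. Assume that $\varphi$ is a smooth positive function on $\mathbb{S}^n$ with $A[\varphi]>0$ on $\mathbb{S}^n$ (a smooth uniformly h-convex solution) satisfying $$\varphi^{n-k}\,p_{n-k}\left(A[\varphi]\right)=f(z)\qquad\text{on }\mathbb{S}^n .$$ Then $$\int_{\mathbb{S}^n}\varphi^{-n}\langle Df,Dx_i\rangle\,d\sigma=0,\qquad i=0,1,\dots,n,$$ where $x_0,\dots,x_n$ are the coordinate functions of $\mathbb{S}^n\subset\mathbb{R}^{n+1}$. More generally, $$\int_{\mathbb{S}^n}\varphi^{-n}\,\overline V(f)\,d\sigma=0$$ for every conformal vector field $\overline V$ on the unit sphere $\mathbb{S}^n$.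
   Context: $\mathbb{S}^n\subset\mathbb{R}^{n+1}$ is the unit sphere with standard metric $\sigma_{ij}$, Levi-Civita connection $D$ and area measure $d\sigma$. For smooth positive $\varphi$ on $\mathbb{S}^n$, $$A_{ij}[\varphi]=D_jD_i\varphi-\frac12\frac{|D\varphi|^2}{\varphi}\sigma_{ij}+\frac12\left(\varphi-\frac1\varphi\right)\sigma_{ij},$$ and $p_m(A)=\binom nm^{-1}\sigma_m$ of the eigenvalues of $A$ with respect to $\sigma_{ij}$. *)

theory Defs
  imports "HOL-Analysis.Analysis"
begin

text \<open>Smooth maps on open subsets of a Euclidean space, and on the unit sphere of a Euclidean space
  (as an embedded submanifold: locally the restriction of a smooth map on an open set).\<close>

primrec Ck_on :: "nat \<Rightarrow> ('a::euclidean_space \<Rightarrow> 'b::real_normed_vector) \<Rightarrow> 'a set \<Rightarrow> bool" where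
  "Ck_on 0 f U \<longleftrightarrow> continuous_on U f"
| "Ck_on (Suc r) f U \<longleftrightarrow>
     (\<forall>x\<in>U. f differentiable (at x)) \<and> (\<forall>v. Ck_on r (\<lambda>x. frechet_derivative f (at x) v) U)"

definition smooth_on_open :: "('a::euclidean_space \<Rightarrow> 'b::real_normed_vector) \<Rightarrow> 'a set \<Rightarrow> bool" where
  "smooth_on_open f U \<longleftrightarrow> open U \<and> (\<forall>r. Ck_on r f U)"

definition smooth_on_sphere :: "('a::euclidean_space \<Rightarrow> 'b::real_normed_vector) \<Rightarrow> bool" where
  "smooth_on_sphere f \<longleftrightarrow>
     (\<forall>x\<in>sphere 0 1. \<exists>U g. x \<in> U \<and> smooth_on_open g U \<and> (\<forall>y\<in>U \<inter> sphere 0 1. g y = f y))"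

text \<open>Functions and vector fields on the sphere are represented by functions on the ambient space;
  all notions below depend only on their values on \<^term>\<open>sphere 0 1\<close>.\<close>

definition tangent_space :: "'a::euclidean_space \<Rightarrow> 'a set" where
  "tangent_space x = {v. v \<bullet> x = 0}"

definition tangential_part :: "'a::euclidean_space \<Rightarrow> 'a \<Rightarrow> 'a" where
  "tangential_part x w = w - (w \<bullet> x) *\<^sub>R x"

text \<open>A derivative within the sphere is unique only on the tangent space, so the following is
  meaningful (and is only used) for \<^term>\<open>v \<in> tangent_space x\<close>.\<close>

definition sphere_deriv :: "('a::euclidean_space \<Rightarrow> 'b::real_normed_vector) \<Rightarrow> 'a \<Rightarrow> 'a \<Rightarrow> 'b" where
  "sphere_deriv f x v = frechet_derivative f (at x within sphere 0 1) v"

definition sphere_grad :: "('a::euclidean_space \<Rightarrow> real) \<Rightarrow> 'a \<Rightarrow> 'a" where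
  "sphere_grad f x =
     (THE g. g \<in> tangent_space x \<and> (\<forall>v\<in>tangent_space x. g \<bullet> v = sphere_deriv f x v))"

text \<open>The Levi-Civita connection of the metric induced from the ambient space: the covariant
  derivative of the tangent field \<open>X\<close> at \<open>x\<close> in direction \<open>u\<close> is the tangential part of the
  directional derivative.\<close>

definition cov_deriv :: "('a::euclidean_space \<Rightarrow> 'a) \<Rightarrow> 'a \<Rightarrow> 'a \<Rightarrow> 'a" where
  "cov_deriv X x u = tangential_part x (sphere_deriv X x u)"

definition sphere_hess :: "('a::euclidean_space \<Rightarrow> real) \<Rightarrow> 'a \<Rightarrow> 'a \<Rightarrow> 'a \<Rightarrow> real" where
  "sphere_hess f x u v = cov_deriv (sphere_grad f) x u \<bullet> v"

text \<open>The tensor \<open>A[\<phi>]\<close> at \<open>x\<close>, as a bilinear form on the tangent space.\<close>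

definition A_form :: "('a::euclidean_space \<Rightarrow> real) \<Rightarrow> 'a \<Rightarrow> 'a \<Rightarrow> 'a \<Rightarrow> real" where
  "A_form \<phi> x u v =
     sphere_hess \<phi> x u v
     - 1 / 2 * ((norm (sphere_grad \<phi> x))\<^sup>2 / \<phi> x) * (u \<bullet> v)
     + 1 / 2 * (\<phi> x - 1 / \<phi> x) * (u \<bullet> v)"

definition pos_def_on :: "'a::euclidean_space set \<Rightarrow> ('a \<Rightarrow> 'a \<Rightarrow> real) \<Rightarrow> bool" where
  "pos_def_on W A \<longleftrightarrow> (\<forall>v\<in>W. v \<noteq> 0 \<longrightarrow> A v v > 0)"

text \<open>\<open>B\<close> is an orthonormal basis of the subspace \<open>W\<close> consisting of eigenvectors of the form \<open>A\<close>
  with respect to the inner product, \<open>b\<close> having eigenvalue \<open>l b\<close>.  A symmetric form has such a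
  basis, and the eigenvalues with multiplicity do not depend on it.\<close>

definition eigenbasis ::
    "'a::euclidean_space set \<Rightarrow> ('a \<Rightarrow> 'a \<Rightarrow> real) \<Rightarrow> 'a set \<Rightarrow> ('a \<Rightarrow> real) \<Rightarrow> bool" where
  "eigenbasis W A B l \<longleftrightarrow>
     pairwise orthogonal B \<and> (\<forall>b\<in>B. norm b = 1) \<and> span B = W \<and>
     (\<forall>b\<in>B. \<forall>w\<in>W. A b w = l b * (b \<bullet> w))"

definition elem_sym :: "nat \<Rightarrow> 'i set \<Rightarrow> ('i \<Rightarrow> real) \<Rightarrow> real" where
  "elem_sym m B l = (\<Sum>I | I \<subseteq> B \<and> card I = m. \<Prod>b\<in>I. l b)"

definition p_form :: "'a::euclidean_space set \<Rightarrow> nat \<Rightarrow> ('a \<Rightarrow> 'a \<Rightarrow> real) \<Rightarrow> real" where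
  "p_form W m A =
     (THE s. \<exists>B l. eigenbasis W A B l \<and> s = elem_sym m B l / real (dim W choose m))"

text \<open>Area measure of the unit sphere, normalized by polar coordinates: for a sphere of dimension
  \<open>n\<close>, Lebesgue measure is \<open>r ^ n dr d\<sigma>\<close>, so the area of a Borel set is \<open>n + 1\<close> times the volume of
  the cone over it in the unit ball.\<close>

definition sphere_area :: "'a::euclidean_space measure" where
  "sphere_area = scale_measure (of_nat DIM('a))
     (distr (restrict_space lborel (ball 0 1 - {0})) (restrict_space borel (sphere 0 1))
       (\<lambda>x. x /\<^sub>R norm x))"

text \<open>The Lie derivative of the metric along \<open>V\<close>, expressed by the Levi-Civita connection.\<close>

definition lie_metric :: "('a::euclidean_space \<Rightarrow> 'a) \<Rightarrow> 'a \<Rightarrow> 'a \<Rightarrow> 'a \<Rightarrow> real" where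
  "lie_metric V x u w = cov_deriv V x u \<bullet> w + u \<bullet> cov_deriv V x w"

definition conformal_field :: "('a::euclidean_space \<Rightarrow> 'a) \<Rightarrow> bool" where
  "conformal_field V \<longleftrightarrow>
     smooth_on_sphere V \<and> (\<forall>x\<in>sphere 0 1. V x \<in> tangent_space x) \<and>
     (\<exists>\<psi>. \<forall>x\<in>sphere 0 1. \<forall>u\<in>tangent_space x. \<forall>w\<in>tangent_space x.
        lie_metric V x u w = 2 * \<psi> x * (u \<bullet> w))"

end

theory Submission
  imports Defs
begin

text \<open>Extend \<open>\<phi>\<close> to the 1-homogeneous function \<open>u\<close> and put \<open>p = grad u\<close>, \<open>\<beta> = (c - |p|\<^sup>2) / (2 u)\<close> for a
  constant \<open>c\<close>. On tangent spaces \<open>Hess u + \<beta> I = A[\<phi>] + (c + 1) / (2 \<phi>) I\<close>, so the determinants of these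
  forms, as \<open>c\<close> varies, generate all \<open>p\<^sub>m(A[\<phi>])\<close>. Geometrically \<open>(\<beta>, p + \<beta> x)\<close> is a map of the sphere into a
  quadric of Minkowski space. The components of its exact \<open>n\<close>-forms (Jacobian determinants with one row
  replaced by the normal) have integral zero, and they equal
  \<open>(p\<^sub>i + (a \<bullet> x) p\<^sub>i - (a \<bullet> p) x\<^sub>i) / u\<close> times the determinant above. Extracting the coefficient for
  \<open>m = n - k\<close> and integrating by parts gives the identity for the fields \<open>\<Omega> x + b - (b \<bullet> x) x\<close> with \<open>\<Omega>\<close>
  skew. Every conformal field is of this form: by the traced compatibility equation its conformal
  factor extends to a 1-homogeneous harmonic function, which must be linear, and what remains is a
  Killing field.\<close>

subsection \<open>Calculus of \<open>C\<^sup>k\<close> functions\<close>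

text \<open>\<open>A[\<phi>]\<close> is the case c = -1 of Hess u + \<beta> I. Only full Jacobian
  determinants are exact forms, so the intermediate p_m have to be reached as coefficients of the
  polynomial s -> det(A + s I). The shift s = (c + 1) / (2 u) varies from point to point, while each
  integral identity holds for one constant c. Sampling c = 2 j - 1 for j = 0, ..., n gives s = j /
  u, and the power of u that this leaves in each coefficient becomes part of the final weight. The
  auxiliary vector a separates the components of the identity: a = 0 serves the gradient fields of
  the coordinates, and the difference of a = e_j and a = 0 serves the rotations. The calculus takes
  place on punctured Euclidean space: homogeneous extensions turn covariant derivatives into partial
  derivatives, and Euler's relation controls the radial direction. Every integration by parts goes
  back to the rotation invariance of the area measure.\<close>

lemma Ck_on_cong:
  assumes "open U" "\<And>x. x \<in> U \<Longrightarrow> f x = g x" "Ck_on r f U"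
  shows "Ck_on r g U"
  using assms(2,3)
proof (induction r arbitrary: f g)
  case 0
  then show ?case using continuous_on_cong by (metis Ck_on.simps(1))
next
  case (Suc r)
  have d: "(g has_derivative frechet_derivative f (at x)) (at x)" if "x \<in> U" for x
    using Suc.prems that assms(1) has_derivative_transform_within_open[of f _ x UNIV U g]
    by (auto simp: frechet_derivative_works)
  have e: "frechet_derivative g (at x) = frechet_derivative f (at x)" if "x \<in> U" for x
    using d[OF that] frechet_derivative_at by metis
  show ?case
  proof (simp, intro conjI ballI allI)
    show "g differentiable at x" if "x \<in> U" for x
      using d[OF that] by (auto simp: differentiable_def)
    show "Ck_on r (\<lambda>x. frechet_derivative g (at x) v) U" for v
      by (rule Suc.IH[of "\<lambda>x. frechet_derivative f (at x) v"]) (use e Suc.prems in auto)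
  qed
qed

lemma Ck_on_subset: "Ck_on r f U \<Longrightarrow> V \<subseteq> U \<Longrightarrow> Ck_on r f V"
  by (induction r arbitrary: f) (auto intro: continuous_on_subset)

text \<open>Glues local regularity: \<open>smooth_on_sphere\<close> gives a different extension near
  each point, smooth only on its own open set.\<close>

lemma Ck_on_local:
  assumes "\<And>x. x \<in> U \<Longrightarrow> \<exists>V. open V \<and> x \<in> V \<and> Ck_on r f V"
  shows "Ck_on r f U"
  using assms
proof (induction r arbitrary: f)
  case 0
  have "continuous (at x) f" if "x \<in> U" for x
    using 0[OF that] by (auto simp: continuous_on_eq_continuous_at)
  then show ?case by (simp add: continuous_at_imp_continuous_on)
next
  case (Suc r)
  then show ?case by simp meson
qed

lemma Ck_on_cts: "Ck_on r f U \<Longrightarrow> continuous_on U f"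
  by (cases r) (auto intro!: continuous_at_imp_continuous_on differentiable_imp_continuous_within)

lemma Ck_on_Suc_D: "Ck_on (Suc r) f U \<Longrightarrow> Ck_on r f U"
proof (induction r arbitrary: f)
  case 0
  then show ?case using Ck_on_cts by (metis Ck_on.simps(1))
next
  case (Suc r)
  then show ?case using Ck_on.simps(2) by blast
qed

lemma Ck_on_SucI:
  assumes "open U" "\<And>x. x \<in> U \<Longrightarrow> (f has_derivative f' x) (at x)" "\<And>v. Ck_on r (\<lambda>x. f' x v) U"
  shows "Ck_on (Suc r) f U"
proof (simp, intro conjI ballI allI)
  show "f differentiable at x" if "x \<in> U" for x
    using assms(2)[OF that] by (auto simp: differentiable_def)
  show "Ck_on r (\<lambda>x. frechet_derivative f (at x) v) U" for v
    by (rule Ck_on_cong[OF assms(1) _ assms(3)[of v]]) (metis assms(2) frechet_derivative_at)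
qed

lemma Ck_on_SucD:
  assumes "Ck_on (Suc r) f U" "x \<in> U"
  shows "(f has_derivative frechet_derivative f (at x)) (at x)"
  using assms by (simp add: frechet_derivative_works)

lemma Ck_on_const: "open U \<Longrightarrow> Ck_on r (\<lambda>x. c) U"
  by (induction r arbitrary: c) auto

lemma Ck_on_bounded_linear:
  assumes "open U" "bounded_linear f"
  shows "Ck_on r f U"
proof (cases r)
  case 0
  then show ?thesis using assms by (simp add: bounded_linear.linear linear_continuous_on)
next
  case (Suc r')
  show ?thesis unfolding Suc
    by (rule Ck_on_SucI[where f'="\<lambda>x. f"])
       (auto intro: assms Ck_on_const bounded_linear_imp_has_derivative)
qed

lemma Ck_on_add:
  assumes "open U" "Ck_on r f U" "Ck_on r g U"
  shows "Ck_on r (\<lambda>x. f x + g x) U"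
  using assms(2,3)
proof (induction r arbitrary: f g)
  case 0
  then show ?case by (auto intro: continuous_intros)
next
  case (Suc r)
  show ?case
    by (rule Ck_on_SucI[OF assms(1) has_derivative_add[OF Ck_on_SucD[OF Suc.prems(1)] Ck_on_SucD[OF Suc.prems(2)]]])
       (use Suc in auto)
qed

lemma Ck_on_mult:
  fixes f g :: "'a::euclidean_space \<Rightarrow> real"
  assumes "open U" "Ck_on r f U" "Ck_on r g U"
  shows "Ck_on r (\<lambda>x. f x * g x) U"
  using assms(2,3)
proof (induction r arbitrary: f g)
  case 0
  then show ?case by (auto intro: continuous_intros)
next
  case (Suc r)
  have d: "Ck_on r (\<lambda>x. frechet_derivative f (at x) v) U" "Ck_on r (\<lambda>x. frechet_derivative g (at x) v) U"
    "Ck_on r f U" "Ck_on r g U" for v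
    using Suc.prems Ck_on_Suc_D by auto
  show ?case
    by (rule Ck_on_SucI[OF assms(1) has_derivative_mult[OF Ck_on_SucD[OF Suc.prems(1)] Ck_on_SucD[OF Suc.prems(2)]]])
       (use d in \<open>auto intro!: Ck_on_add[OF assms(1)] Suc.IH\<close>)
qed

lemma Ck_on_sum:
  assumes "open U" "\<And>i. i \<in> I \<Longrightarrow> Ck_on r (f i) U"
  shows "Ck_on r (\<lambda>x. \<Sum>i\<in>I. f i x) U"
  using assms(2) by (induction I rule: infinite_finite_induct) (auto intro: Ck_on_add Ck_on_const assms(1))

lemma Ck_on_inverse:
  fixes f :: "'a::euclidean_space \<Rightarrow> real"
  assumes "open U" "Ck_on r f U" "\<And>x. x \<in> U \<Longrightarrow> f x \<noteq> 0"
  shows "Ck_on r (\<lambda>x. inverse (f x)) U"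
  using assms(2)
proof (induction r)
  case 0
  then show ?case using assms(3) by (auto intro: continuous_intros)
next
  case (Suc r)
  have i: "Ck_on r (\<lambda>x. inverse (f x)) U" using Suc Ck_on_Suc_D by blast
  show ?case
  proof (rule Ck_on_SucI[OF assms(1) Deriv.has_derivative_inverse[OF assms(3) Ck_on_SucD[OF Suc.prems]]])
    show "Ck_on r (\<lambda>x. - (inverse (f x) * frechet_derivative f (at x) v * inverse (f x))) U" for v
      using Ck_on_mult[OF assms(1) Ck_on_const[OF assms(1), of r "-1"]
          Ck_on_mult[OF assms(1) Ck_on_mult[OF assms(1) i, of "\<lambda>x. frechet_derivative f (at x) v"] i]]
        Suc.prems by simp
  qed
qed

text \<open>The exponent stays arbitrary in the induction because differentiating |x|^(-k) gives
  |x|^(-k-2) times a linear function, which leads back to the same family.\<close>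

lemma Ck_on_inverse_norm_power:
  "Ck_on r (\<lambda>x::'a::euclidean_space. inverse (norm x) ^ k) (- {0})"
proof (induction r arbitrary: k)
  case 0
  then show ?case by (auto intro!: continuous_intros)
next
  case (Suc r)
  show ?case
  proof (rule Ck_on_SucI)
    show "open (- {0::'a})" by auto
    show "((\<lambda>x::'a. inverse (norm x) ^ k) has_derivative (\<lambda>v. (- real k) * (inverse (norm x) ^ (k + 2) * (x \<bullet> v)))) (at x)"
      if "x \<in> - {0}" for x :: 'a
    proof -
      have n: "norm x \<noteq> 0" using that by simp
      have "((\<lambda>x::'a. inverse (norm x) ^ k) has_derivative
          (\<lambda>v. real k * (- (inverse (norm x) * (v \<bullet> sgn x) * inverse (norm x))) * inverse (norm x) ^ (k - 1))) (at x)"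
        using that by (intro has_derivative_power Deriv.has_derivative_inverse has_derivative_norm has_derivative_ident) auto
      moreover have "real k * (- (inverse (norm x) * (v \<bullet> sgn x) * inverse (norm x))) * inverse (norm x) ^ (k - 1)
          = (- real k) * (inverse (norm x) ^ (k + 2) * (x \<bullet> v))" for v
        using n by (cases k) (auto simp: sgn_div_norm inner_commute divide_simps power_add power2_eq_square algebra_simps)
      ultimately show ?thesis by (simp only:)
    qed
    show "Ck_on r (\<lambda>x. (- real k) * (inverse (norm x) ^ (k + 2) * (x \<bullet> v))) (- {0})" for v :: 'a
      by (intro Ck_on_mult Ck_on_const Ck_on_bounded_linear Suc.IH bounded_linear_inner_left) auto
  qed
qed

text \<open>In coordinates the chain rule gives a sum of products of derivatives of components of
  \<open>P\<close> with partial derivatives of \<open>G\<close> along \<open>P\<close>. The latter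
  are composites again, so the induction varies \<open>G\<close>.\<close>

lemma Ck_on_compose:
  fixes G :: "'b::euclidean_space \<Rightarrow> real" and P :: "'a::euclidean_space \<Rightarrow> 'b"
  assumes "open W" "\<And>x. x \<in> W \<Longrightarrow> P x \<in> V" "Ck_on r G V" "\<And>b. b \<in> Basis \<Longrightarrow> Ck_on r (\<lambda>x. P x \<bullet> b) W"
  shows "Ck_on r (\<lambda>x. G (P x)) W"
  using assms(3,4)
proof (induction r arbitrary: G)
  case 0
  have "continuous_on W P"
    using 0(2) continuous_on_componentwise[of W P] by auto
  then show ?case using 0 assms(2) continuous_on_compose2[of V G W P] by auto
next
  case (Suc r)
  define D where "D = (\<lambda>x v. \<Sum>b\<in>Basis. frechet_derivative (\<lambda>x. P x \<bullet> b) (at x) v * frechet_derivative G (at (P x)) b)"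
  have "((\<lambda>x. G (P x)) has_derivative D x) (at x)" if x: "x \<in> W" for x
  proof -
    define P' where "P' = (\<lambda>v. \<Sum>b\<in>Basis. frechet_derivative (\<lambda>x. P x \<bullet> b) (at x) v *\<^sub>R b)"
    have P': "(P has_derivative P') (at x)"
      unfolding P'_def has_derivative_componentwise_within[of P]
      using Ck_on_SucD[OF Suc.prems(2) x] by (auto simp: inner_sum_left inner_Basis if_distrib cong: if_cong)
    have G: "(G has_derivative frechet_derivative G (at (P x))) (at (P x))"
      using Ck_on_SucD[OF Suc.prems(1) assms(2)[OF x]] .
    then have lin: "linear (frechet_derivative G (at (P x)))" using has_derivative_linear by blast
    have "frechet_derivative G (at (P x)) (P' v) = D x v" for v
      unfolding P'_def D_def by (simp add: linear_sum[OF lin] linear_scale[OF lin])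
    then show ?thesis using diff_chain_at[OF P' G] by (simp add: o_def)
  qed
  moreover have "Ck_on r (\<lambda>x. D x v) W" for v
    unfolding D_def
  proof (rule Ck_on_sum[OF assms(1)], rule Ck_on_mult[OF assms(1)])
    fix b :: 'b assume b: "b \<in> Basis"
    show "Ck_on r (\<lambda>x. frechet_derivative (\<lambda>x. P x \<bullet> b) (at x) v) W"
      using Suc.prems(2)[OF b] by simp
    show "Ck_on r (\<lambda>x. frechet_derivative G (at (P x)) b) W"
      by (rule Suc.IH) (use Suc.prems(1) Ck_on_Suc_D[OF Suc.prems(2)] in auto)
  qed
  ultimately show ?case using Ck_on_SucI[OF assms(1)] by blast
qed

subsection \<open>Smooth functions on punctured space\<close>

text \<open>The origin is removed because homogeneous extensions from the sphere are singular
  there.\<close>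

definition smooth_punct :: "('a::euclidean_space \<Rightarrow> real) \<Rightarrow> bool" where
  "smooth_punct F \<longleftrightarrow> (\<forall>r. Ck_on r F (- {0}))"

text \<open>The direction comes first so that \<open>pd v\<close> is an operator on functions and
  can be iterated.\<close>

definition pd :: "'a::euclidean_space \<Rightarrow> ('a \<Rightarrow> real) \<Rightarrow> 'a \<Rightarrow> real" where
  "pd v F x = frechet_derivative F (at x) v"

lemma smooth_punct_deriv:
  assumes "smooth_punct F" "x \<noteq> 0"
  shows "(F has_derivative (\<lambda>v. pd v F x)) (at x)"
  using assms Ck_on_SucD[of 0 F "- {0}" x] unfolding smooth_punct_def pd_def by auto

lemma smooth_punct_pd: "smooth_punct F \<Longrightarrow> smooth_punct (pd v F)"
  unfolding smooth_punct_def pd_def[abs_def] by (metis Ck_on.simps(2))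

lemma pd_eqI:
  assumes "(F has_derivative F') (at x)" shows "pd v F x = F' v"
  using frechet_derivative_at[OF assms] by (simp add: pd_def)

lemma pd_cong:
  assumes "\<And>y. y \<noteq> 0 \<Longrightarrow> F y = G y" "x \<noteq> 0"
  shows "pd v F x = pd v G x"
proof -
  have "(F has_derivative D) (at x) = (G has_derivative D) (at x)" for D
    using assms has_derivative_transform_within_open[of F D x UNIV "- {0}" G]
      has_derivative_transform_within_open[of G D x UNIV "- {0}" F] by auto
  then show ?thesis by (simp add: pd_def frechet_derivative_def)
qed

lemma smooth_punct_const: "smooth_punct (\<lambda>x. c)"
  by (auto simp: smooth_punct_def intro: Ck_on_const)

lemma smooth_punct_inner: "smooth_punct (\<lambda>x. x \<bullet> b)"
  by (auto simp: smooth_punct_def intro: Ck_on_bounded_linear bounded_linear_inner_left)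

lemma smooth_punct_add: "smooth_punct F \<Longrightarrow> smooth_punct G \<Longrightarrow> smooth_punct (\<lambda>x. F x + G x)"
  by (auto simp: smooth_punct_def intro: Ck_on_add)

lemma smooth_punct_mult: "smooth_punct F \<Longrightarrow> smooth_punct G \<Longrightarrow> smooth_punct (\<lambda>x. F x * G x)"
  by (auto simp: smooth_punct_def intro!: Ck_on_mult)

lemma smooth_punct_uminus: "smooth_punct F \<Longrightarrow> smooth_punct (\<lambda>x. - F x)"
  using smooth_punct_mult[OF smooth_punct_const[of "-1"]] by simp

lemma smooth_punct_diff: "smooth_punct F \<Longrightarrow> smooth_punct G \<Longrightarrow> smooth_punct (\<lambda>x. F x - G x)"
  using smooth_punct_add[OF _ smooth_punct_uminus, of F G] by simp

lemma smooth_punct_sum: "(\<And>i. i \<in> I \<Longrightarrow> smooth_punct (F i)) \<Longrightarrow> smooth_punct (\<lambda>x. \<Sum>i\<in>I. F i x)"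
  by (auto simp: smooth_punct_def intro!: Ck_on_sum)

lemma smooth_punct_prod: "(\<And>i. i \<in> I \<Longrightarrow> smooth_punct (F i)) \<Longrightarrow> smooth_punct (\<lambda>x. \<Prod>i\<in>I. F i x)"
  by (induction I rule: infinite_finite_induct) (auto intro: smooth_punct_const smooth_punct_mult)

lemma smooth_punct_inverse:
  "smooth_punct F \<Longrightarrow> (\<And>x. x \<noteq> 0 \<Longrightarrow> F x \<noteq> 0) \<Longrightarrow> smooth_punct (\<lambda>x. inverse (F x))"
  by (auto simp: smooth_punct_def intro!: Ck_on_inverse)

lemma smooth_punct_divide:
  "smooth_punct F \<Longrightarrow> smooth_punct G \<Longrightarrow> (\<And>x. x \<noteq> 0 \<Longrightarrow> G x \<noteq> 0) \<Longrightarrow> smooth_punct (\<lambda>x. F x / G x)"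
  using smooth_punct_mult[OF _ smooth_punct_inverse, of F G] by (simp add: divide_inverse)

lemma smooth_punct_power: "smooth_punct F \<Longrightarrow> smooth_punct (\<lambda>x. F x ^ k)"
  by (induction k) (auto intro: smooth_punct_const smooth_punct_mult)

lemma smooth_punct_inverse_norm: "smooth_punct (\<lambda>x. inverse (norm x))"
  using Ck_on_inverse_norm_power[where k=1 and 'a='a] unfolding smooth_punct_def by (simp only: power_one_right) auto

lemma smooth_punct_norm: "smooth_punct norm"
  using smooth_punct_inverse[OF smooth_punct_inverse_norm] by simp

lemmas smooth_punct_intros = smooth_punct_const smooth_punct_inner smooth_punct_add
  smooth_punct_mult smooth_punct_uminus smooth_punct_diff smooth_punct_sum smooth_punct_prod
  smooth_punct_inverse smooth_punct_divide smooth_punct_power smooth_punct_inverse_norm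
  smooth_punct_norm smooth_punct_pd

text \<open>Near each point the extension is a local smooth extension composed with x / |x|, on the
  open cone over its domain.\<close>

lemma smooth_punct_radial:
  assumes "smooth_on_sphere f"
  shows "smooth_punct (\<lambda>x. f (x /\<^sub>R norm x))"
  unfolding smooth_punct_def
proof (intro allI Ck_on_local)
  fix r and x :: 'a assume "x \<in> - {0}"
  then have x: "x \<noteq> 0" by simp
  then have "x /\<^sub>R norm x \<in> sphere 0 1" by simp
  from assms[unfolded smooth_on_sphere_def, rule_format, OF this]
  obtain U g where U: "x /\<^sub>R norm x \<in> U" "smooth_on_open g U" "\<forall>y\<in>U \<inter> sphere 0 1. g y = f y"
    by (elim exE conjE) 
  define W where "W = {y \<in> - {0}. y /\<^sub>R norm y \<in> U}"
  have "continuous_on (- {0}) (\<lambda>y::'a. y /\<^sub>R norm y)" by (auto intro!: continuous_intros)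
  then have oW: "open W"
    using U(2) continuous_open_preimage[of "- {0}" "\<lambda>y::'a. y /\<^sub>R norm y" U]
    by (auto simp: smooth_on_open_def W_def vimage_def Int_def)
  have "Ck_on r (\<lambda>y. g (y /\<^sub>R norm y)) W"
  proof (rule Ck_on_compose[where V=U])
    show "Ck_on r g U" using U(2) by (auto simp: smooth_on_open_def)
    show "Ck_on r (\<lambda>y. (y /\<^sub>R norm y) \<bullet> b) W" for b
      using smooth_punct_mult[OF smooth_punct_inverse_norm smooth_punct_inner, of b]
      by (auto simp: smooth_punct_def W_def intro: Ck_on_subset)
  qed (auto simp: oW, auto simp: W_def)
  then have "Ck_on r (\<lambda>y. f (y /\<^sub>R norm y)) W"
    by (rule Ck_on_cong[OF oW, rotated]) (rule U(3)[rule_format], auto simp: W_def)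
  then show "\<exists>V. open V \<and> x \<in> V \<and> Ck_on r (\<lambda>y. f (y /\<^sub>R norm y)) V"
    using oW U(1) x by (auto simp: W_def)
qed

section \<open>Rules for directional derivatives and symmetry of second derivatives\<close>

lemma pd_linear:
  assumes "smooth_punct F" "x \<noteq> 0" shows "linear (\<lambda>v. pd v F x)"
  using smooth_punct_deriv[OF assms] has_derivative_linear by blast

lemma pd_const [simp]: "pd v (\<lambda>x. c) x = 0"
  by (simp add: pd_def)

lemma pd_inner [simp]: "pd v (\<lambda>x. x \<bullet> b) x = v \<bullet> b"
  by (rule pd_eqI) (auto intro!: derivative_eq_intros)

lemma pd_add:
  "smooth_punct F \<Longrightarrow> smooth_punct G \<Longrightarrow> x \<noteq> 0 \<Longrightarrow> pd v (\<lambda>x. F x + G x) x = pd v F x + pd v G x"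
  by (rule pd_eqI) (auto intro!: derivative_eq_intros smooth_punct_deriv)

lemma pd_diff:
  "smooth_punct F \<Longrightarrow> smooth_punct G \<Longrightarrow> x \<noteq> 0 \<Longrightarrow> pd v (\<lambda>x. F x - G x) x = pd v F x - pd v G x"
  by (rule pd_eqI) (auto intro!: derivative_eq_intros smooth_punct_deriv)

lemma pd_mult:
  "smooth_punct F \<Longrightarrow> smooth_punct G \<Longrightarrow> x \<noteq> 0 \<Longrightarrow>
    pd v (\<lambda>x. F x * G x) x = pd v F x * G x + F x * pd v G x"
  by (rule pd_eqI) (auto intro!: derivative_eq_intros smooth_punct_deriv)

lemma pd_sum:
  "(\<And>i. i \<in> I \<Longrightarrow> smooth_punct (F i)) \<Longrightarrow> x \<noteq> 0 \<Longrightarrow>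
    pd v (\<lambda>x. \<Sum>i\<in>I. F i x) x = (\<Sum>i\<in>I. pd v (F i) x)"
  by (rule pd_eqI) (auto intro!: derivative_eq_intros smooth_punct_deriv)

lemma pd_inverse:
  "smooth_punct F \<Longrightarrow> F x \<noteq> 0 \<Longrightarrow> x \<noteq> 0 \<Longrightarrow>
    pd v (\<lambda>x. inverse (F x)) x = - (pd v F x * inverse (F x) ^ 2)"
  by (rule pd_eqI) (auto intro!: derivative_eq_intros smooth_punct_deriv simp: power2_eq_square)

lemma pd_divide:
  "smooth_punct F \<Longrightarrow> smooth_punct G \<Longrightarrow> G x \<noteq> 0 \<Longrightarrow> x \<noteq> 0 \<Longrightarrow>
    pd v (\<lambda>x. F x / G x) x = (pd v F x * G x - F x * pd v G x) / (G x)\<^sup>2"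
  by (rule pd_eqI) (auto intro!: derivative_eq_intros smooth_punct_deriv simp: power2_eq_square field_simps)

lemma pd_power:
  "smooth_punct F \<Longrightarrow> x \<noteq> 0 \<Longrightarrow>
    pd v (\<lambda>x. F x ^ k) x = real k * pd v F x * F x ^ (k - 1)"
  by (rule pd_eqI) (auto intro!: derivative_eq_intros smooth_punct_deriv)

lemma pd_norm: "x \<noteq> 0 \<Longrightarrow> pd v norm x = (v \<bullet> x) / norm x"
  by (rule pd_eqI[THEN trans, OF has_derivative_norm])
    (auto simp: sgn_div_norm divide_inverse mult.commute)

text \<open>Two applications of the mean value theorem: along \<open>v\<close> to the increment in
  direction \<open>w\<close>, then along \<open>w\<close>. The left side is symmetric in
  \<open>v\<close> and \<open>w\<close> and the right side is not, which is what allows derivatives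
  to be exchanged. The last hypothesis keeps the parallelogram off the origin.\<close>

lemma second_difference:
  assumes F: "smooth_punct F" and h: "0 < h"
    and nz: "\<forall>s t. 0 \<le> s \<and> s \<le> h \<and> 0 \<le> t \<and> t \<le> h \<longrightarrow> x + s *\<^sub>R v + t *\<^sub>R w \<noteq> 0"
  obtains s t where "0 < s" "s < h" "0 < t" "t < h"
    "F (x + h *\<^sub>R v + h *\<^sub>R w) - F (x + h *\<^sub>R v) - F (x + h *\<^sub>R w) + F x
       = h * (h * pd w (pd v F) (x + s *\<^sub>R v + t *\<^sub>R w))"
proof -
  have line: "((\<lambda>s. G (y + s *\<^sub>R v)) has_real_derivative pd v G (y + s *\<^sub>R v)) (at s)"
    if "smooth_punct G" "y + s *\<^sub>R v \<noteq> 0" for G y s v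
  proof -
    have "((\<lambda>s. G (y + s *\<^sub>R v)) has_derivative (\<lambda>r. pd (r *\<^sub>R v) G (y + s *\<^sub>R v))) (at s)"
      by (rule has_derivative_compose[where g=G and f="\<lambda>s. y + s *\<^sub>R v" and f'="\<lambda>r. r *\<^sub>R v", OF _ smooth_punct_deriv[OF that]])
         (auto intro!: derivative_eq_intros)
    then show ?thesis
      by (simp add: has_field_derivative_def linear_scale[OF pd_linear[OF that]] mult.commute[of _ "pd v G (y + s *\<^sub>R v)"])
  qed
  define \<phi> where "\<phi> = (\<lambda>s. F (x + h *\<^sub>R w + s *\<^sub>R v) - F (x + s *\<^sub>R v))"
  have "\<exists>s>0. s < h \<and> \<phi> h - \<phi> 0 = (h - 0) * (pd v F (x + h *\<^sub>R w + s *\<^sub>R v) - pd v F (x + s *\<^sub>R v))"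
    unfolding \<phi>_def
    by (rule MVT2[OF h], intro DERIV_diff line F)
       (use nz[rule_format, of _ h] nz[rule_format, of _ 0] h in \<open>auto simp: algebra_simps\<close>)
  then obtain s where s: "0 < s" "s < h"
    "\<phi> h - \<phi> 0 = h * (pd v F (x + h *\<^sub>R w + s *\<^sub>R v) - pd v F (x + s *\<^sub>R v))" by auto
  have "\<exists>t>0. t < h \<and> pd v F (x + s *\<^sub>R v + h *\<^sub>R w) - pd v F (x + s *\<^sub>R v + 0 *\<^sub>R w)
     = (h - 0) * pd w (pd v F) (x + s *\<^sub>R v + t *\<^sub>R w)"
    by (rule MVT2[OF h], rule line[OF smooth_punct_pd[OF F]]) (use nz s in auto)
  then obtain t where t: "0 < t" "t < h" "pd v F (x + s *\<^sub>R v + h *\<^sub>R w) - pd v F (x + s *\<^sub>R v)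
     = h * pd w (pd v F) (x + s *\<^sub>R v + t *\<^sub>R w)" by auto
  have c: "x + h *\<^sub>R w + s *\<^sub>R v = x + s *\<^sub>R v + h *\<^sub>R w" "x + h *\<^sub>R w + h *\<^sub>R v = x + h *\<^sub>R v + h *\<^sub>R w"
    by (simp_all add: algebra_simps)
  have "F (x + h *\<^sub>R v + h *\<^sub>R w) - F (x + h *\<^sub>R v) - F (x + h *\<^sub>R w) + F x = \<phi> h - \<phi> 0"
    by (simp add: \<phi>_def c)
  then show ?thesis using that[OF s(1,2) t(1,2)] s(3) t(3) c(1) by simp
qed

lemma smooth_punct_continuous: "smooth_punct F \<Longrightarrow> continuous_on (- {0}) F"
  using Ck_on.simps(1) unfolding smooth_punct_def by blast

text \<open>Expanding one second difference in both orders gives equal values of the two mixed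
  derivatives at points near \<open>x\<close>; continuity then excludes a gap at
  \<open>x\<close>.\<close>

lemma pd_commute:
  fixes F :: "'a::euclidean_space \<Rightarrow> real"
  assumes F: "smooth_punct F" and x: "x \<noteq> 0"
  shows "pd v (pd w F) x = pd w (pd v F) x"
proof (rule ccontr)
  assume ne: "pd v (pd w F) x \<noteq> pd w (pd v F) x"
  \<comment> \<open>Half the gap: no common value can be closer than \<open>e\<close> to both
    derivatives at \<open>x\<close>.\<close>
  define e where "e = \<bar>pd v (pd w F) x - pd w (pd v F) x\<bar> / 2"
  have e: "e > 0" using ne by (simp add: e_def)
  have "continuous (at x) (pd a (pd b F))" for a b
    using smooth_punct_continuous[OF smooth_punct_pd[OF smooth_punct_pd[OF F]]] x open_Compl[OF closed_singleton[of "0::'a"]]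
    continuous_on_eq_continuous_at[of "- {0::'a}"] by blast
  then have "\<exists>d>0. \<forall>y. dist y x < d \<longrightarrow> dist (pd a (pd b F) y) (pd a (pd b F) x) < e" for a b
    using e by (auto simp: continuous_at_eps_delta dist_real_def)
  then obtain d1 d2 where d: "d1 > 0" "\<And>y. dist y x < d1 \<Longrightarrow> dist (pd v (pd w F) y) (pd v (pd w F) x) < e"
    "d2 > 0" "\<And>y. dist y x < d2 \<Longrightarrow> dist (pd w (pd v F) y) (pd w (pd v F) x) < e"
    by meson
  \<comment> \<open>Within distance \<open>m\<close> of \<open>x\<close> both derivatives are
    \<open>e\<close>-close to their values at \<open>x\<close> and the origin is not reached;
    \<open>h\<close> makes the whole parallelogram fit.\<close>
  define m where "m = min (min d1 d2) (norm x)"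
  have m: "m > 0" using d x by (simp add: m_def)
  define h where "h = m / (2 * (norm v + norm w + 1))"
  have h: "h > 0" using m by (simp add: h_def add_nonneg_pos)
  have near: "norm (s *\<^sub>R v + t *\<^sub>R w) < m" if "0 \<le> s" "s \<le> h" "0 \<le> t" "t \<le> h" for s t
  proof -
    have "norm (s *\<^sub>R v + t *\<^sub>R w) \<le> s * norm v + t * norm w"
      using norm_triangle_ineq[of "s *\<^sub>R v" "t *\<^sub>R w"] that by simp
    also have "\<dots> \<le> h * norm v + h * norm w" using that by (intro add_mono mult_right_mono) auto
    also have "\<dots> \<le> h * (norm v + norm w + 1)" using h by (simp add: algebra_simps)
    also have "\<dots> = m / 2" by (simp add: h_def field_simps add_nonneg_pos add_nonneg_eq_0_iff)
    finally show ?thesis using m by simp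
  qed
  have nz: "x + s *\<^sub>R v + t *\<^sub>R w \<noteq> 0" if "0 \<le> s" "s \<le> h" "0 \<le> t" "t \<le> h" for s t
  proof
    assume "x + s *\<^sub>R v + t *\<^sub>R w = 0"
    then have "x = - (s *\<^sub>R v + t *\<^sub>R w)" by (metis add.assoc eq_neg_iff_add_eq_0)
    then have "norm x = norm (s *\<^sub>R v + t *\<^sub>R w)" by (metis norm_minus_cancel)
    then show False using near[OF that] by (simp add: m_def)
  qed
  have nz': "x + t *\<^sub>R w + s *\<^sub>R v \<noteq> 0" if "0 \<le> t" "t \<le> h" "0 \<le> s" "s \<le> h" for s t
    using nz[OF that(3,4,1,2)] by (simp add: algebra_simps)
  obtain s t where st: "0 < s" "s < h" "0 < t" "t < h"
    "F (x + h *\<^sub>R v + h *\<^sub>R w) - F (x + h *\<^sub>R v) - F (x + h *\<^sub>R w) + F x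
       = h * (h * pd w (pd v F) (x + s *\<^sub>R v + t *\<^sub>R w))"
    by (rule second_difference[OF F h, of x v w]) (use nz in blast)+
  obtain s' t' where st': "0 < s'" "s' < h" "0 < t'" "t' < h"
    "F (x + h *\<^sub>R w + h *\<^sub>R v) - F (x + h *\<^sub>R w) - F (x + h *\<^sub>R v) + F x
       = h * (h * pd v (pd w F) (x + s' *\<^sub>R w + t' *\<^sub>R v))"
    by (rule second_difference[OF F h, of x w v]) (use nz' in blast)+
  have "F (x + h *\<^sub>R w + h *\<^sub>R v) = F (x + h *\<^sub>R v + h *\<^sub>R w)" by (simp add: algebra_simps)
  then have "h * (h * pd w (pd v F) (x + s *\<^sub>R v + t *\<^sub>R w)) = h * (h * pd v (pd w F) (x + s' *\<^sub>R w + t' *\<^sub>R v))"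
    using st(5) st'(5) by linarith
  then have eq: "pd w (pd v F) (x + s *\<^sub>R v + t *\<^sub>R w) = pd v (pd w F) (x + s' *\<^sub>R w + t' *\<^sub>R v)"
    using h by simp
  have "dist (x + s *\<^sub>R v + t *\<^sub>R w) x < m" "dist (x + s' *\<^sub>R w + t' *\<^sub>R v) x < m"
    using near[of s t] near[of t' s'] st st' by (simp_all add: dist_norm add.assoc add.commute[of "s' *\<^sub>R w"])
  then have "dist (pd w (pd v F) (x + s *\<^sub>R v + t *\<^sub>R w)) (pd w (pd v F) x) < e"
    "dist (pd v (pd w F) (x + s' *\<^sub>R w + t' *\<^sub>R v)) (pd v (pd w F) x) < e"
    using d by (auto simp: m_def)
  then show False unfolding eq e_def dist_real_def by (smt (verit) field_sum_of_halves)
qed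

subsection \<open>Integration over the sphere\<close>

lemma nn_integral_lborel_shift:
  fixes h :: "'a::euclidean_space \<Rightarrow> ennreal"
  assumes "h \<in> borel_measurable borel"
  shows "(\<integral>\<^sup>+x. h (t + x) \<partial>lborel) = (\<integral>\<^sup>+x. h x \<partial>lborel)"
    "(\<integral>\<^sup>+x. h (t - x) \<partial>lborel) = (\<integral>\<^sup>+x. h x \<partial>lborel)"
proof -
  have *: "(\<integral>\<^sup>+x. h (t + c *\<^sub>R x) \<partial>lborel) = (\<integral>\<^sup>+x. h x \<partial>lborel)" if "\<bar>c\<bar> = 1" for c
  proof -
    have "lborel = distr lborel borel (\<lambda>x::'a. t + c *\<^sub>R x)"
      using that lborel_affine[of c t] by (auto simp: density_1)
    then show ?thesis
      using assms nn_integral_distr[of "\<lambda>x. t + c *\<^sub>R x" lborel borel h] by simp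
  qed
  show "(\<integral>\<^sup>+x. h (t + x) \<partial>lborel) = (\<integral>\<^sup>+x. h x \<partial>lborel)" using *[of 1] by simp
  show "(\<integral>\<^sup>+x. h (t - x) \<partial>lborel) = (\<integral>\<^sup>+x. h x \<partial>lborel)" using *[of "-1"] by simp
qed

text \<open>Lebesgue measure and its image are both translation invariant, hence proportional by Fubini,
  and they agree on the unit ball.\<close>

lemma lborel_distr_orthogonal:
  fixes \<rho> :: "'a::euclidean_space \<Rightarrow> 'a"
  assumes "orthogonal_transformation \<rho>"
  shows "distr lborel borel \<rho> = lborel"
proof -
  have lin: "linear \<rho>" and nrm: "\<And>x. norm (\<rho> x) = norm x"
    using assms by (auto simp: orthogonal_transformation)
  have [measurable]: "\<rho> \<in> borel_measurable borel"
    using lin by (intro borel_measurable_continuous_onI linear_continuous_on linear_conv_bounded_linear[THEN iffD1])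
  obtain \<sigma> where \<sigma>: "\<And>y. \<rho> (\<sigma> y) = y"
    using orthogonal_transformation_surj[OF assms] by (metis surjD)
  have swap: "(\<integral>\<^sup>+x. f (\<rho> x) \<partial>lborel) * (\<integral>\<^sup>+x. g x \<partial>lborel) = (\<integral>\<^sup>+x. g (\<rho> x) \<partial>lborel) * (\<integral>\<^sup>+x. f x \<partial>lborel)"
    if [measurable]: "f \<in> borel_measurable borel" "g \<in> borel_measurable borel" for f g :: "'a \<Rightarrow> ennreal"
  proof -
    have "(\<integral>\<^sup>+x. f (\<rho> x) \<partial>lborel) * (\<integral>\<^sup>+x. g x \<partial>lborel) = (\<integral>\<^sup>+x. f (\<rho> x) * (\<integral>\<^sup>+y. g (\<rho> x + y) \<partial>lborel) \<partial>lborel)"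
      by (simp add: nn_integral_multc nn_integral_lborel_shift)
    also have "\<dots> = (\<integral>\<^sup>+x. (\<integral>\<^sup>+y. f (\<rho> x) * g (\<rho> x + y) \<partial>lborel) \<partial>lborel)"
      by (simp add: nn_integral_cmult)
    also have "\<dots> = (\<integral>\<^sup>+y. (\<integral>\<^sup>+x. f (\<rho> x) * g (\<rho> x + y) \<partial>lborel) \<partial>lborel)"
      by (rule lborel_pair.Fubini') measurable
    \<comment> \<open>Translating \<open>x\<close> by \<open>- \<sigma> y\<close> removes
      \<open>y\<close> from the argument of \<open>g\<close> and puts it, with the opposite sign,
      into that of \<open>f\<close>.\<close>
    also have "\<dots> = (\<integral>\<^sup>+y. (\<integral>\<^sup>+x. f (\<rho> (- \<sigma> y + x)) * g (\<rho> (- \<sigma> y + x) + y) \<partial>lborel) \<partial>lborel)"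
      by (subst nn_integral_lborel_shift(1)[where h="\<lambda>x. f (\<rho> x) * g (\<rho> x + _)"]) auto
    also have "\<dots> = (\<integral>\<^sup>+y. (\<integral>\<^sup>+x. f (\<rho> x - y) * g (\<rho> x) \<partial>lborel) \<partial>lborel)"
      by (simp add: linear_add[OF lin] linear_neg[OF lin] linear_diff[OF lin] \<sigma>)
    also have "\<dots> = (\<integral>\<^sup>+x. (\<integral>\<^sup>+y. f (\<rho> x - y) * g (\<rho> x) \<partial>lborel) \<partial>lborel)"
      by (rule lborel_pair.Fubini') measurable
    also have "\<dots> = (\<integral>\<^sup>+x. (\<integral>\<^sup>+y. f y \<partial>lborel) * g (\<rho> x) \<partial>lborel)"
      by (simp add: nn_integral_multc nn_integral_lborel_shift)
    also have "\<dots> = (\<integral>\<^sup>+x. g (\<rho> x) \<partial>lborel) * (\<integral>\<^sup>+x. f x \<partial>lborel)"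
      by (simp add: nn_integral_cmult mult.commute)
    finally show ?thesis .
  qed
  let ?B = "ball 0 1 :: 'a set"
  have ball: "emeasure lborel ?B \<noteq> 0" "emeasure lborel ?B \<noteq> \<infinity>"
    using content_ball_pos[of 1 "0::'a"] emeasure_bounded_finite[OF bounded_ball, of "0::'a" 1]
    by (auto simp: measure_def)
  have "(\<integral>\<^sup>+x. f (\<rho> x) \<partial>lborel) = (\<integral>\<^sup>+x. f x \<partial>lborel)"
    if [measurable]: "f \<in> borel_measurable borel" for f :: "'a \<Rightarrow> ennreal"
  proof -
    have "(\<integral>\<^sup>+x. f (\<rho> x) \<partial>lborel) * emeasure lborel ?B = (\<integral>\<^sup>+x. f x \<partial>lborel) * emeasure lborel ?B"
    proof -
      have m: "(indicator ?B :: 'a \<Rightarrow> ennreal) \<in> borel_measurable borel"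
        by (intro borel_measurable_indicator) auto
      \<comment> \<open>The unit ball is a test set invariant under \<open>\<rho>\<close>; its
        finite nonzero volume can then be cancelled.\<close>
      have "(indicator ?B (\<rho> x) :: ennreal) = indicator ?B x" for x by (simp add: indicator_def nrm)
      then show ?thesis using swap[OF that m] by (simp add: mult.commute)
    qed
    then show ?thesis using ball by (metis ennreal_mult_cancel_left mult.commute top_neq_ennreal infinity_ennreal_def)
  qed
  note inv = this
  show ?thesis
  proof (rule measure_eqI)
    fix A assume "A \<in> sets (distr lborel borel \<rho>)"
    then have [measurable]: "A \<in> sets borel" by simp
    have "emeasure (distr lborel borel \<rho>) A = (\<integral>\<^sup>+x. indicator A x \<partial>distr lborel borel \<rho>)" by simp
    also have "\<dots> = (\<integral>\<^sup>+x. indicator A (\<rho> x) \<partial>lborel)" by (rule nn_integral_distr) auto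
    also have "\<dots> = (\<integral>\<^sup>+x. indicator A x \<partial>lborel)" by (rule inv) simp
    finally show "emeasure (distr lborel borel \<rho>) A = emeasure lborel A" by simp
  qed simp
qed

section \<open>The area measure, its invariance, and integration by parts on the sphere\<close>

lemma space_sphere_area: "space (sphere_area :: 'a::euclidean_space measure) = sphere 0 1"
  by (simp add: sphere_area_def space_scale_measure space_restrict_space)

lemma sets_sphere_area [measurable_cong]:
  "sets (sphere_area :: 'a::euclidean_space measure) = sets (restrict_space borel (sphere 0 1))"
  by (simp add: sphere_area_def)

lemma measurable_radial:
  "(\<lambda>x::'a::euclidean_space. x /\<^sub>R norm x) \<in> restrict_space lborel (ball 0 1 - {0}) \<rightarrow>\<^sub>M restrict_space borel (sphere 0 1)"
  by (rule measurable_restrict_space2) (auto simp: space_restrict_space intro!: measurable_restrict_space1)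

lemma scale_measure_density:
  "scale_measure (ennreal c) M = density M (\<lambda>_. ennreal c)"
  by (rule measure_eqI) (auto simp: emeasure_density nn_integral_cmult_indicator)

lemma emeasure_sphere_area_space: "emeasure (sphere_area :: 'a::euclidean_space measure) (sphere 0 1) < \<infinity>"
proof -
  have "emeasure (distr (restrict_space lborel (ball 0 1 - {0})) (restrict_space borel (sphere 0 1))
       (\<lambda>x::'a. x /\<^sub>R norm x)) (sphere 0 1) \<le> emeasure lborel (ball 0 1 - {0::'a})"
    by (subst emeasure_distr[OF measurable_radial])
       (auto simp: sets_restrict_space_iff emeasure_restrict_space space_restrict_space intro!: emeasure_mono)
  also have "\<dots> < \<infinity>"
    by (rule emeasure_bounded_finite, rule bounded_subset[OF bounded_ball]) auto
  finally show ?thesis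
    by (simp add: sphere_area_def ennreal_mult_less_top of_nat_less_top)
qed

interpretation sphere_area: finite_measure "sphere_area :: 'a::euclidean_space measure"
  by standard (use emeasure_sphere_area_space[where 'a='a] in \<open>auto simp: space_sphere_area\<close>)

lemma borel_measurable_sphere_area:
  fixes h :: "'a::euclidean_space \<Rightarrow> real"
  assumes "continuous_on (sphere 0 1) h"
  shows "h \<in> borel_measurable sphere_area"
  using borel_measurable_continuous_on_restrict[OF assms] measurable_cong_sets[OF sets_sphere_area refl] by blast

lemma continuous_on_sphere_bounded:
  fixes h :: "'a::euclidean_space \<Rightarrow> real"
  assumes "continuous_on (sphere 0 1) h"
  obtains B where "\<And>x. x \<in> sphere 0 1 \<Longrightarrow> norm (h x) \<le> B"
proof -
  have "bounded (h ` sphere 0 1)"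
    by (intro compact_imp_bounded compact_continuous_image assms compact_sphere)
  then show ?thesis using that unfolding bounded_iff by blast
qed

lemma continuous_on_radial:
  fixes h :: "'a::euclidean_space \<Rightarrow> real"
  assumes "continuous_on (sphere 0 1) h"
  shows "continuous_on (- {0}) (\<lambda>x. h (x /\<^sub>R norm x))"
proof (rule continuous_on_compose2[OF assms])
  show "continuous_on (- {0}) (\<lambda>x::'a. x /\<^sub>R norm x)" by (auto intro!: continuous_intros)
  show "(\<lambda>x::'a. x /\<^sub>R norm x) ` (- {0}) \<subseteq> sphere 0 1" by (rule image_subsetI) simp
qed

lemma integrable_sphere_area:
  fixes h :: "'a::euclidean_space \<Rightarrow> real"
  assumes "continuous_on (sphere 0 1) h"
  shows "integrable sphere_area h"
proof -
  obtain B where "\<And>x. x \<in> sphere 0 1 \<Longrightarrow> norm (h x) \<le> B"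
    using continuous_on_sphere_bounded[OF assms] by blast
  then show ?thesis
    by (intro sphere_area.integrable_const_bound[of _ B] borel_measurable_sphere_area assms AE_I2)
       (auto simp: space_sphere_area)
qed

lemma integral_sphere_area:
  fixes h :: "'a::euclidean_space \<Rightarrow> real"
  assumes "continuous_on (sphere 0 1) h"
  shows "integral\<^sup>L sphere_area h
    = real DIM('a) * (\<integral>x. indicator (ball 0 1 - {0}) x * h (x /\<^sub>R norm x) \<partial>lborel)"
proof -
  let ?M = "distr (restrict_space lborel (ball 0 1 - {0})) (restrict_space borel (sphere 0 1)) (\<lambda>x::'a. x /\<^sub>R norm x)"
  have h: "h \<in> borel_measurable (restrict_space borel (sphere 0 1))"
    by (rule borel_measurable_continuous_on_restrict[OF assms])
  then have h': "h \<in> borel_measurable ?M" by simp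
  have "sphere_area = density ?M (\<lambda>_. ennreal (real DIM('a)))"
    by (simp add: sphere_area_def ennreal_of_nat_eq_real_of_nat scale_measure_density)
  then have "integral\<^sup>L sphere_area h = (\<integral>x. real DIM('a) * h x \<partial>?M)"
    using integral_density[OF h', of "\<lambda>_. real DIM('a)"] by simp
  also have "\<dots> = real DIM('a) * (\<integral>x. h (x /\<^sub>R norm x) \<partial>restrict_space lborel (ball 0 1 - {0}))"
    by (simp add: integral_distr[OF measurable_radial h])
  also have "(\<integral>x. h (x /\<^sub>R norm x) \<partial>restrict_space lborel (ball 0 1 - {0}))
     = (\<integral>x. indicator (ball 0 1 - {0}) x * h (x /\<^sub>R norm x) \<partial>lborel)"
    by (subst integral_restrict_space) auto
  finally show ?thesis .
qed

text \<open>An orthogonal map commutes with x / |x| and preserves the punctured ball, so on the cone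
  the invariance of Lebesgue measure applies.\<close>

lemma integral_sphere_area_orthogonal:
  fixes h :: "'a::euclidean_space \<Rightarrow> real" and \<rho> :: "'a \<Rightarrow> 'a"
  assumes h: "continuous_on (sphere 0 1) h" and \<rho>: "orthogonal_transformation \<rho>"
  shows "(\<integral>x. h (\<rho> x) \<partial>sphere_area) = (\<integral>x. h x \<partial>sphere_area)"
proof -
  have lin: "linear \<rho>" and nrm: "\<And>x. norm (\<rho> x) = norm x"
    using \<rho> by (auto simp: orthogonal_transformation)
  have cont: "continuous_on A \<rho>" for A
    using lin by (intro linear_continuous_on linear_conv_bounded_linear[THEN iffD1])
  then have m: "\<rho> \<in> borel_measurable borel" by (intro borel_measurable_continuous_onI)
  let ?H = "\<lambda>x. indicator (ball 0 1 - {0}) x * h (x /\<^sub>R norm x)"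
  have z: "\<rho> x = 0 \<longleftrightarrow> x = 0" for x using nrm[of x] by (metis norm_eq_zero)
  have "continuous_on (sphere 0 1) (\<lambda>x. h (\<rho> x))"
    by (rule continuous_on_compose2[OF h cont]) (auto simp: nrm)
  note integral_sphere_area[OF this]
  also have "(\<lambda>x. indicator (ball 0 1 - {0}) x * h (\<rho> (x /\<^sub>R norm x))) = (\<lambda>x. ?H (\<rho> x))"
    by (auto simp: fun_eq_iff indicator_def nrm z linear_scale[OF lin])
  also have "(\<integral>x. ?H (\<rho> x) \<partial>lborel) = (\<integral>x. ?H x \<partial>distr lborel borel \<rho>)"
  proof (rule integral_distr[symmetric])
    show "\<rho> \<in> lborel \<rightarrow>\<^sub>M borel" using m by simp
    have "continuous_on (ball 0 1 - {0}) (\<lambda>x. h (x /\<^sub>R norm x))"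
      by (rule continuous_on_subset[OF continuous_on_radial[OF h]]) auto
    then have "(\<lambda>x. indicator (ball 0 1 - {0}) x *\<^sub>R h (x /\<^sub>R norm x)) \<in> borel_measurable borel"
      by (intro borel_measurable_continuous_on_indicator) auto
    then show "?H \<in> borel_measurable borel" by simp
  qed
  also have "distr lborel borel \<rho> = lborel" by (rule lborel_distr_orthogonal[OF \<rho>])
  also have "real DIM('a) * (\<integral>x. ?H x \<partial>lborel) = (\<integral>x. h x \<partial>sphere_area)"
    by (rule integral_sphere_area[OF h, symmetric])
  finally show ?thesis .
qed

text \<open>If \<open>h\<close> were nonzero at a point, the integrand over the ball would be
  nonzero on an open cone, which has positive volume.\<close>

lemma integral_sphere_area_eq_0:
  fixes h :: "'a::euclidean_space \<Rightarrow> real"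
  assumes h: "continuous_on (sphere 0 1) h" and nn: "\<And>x. x \<in> sphere 0 1 \<Longrightarrow> h x \<ge> 0"
    and 0: "(\<integral>x. h x \<partial>sphere_area) = 0" and x: "x \<in> sphere 0 1"
  shows "h x = 0"
proof (rule ccontr)
  assume ne: "h x \<noteq> 0"
  let ?H = "\<lambda>x. indicator (ball 0 1 - {0}) x * h (x /\<^sub>R norm x)"
  have c: "continuous_on (ball 0 1 - {0}) (\<lambda>x. h (x /\<^sub>R norm x))"
    by (rule continuous_on_subset[OF continuous_on_radial[OF h]]) auto
  obtain B where B: "\<And>x. x \<in> sphere 0 1 \<Longrightarrow> norm (h x) \<le> B"
    using continuous_on_sphere_bounded[OF h] by blast
  have "(\<lambda>x. indicator (ball 0 1 - {0}) x *\<^sub>R h (x /\<^sub>R norm x)) \<in> borel_measurable borel"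
    using c by (intro borel_measurable_continuous_on_indicator) auto
  then have m: "?H \<in> borel_measurable lborel" by simp
  have int: "integrable lborel ?H"
  proof (rule Bochner_Integration.integrable_bound[OF _ m])
    show "integrable lborel (\<lambda>x. B * indicator (ball 0 1 - {0::'a}) x)"
      using emeasure_bounded_finite[of "ball 0 1 - {0::'a}"]
      by (intro integrable_mult_right integrable_real_indicator) (auto simp: bounded_subset[OF bounded_ball])
    show "AE x in lborel. norm (?H x) \<le> norm (B * indicator (ball 0 1 - {0}) x)"
    proof (rule AE_I2)
      fix x :: 'a show "norm (?H x) \<le> norm (B * indicator (ball 0 1 - {0}) x)"
        using B[of "x /\<^sub>R norm x"] by (cases "x = 0") (auto simp: indicator_def)
    qed
  qed
  have nnH: "?H x \<ge> 0" for x using nn[of "x /\<^sub>R norm x"] by (cases "x = 0") (auto simp: indicator_def)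
  have "(\<integral>x. ?H x \<partial>lborel) = 0" using 0 integral_sphere_area[OF h] by simp
  then have ae: "AE x in lborel. ?H x = 0"
    using integral_nonneg_eq_0_iff_AE[OF int] nnH by simp
  define W where "W = {y \<in> ball 0 1 - {0}. h (y /\<^sub>R norm y) \<in> - {0}}"
  have "open W"
    unfolding W_def using continuous_open_preimage[OF c, of "- {0}"] by (auto simp: vimage_def Int_def)
  \<comment> \<open>Half of \<open>x\<close>, because \<open>x\<close> itself lies on the boundary
    of the ball.\<close>
  moreover have "(1 / 2) *\<^sub>R x \<in> W" using x ne by (auto simp: W_def)
  moreover have "negligible W"
  proof -
    have "AE y in lborel. y \<notin> W" using ae by eventually_elim (auto simp: W_def indicator_def)
    then have "W \<in> null_sets lborel" using \<open>open W\<close> by (subst (asm) AE_iff_null_sets[symmetric]) auto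
    then show ?thesis by (simp add: negligible_iff_null_sets null_sets_completionI)
  qed
  ultimately show False using open_not_negligible by blast
qed

text \<open>For orthonormal \<open>a\<close> and \<open>b\<close> this is the rotation of their
  plane by the angle \<open>t\<close>, written as a correction of the identity so that the
  orthogonal complement stays fixed without splitting \<open>x\<close>.\<close>

definition plane_rot :: "'a::euclidean_space \<Rightarrow> 'a \<Rightarrow> real \<Rightarrow> 'a \<Rightarrow> 'a" where
  "plane_rot a b t x = x + ((cos t - 1) * (x \<bullet> a) - sin t * (x \<bullet> b)) *\<^sub>R a
     + (sin t * (x \<bullet> a) + (cos t - 1) * (x \<bullet> b)) *\<^sub>R b"

lemma plane_rot_orthogonal:
  assumes "norm a = 1" "norm b = 1" "a \<bullet> b = 0"
  shows "orthogonal_transformation (plane_rot a b t)"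
  unfolding orthogonal_transformation_def
proof
  show "linear (plane_rot a b t)"
    by (rule linearI) (simp_all add: plane_rot_def algebra_simps inner_add_left)
  have [simp]: "a \<bullet> a = 1" "b \<bullet> b = 1" "a \<bullet> b = 0" "b \<bullet> a = 0"
    using assms by (auto simp: dot_square_norm inner_commute)
  show "\<forall>v w. plane_rot a b t v \<bullet> plane_rot a b t w = v \<bullet> w"
  proof (intro allI)
    fix v w
    have c: "cos t * cos t = 1 - sin t * sin t" using sin_cos_squared_add[of t] by (simp add: power2_eq_square)
    show "plane_rot a b t v \<bullet> plane_rot a b t w = v \<bullet> w"
      unfolding plane_rot_def
      by (simp add: inner_add_left inner_add_right inner_commute[of a v] inner_commute[of b v] inner_commute[of a w] inner_commute[of b w])
         (use c in algebra)
  qed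
qed

lemma smooth_punct_continuous_sphere:
  "smooth_punct F \<Longrightarrow> continuous_on (sphere 0 1) F"
  by (rule continuous_on_subset[OF smooth_punct_continuous]) auto

text \<open>The divergence theorem on the sphere, in terms of the Killing fields \<open>(x \<bullet> a) b - (x \<bullet> b) a\<close>,
  which span the tangent spaces: differentiate the rotation invariance of the integral.\<close>

lemma integral_sphere_area_rot:
  fixes F :: "'a::euclidean_space \<Rightarrow> real"
  assumes F: "smooth_punct F" and ab: "norm a = 1" "norm b = 1" "a \<bullet> b = 0"
  shows "(\<integral>x. (x \<bullet> a) * pd b F x - (x \<bullet> b) * pd a F x \<partial>sphere_area) = 0"
proof -
  define G where "G = (\<lambda>x. (x \<bullet> a) * pd b F x - (x \<bullet> b) * pd a F x)"
  have orth: "orthogonal_transformation (plane_rot a b t)" for t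
    by (rule plane_rot_orthogonal[OF ab])
  have nrm: "norm (plane_rot a b t x) = norm x" for t x
    using orth by (simp add: orthogonal_transformation)
  have sG: "smooth_punct G" unfolding G_def by (intro smooth_punct_intros F)
  have cG: "continuous_on (sphere 0 1) G" and cF: "continuous_on (sphere 0 1) F"
    using sG F smooth_punct_continuous_sphere by auto
  obtain B where B: "\<And>x. x \<in> sphere 0 1 \<Longrightarrow> norm (G x) \<le> B"
    using continuous_on_sphere_bounded[OF cG] by blast
  have [simp]: "a \<bullet> a = 1" "b \<bullet> b = 1" "a \<bullet> b = 0" "b \<bullet> a = 0"
    using ab by (auto simp: dot_square_norm inner_commute)
  have der: "((\<lambda>t. F (plane_rot a b t x)) has_real_derivative G (plane_rot a b t x)) (at t)"
    if x: "x \<in> sphere 0 1" for t x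
  proof -
    let ?y = "plane_rot a b t x"
    have y: "?y \<noteq> 0" using x nrm[of t x] by auto
    \<comment> \<open>The velocity of the rotation is the Killing field at the rotated point, so the
      derivative is \<open>G\<close> at that point for every \<open>t\<close>.\<close>
    have "((\<lambda>t. plane_rot a b t x) has_derivative (\<lambda>s. s *\<^sub>R (- (?y \<bullet> b) *\<^sub>R a + (?y \<bullet> a) *\<^sub>R b))) (at t)"
      unfolding plane_rot_def
      by (auto intro!: derivative_eq_intros simp: inner_add_left algebra_simps)
    then have "((\<lambda>t. F (plane_rot a b t x)) has_derivative
        (\<lambda>s. pd (s *\<^sub>R (- (?y \<bullet> b) *\<^sub>R a + (?y \<bullet> a) *\<^sub>R b)) F ?y)) (at t)"
      by (rule has_derivative_compose[where g=F and f="\<lambda>t. plane_rot a b t x" and g'="\<lambda>v. pd v F ?y", OF _ smooth_punct_deriv[OF F y]])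
    moreover have "pd (s *\<^sub>R (- (?y \<bullet> b) *\<^sub>R a + (?y \<bullet> a) *\<^sub>R b)) F ?y = G ?y * s" for s
      unfolding linear_scale[OF pd_linear[OF F y]] linear_add[OF pd_linear[OF F y]]
      by (simp add: G_def algebra_simps)
    ultimately show ?thesis by (simp add: has_field_derivative_def)
  qed
  have rot0: "plane_rot a b 0 x = x" for x by (simp add: plane_rot_def)
  \<comment> \<open>Times 1 / (k + 1) tending to 0. By rotation invariance every difference quotient
    \<open>s k\<close> has integral zero, and the quotients converge to \<open>G\<close>.\<close>
  define t where "t = (\<lambda>k. inverse (real (Suc k)))"
  have t: "t k > 0" for k by (simp add: t_def)
  define s where "s = (\<lambda>k x. (F (plane_rot a b (t k) x) - F x) / t k)"
  have controt: "continuous_on (sphere 0 1) (\<lambda>x. F (plane_rot a b r x))" for r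
    by (rule continuous_on_compose2[OF cF, of _ "plane_rot a b r"])
       (auto simp: nrm intro!: linear_continuous_on linear_conv_bounded_linear[THEN iffD1] orthogonal_transformation_linear orth)
  have cs: "continuous_on (sphere 0 1) (s k)" for k
    unfolding s_def using t[of k] by (intro continuous_intros controt cF) auto
  have s0: "(\<integral>x. s k x \<partial>sphere_area) = 0" for k
    using integral_sphere_area_orthogonal[OF cF orth, of "t k"]
    by (simp add: s_def integrable_sphere_area controt cF)
  have "(\<lambda>k. \<integral>x. s k x \<partial>sphere_area) \<longlonglongrightarrow> (\<integral>x. G x \<partial>sphere_area)"
  proof (rule integral_dominated_convergence[where w="\<lambda>_. B"])
    show "AE x in sphere_area. (\<lambda>k. s k x) \<longlonglongrightarrow> G x"
    proof (rule AE_I2)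
      fix x :: 'a assume "x \<in> space sphere_area"
      then have x: "x \<in> sphere 0 1" by (simp add: space_sphere_area)
      have "((\<lambda>h. (F (plane_rot a b h x) - F x) / h) \<longlongrightarrow> G x) (at 0)"
        using der[OF x, of 0] unfolding DERIV_def by (simp add: rot0)
      moreover have "filterlim t (at 0) sequentially"
        using LIMSEQ_inverse_real_of_nat t unfolding filterlim_at t_def by (auto simp: t_def)
      ultimately show "(\<lambda>k. s k x) \<longlonglongrightarrow> G x"
        unfolding s_def by (rule filterlim_compose)
    qed
    show "AE x in sphere_area. norm (s k x) \<le> B" for k
    proof (rule AE_I2)
      fix x :: 'a assume "x \<in> space sphere_area"
      then have x: "x \<in> sphere 0 1" by (simp add: space_sphere_area)
      \<comment> \<open>The quotient is a value of \<open>G\<close> at an intermediate rotated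
        point; this gives the uniform bound for dominated convergence.\<close>
      have "\<exists>r>0. r < t k \<and> F (plane_rot a b (t k) x) - F (plane_rot a b 0 x) = (t k - 0) * G (plane_rot a b r x)"
        by (rule MVT2[OF t]) (rule der[OF x])
      then obtain r where "F (plane_rot a b (t k) x) - F x = t k * G (plane_rot a b r x)"
        by (auto simp: rot0)
      then have "s k x = G (plane_rot a b r x)" using t[of k] by (simp add: s_def)
      then show "norm (s k x) \<le> B" using B[of "plane_rot a b r x"] x by (simp add: nrm)
    qed
  qed (auto intro: borel_measurable_sphere_area cG cs)
  then show ?thesis using s0 LIMSEQ_unique[OF _ tendsto_const] unfolding G_def by simp
qed

subsection \<open>Determinants\<close>

text \<open>Multilinearity in the rows: every term with \<open>b\<close> in two rows vanishes, so
  only first-order corrections survive.\<close>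

lemma det_add_rank1_rows:
  fixes A :: "real^'n^'n"
  assumes "finite S"
  shows "det (\<chi> i. if i \<in> S then A $ i + a i *s b else A $ i)
     = det A + (\<Sum>i\<in>S. a i * det (\<chi> r. if r = i then b else A $ r))"
  using assms
proof (induction S arbitrary: A)
  case empty
  then show ?case by (simp add: vec_lambda_eta)
next
  case (insert k S)
  define A' where "A' = (\<chi> i. if i = k then A $ k + a k *s b else A $ i)"
  have 1: "(\<chi> i. if i \<in> insert k S then A $ i + a i *s b else A $ i)
      = (\<chi> i. if i \<in> S then A' $ i + a i *s b else A' $ i)"
    using insert(2) by (auto simp: A'_def vec_eq_iff)
  have split: "det (\<chi> i. if i = k then c + a k *s b else B $ i)
     = det (\<chi> i. if i = k then c else B $ i) + a k * det (\<chi> i. if i = k then b else B $ i)" for c and B :: "real^'n^'n"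
    using det_row_add[of k "\<lambda>_. c" "\<lambda>_. a k *s b" "\<lambda>i. B $ i"] det_row_mul[of k "a k" "\<lambda>_. b" "\<lambda>i. B $ i"] by simp
  have A: "(\<chi> i. if i = k then A $ k else A $ i) = A" by (auto simp: vec_eq_iff)
  have 2: "det A' = det A + a k * det (\<chi> r. if r = k then b else A $ r)"
    unfolding A'_def split A ..
  \<comment> \<open>Row \<open>i\<close> is already \<open>b\<close>, so the multiple of
    \<open>b\<close> added to row \<open>k\<close> of \<open>A'\<close> does not change this
    determinant.\<close>
  have 3: "det (\<chi> r. if r = i then b else A' $ r) = det (\<chi> r. if r = i then b else A $ r)" if "i \<in> S" for i
  proof -
    have ik: "i \<noteq> k" using insert(2) that by auto
    define B where "B = (\<chi> r. if r = i then b else A $ r)"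
    have e: "(\<chi> r. if r = i then b else A' $ r) = (\<chi> r. if r = k then A $ k + a k *s b else B $ r)"
      using ik by (auto simp: A'_def B_def vec_eq_iff)
    have "det (\<chi> r. if r = k then b else B $ r) = 0"
      by (rule det_identical_rows[OF ik]) (use ik in \<open>simp add: row_def B_def vec_eq_iff\<close>)
    moreover have "(\<chi> r. if r = k then A $ k else B $ r) = B"
      using ik by (auto simp: B_def vec_eq_iff)
    ultimately show ?thesis unfolding e split by (simp add: B_def)
  qed
  show ?case unfolding 1 insert.IH 2 using insert(1,2) by (simp add: 3)
qed

lemma det_add_multiples_of_row:
  fixes A :: "real^'n^'n"
  shows "det (\<chi> k. if k = i then A $ i else A $ k + c k *s (A $ i)) = det A"
proof -
  have "(\<chi> k. if k = i then A $ i else A $ k + c k *s (A $ i)) = (\<chi> k. if k \<in> - {i} then A $ k + c k *s (A $ i) else A $ k)"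
    by (auto simp: vec_eq_iff)
  moreover have "det (\<chi> r. if r = k then A $ i else A $ r) = 0" if "k \<noteq> i" for k
    by (rule det_identical_rows[of k i]) (use that in \<open>simp_all add: row_def vec_eq_iff\<close>)
  ultimately show ?thesis using det_add_rank1_rows[of "- {i}" A c "A $ i"] by simp
qed

lemma det_unit_row:
  fixes v :: "real^'n"
  shows "det (\<chi> r. if r = k then v else axis r 1) = v $ k"
proof -
  have r: "row i (mat 1 :: real^'n^'n) = axis i 1" for i by (auto simp: row_def mat_def axis_def vec_eq_iff)
  show ?thesis using cramer_lemma_transpose[of k v "mat 1"] unfolding r basis_expansion by simp
qed

text \<open>Linearity in row \<open>i\<close>: among the unit vectors that can replace
  \<open>v\<close>, only those with index \<open>i\<close> or \<open>k\<close> avoid a repeated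
  row.\<close>

lemma det_two_unit_rows:
  fixes v w :: "real^'n"
  assumes ik: "i \<noteq> k"
  shows "det (\<chi> r. if r = i then v else if r = k then w else axis r 1) = v $ i * w $ k - v $ k * w $ i"
proof -
  let ?D = "\<lambda>v. det (\<chi> r. if r = i then v else if r = k then w else axis r 1)"
  have "?D v = ?D (\<Sum>l\<in>UNIV. v $ l *s axis l 1)" by (simp only: basis_expansion)
  also have "\<dots> = (\<Sum>l\<in>UNIV. v $ l * ?D (axis l 1))"
    using det_linear_row_sum[of UNIV i "\<lambda>_ l. v $ l *s axis l (1::real)" "\<lambda>r. if r = k then w else axis r 1"]
      det_row_mul[of i _ "\<lambda>_. axis _ 1" "\<lambda>r. if r = k then w else axis r 1"] by simp
  also have "\<dots> = (\<Sum>l\<in>UNIV. (if l = i then v $ i * w $ k else 0) - (if l = k then v $ k * w $ i else 0))"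
  proof (rule sum.cong[OF refl])
    fix l
    consider "l = i" | "l = k" | "l \<noteq> i" "l \<noteq> k" by blast
    then show "v $ l * ?D (axis l 1) = (if l = i then v $ i * w $ k else 0) - (if l = k then v $ k * w $ i else 0)"
    proof cases
      case 1
      have "(\<chi> r. if r = i then axis i 1 else if r = k then w else axis r 1) = (\<chi> r. if r = k then w else axis r (1::real))"
        using ik by (auto simp: vec_eq_iff)
      then have "?D (axis i 1) = w $ k" using det_unit_row[of k w] by (simp only:)
      then show ?thesis unfolding 1 using ik by simp
    next
      case 2
      let ?A = "\<chi> r. if r = i then w else axis r (1::real)"
      \<comment> \<open>Exchanging rows \<open>i\<close> and \<open>k\<close> leaves the unit matrix
        with only row \<open>i\<close> replaced; hence the minus sign.\<close>
      have "(\<chi> r. if r = i then axis k 1 else if r = k then w else axis r 1) = (\<chi> r. ?A $ (Transposition.transpose i k r))"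
        using ik by (auto simp: vec_eq_iff Transposition.transpose_def)
      then have "?D (axis k 1) = - det ?A"
        using det_permute_rows[of "Transposition.transpose i k" ?A] ik by (simp add: permutes_swap_id sign_swap_id)
      then show ?thesis unfolding 2 using ik det_unit_row[of i w] by simp
    next
      case 3
      have "?D (axis l 1) = 0"
        by (rule det_identical_rows[of i l]) (use 3 in \<open>simp_all add: row_def vec_eq_iff\<close>)
      then show ?thesis using 3 by simp
    qed
  qed
  also have "\<dots> = v $ i * w $ k - v $ k * w $ i" by (simp add: sum_subtractf)
  finally show ?thesis .
qed

text \<open>Rank-one expansion around the unit matrix with row \<open>i\<close> replaced by
  \<open>x\<close>; each correction is a two-by-two minor. The minor with k = i is zero, which lets
  the sum run over all indices.\<close>

lemma det_skew_projection:
  fixes x p :: "real^'n"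
  shows "det (\<chi> k. if k = i then x else axis k 1 + c k *s p)
    = x $ i + (\<Sum>k\<in>UNIV. c k * (x $ i * p $ k - x $ k * p $ i))"
proof -
  define A where "A = (\<chi> r. if r = i then x else axis r (1::real))"
  have 1: "(\<chi> k. if k = i then x else axis k 1 + c k *s p) = (\<chi> k. if k \<in> - {i} then A $ k + c k *s p else A $ k)"
    by (auto simp: A_def vec_eq_iff)
  have 2: "det (\<chi> r. if r = k then p else A $ r) = x $ i * p $ k - x $ k * p $ i" if "k \<noteq> i" for k
  proof -
    have "(\<chi> r. if r = k then p else A $ r) = (\<chi> r. if r = i then x else if r = k then p else axis r (1::real))"
      using that by (auto simp: A_def vec_eq_iff)
    then show ?thesis using det_two_unit_rows[of i k x p] that by simp
  qed
  have "det (\<chi> k. if k = i then x else axis k 1 + c k *s p)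
    = x $ i + (\<Sum>k\<in>- {i}. c k * (x $ i * p $ k - x $ k * p $ i))"
    unfolding 1 det_add_rank1_rows[OF finite]
    by (simp add: 2 A_def[symmetric] det_unit_row[of i x, folded A_def])
  also have "(\<Sum>k\<in>- {i}. c k * (x $ i * p $ k - x $ k * p $ i)) = (\<Sum>k\<in>UNIV. c k * (x $ i * p $ k - x $ k * p $ i))"
    by (rule sum.mono_neutral_left) auto
  finally show ?thesis .
qed

text \<open>Let \<open>y = p + \<beta> (x + a)\<close>, where \<open>p\<close> is the gradient and \<open>S - \<beta> I\<close> the Hessian of a
  1-homogeneous function \<open>u\<close>. If the gradient of \<open>\<beta>\<close> is \<open>- S p / u\<close>, the matrix below is the
  Jacobian of \<open>y\<close> with one row replaced by the unit normal.\<close>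

lemma det_horospherical:
  fixes S :: "real^'n^'n" and x p a :: "real^'n"
  assumes sym: "transpose S = S" and x: "x \<bullet> x = 1" and Sx: "S *v x = \<beta> *s x" and px: "p \<bullet> x = u" and u: "u \<noteq> 0"
  shows "det (\<chi> k. if k = i then x else S $ k - ((x + a) $ k / u) *s (S *v p))
    = (p $ i + (a \<bullet> x) * p $ i - (a \<bullet> p) * x $ i) / u * det (S + (\<chi> k. ((1 - \<beta>) * x $ k) *s x))"
proof -
  \<comment> \<open>\<open>x\<close> is an eigenvector of \<open>S\<close> with eigenvalue \<beta>.
    The added term changes this eigenvalue to 1, so \<open>K\<close> fixes \<open>x\<close> and det
    K is the determinant of \<open>S\<close> on the tangent space.\<close>
  define K where "K = S + (\<chi> k. ((1 - \<beta>) * x $ k) *s x)"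
  define N where "N = (\<chi> k. if k = i then x else axis k 1 + (- ((x + a) $ k / u)) *s p)"
  have vS: "v v* S = S *v v" for v using sym by (metis transpose_matrix_vector)
  have rows: "(N ** K) $ k = (N $ k) v* K" for k
    by (simp add: vec_eq_iff matrix_matrix_mult_def vector_matrix_mult_def mult.commute)
  have vK: "v v* K = S *v v + ((1 - \<beta>) * (v \<bullet> x)) *s x" for v
  proof -
    have "v v* (\<chi> k. ((1 - \<beta>) * x $ k) *s x) = ((1 - \<beta>) * (v \<bullet> x)) *s x"
      by (simp add: vec_eq_iff vector_matrix_mult_def inner_vec_def sum_distrib_left sum_distrib_right mult_ac)
    moreover have "v v* (A + B) = v v* A + v v* B" for A B :: "real^'n^'n"
      by (simp add: vec_eq_iff vector_matrix_mult_def sum.distrib algebra_simps)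
    ultimately show ?thesis unfolding K_def by (simp add: vS)
  qed
  have xK: "x v* K = x" by (simp add: vK x Sx vec_eq_iff algebra_simps)
  have eK: "axis k 1 v* K = S $ k + ((1 - \<beta>) * x $ k) *s x" for k
  proof -
    have "S *v axis k 1 = S $ k" using sym by (simp add: vec_eq_iff matrix_vector_mul_component cart_eq_inner_axis[symmetric] Finite_Cartesian_Product.transpose_def)
    then show ?thesis by (simp add: vK inner_commute[of "axis k 1"] inner_axis)
  qed
  have lin: "(v + c *s w) v* K = v v* K + c *s (w v* K)" for v w c
    by (simp add: vec_eq_iff vector_matrix_mult_def sum.distrib algebra_simps sum_distrib_left)
  define M where "M = (\<chi> k. if k = i then x else S $ k - ((x + a) $ k / u) *s (S *v p))"
  \<comment> \<open>By p \<bullet> x = u the radial terms of row k cancel except for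
    \<open>- (1 - \<beta>) * a $ k\<close> times \<open>x\<close>. Since row \<open>i\<close> is
    \<open>x\<close>, this remainder does not affect the determinant.\<close>
  have NK: "N ** K = (\<chi> k. if k = i then M $ i else M $ k + (- (1 - \<beta>) * a $ k) *s (M $ i))"
  proof -
    have "(N ** K) $ k = (if k = i then M $ i else M $ k + (- (1 - \<beta>) * a $ k) *s (M $ i))" for k
    proof (cases "k = i")
      case True
      then show ?thesis unfolding rows by (simp add: N_def M_def xK)
    next
      case False
      have "(N ** K) $ k = (axis k 1 + (- ((x + a) $ k / u)) *s p) v* K"
        unfolding rows using False by (simp add: N_def)
      also have "\<dots> = S $ k + ((1 - \<beta>) * x $ k) *s x + (- ((x + a) $ k / u)) *s (S *v p + ((1 - \<beta>) * u) *s x)"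
        unfolding lin eK by (simp add: vK px)
      also have "\<dots> = M $ k + (- (1 - \<beta>) * a $ k) *s x"
        using u False by (simp add: M_def vec_eq_iff field_simps)
      finally show ?thesis using False by (simp add: M_def)
    qed
    then show ?thesis by (simp add: vec_eq_iff)
  qed
  have "det M = det (N ** K)" unfolding NK by (rule det_add_multiples_of_row[symmetric])
  also have "\<dots> = det N * det K" by (rule det_mul)
  also have "det N = x $ i + (\<Sum>k\<in>UNIV. - ((x + a) $ k / u) * (x $ i * p $ k - x $ k * p $ i))"
    unfolding N_def by (rule det_skew_projection)
  also have "(\<Sum>k\<in>UNIV. - ((x + a) $ k / u) * (x $ i * p $ k - x $ k * p $ i))
    = - (x $ i * ((x + a) \<bullet> p) - p $ i * ((x + a) \<bullet> x)) / u"
    by (simp add: inner_vec_def sum_distrib_left sum_subtractf[symmetric] sum_divide_distrib sum_negf[symmetric] algebra_simps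
        del: sum_negf) (simp add: diff_divide_distrib add_divide_distrib)
  also have "x $ i + \<dots> = (p $ i + (a \<bullet> x) * p $ i - (a \<bullet> p) * x $ i) / u"
    using u x px by (simp add: inner_add_left inner_commute[of x p] field_simps)
  finally show ?thesis by (simp add: M_def K_def)
qed

subsection \<open>Integrals of Jacobian determinants\<close>

definition grad :: "(real^'n \<Rightarrow> real) \<Rightarrow> real^'n \<Rightarrow> real^'n" where
  "grad F x = (\<chi> j. pd (axis j 1) F x)"

text \<open>Right composition with a transposition permutes the index set of the Leibniz formula and
  reverses every sign.\<close>

lemma sum_sign_transpose:
  fixes g :: "('n::finite \<Rightarrow> 'n) \<Rightarrow> real"
  assumes "a \<noteq> b"
  shows "(\<Sum>\<pi> | \<pi> permutes UNIV. of_int (sign \<pi>) * g \<pi>)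
     = - (\<Sum>\<pi> | \<pi> permutes UNIV. of_int (sign \<pi>) * g (\<pi> \<circ> Transposition.transpose a b))"
proof -
  have "(\<Sum>\<pi> | \<pi> permutes UNIV. of_int (sign \<pi>) * g \<pi>)
    = (\<Sum>\<pi> | \<pi> permutes UNIV. of_int (sign (\<pi> \<circ> Transposition.transpose a b)) * g (\<pi> \<circ> Transposition.transpose a b))"
    by (rule sum_permutations_compose_right) (simp add: permutes_swap_id)
  also have "\<dots> = (\<Sum>\<pi> | \<pi> permutes UNIV. - (of_int (sign \<pi>) * g (\<pi> \<circ> Transposition.transpose a b)))"
  proof (rule sum.cong[OF refl])
    fix \<pi> :: "'n \<Rightarrow> 'n" assume "\<pi> \<in> {\<pi>. \<pi> permutes UNIV}"
    then have "permutation \<pi>" by (auto simp: permutation_permutes)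
    then have "sign (\<pi> \<circ> Transposition.transpose a b) = - sign \<pi>"
      using assms by (simp add: sign_compose permutation_swap_id sign_swap_id)
    then show "of_int (sign (\<pi> \<circ> Transposition.transpose a b)) * g (\<pi> \<circ> Transposition.transpose a b) = - (of_int (sign \<pi>) * g (\<pi> \<circ> Transposition.transpose a b))"
      by simp
  qed
  finally show ?thesis by (simp add: sum_negf)
qed

lemma sum_sign_symmetric:
  fixes g :: "('n::finite \<Rightarrow> 'n) \<Rightarrow> real"
  assumes "a \<noteq> b" "\<And>\<pi>. g (\<pi> \<circ> Transposition.transpose a b) = g \<pi>"
  shows "(\<Sum>\<pi> | \<pi> permutes UNIV. of_int (sign \<pi>) * g \<pi>) = 0"
  using sum_sign_transpose[OF assms(1), of g] by (simp add: assms(2))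

lemma pd_prod:
  assumes "\<And>i. i \<in> I \<Longrightarrow> smooth_punct (F i)" "x \<noteq> 0"
  shows "pd v (\<lambda>x. \<Prod>i\<in>I. F i x) x = (\<Sum>m\<in>I. pd v (F m) x * (\<Prod>i\<in>I - {m}. F i x))"
  by (rule pd_eqI) (auto intro!: has_derivative_prod smooth_punct_deriv assms)

text \<open>Stokes' theorem for the exact form whose primitive is y_l times the product of the other
  differentials. In the Leibniz formula the normal row and row \<open>l\<close> combine to rotation
  derivatives \<open>R\<close>. These may be applied to the whole product \<open>y l * Q\<close>,
  because the extra terms are antisymmetrised second derivatives; and a rotation derivative has
  integral zero.\<close>

lemma integral_sphere_det_grad:
  fixes y :: "'n::finite \<Rightarrow> real^'n \<Rightarrow> real"
  assumes y: "\<And>k. smooth_punct (y k)" and il: "i \<noteq> l"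
  shows "(\<integral>x. det (\<chi> k. if k = i then x else grad (y k) x) \<partial>sphere_area) = 0"
proof -
  let ?P = "{\<pi>::'n \<Rightarrow> 'n. \<pi> permutes UNIV}"
  define D where "D = (\<lambda>j. pd (axis j (1::real)) :: (real^'n \<Rightarrow> real) \<Rightarrow> real^'n \<Rightarrow> real)"
  define Q where "Q = (\<lambda>\<pi> x. \<Prod>k\<in>- {i, l}. D (\<pi> k) (y k) x)"
  define R where "R = (\<lambda>\<pi> F x. x $ \<pi> i * D (\<pi> l) F x - x $ \<pi> l * D (\<pi> i) F x)"
  have sD: "smooth_punct (D j (y k))" for j k unfolding D_def by (intro smooth_punct_pd y)
  have sQ: "smooth_punct (Q \<pi>)" for \<pi> unfolding Q_def by (intro smooth_punct_prod sD)
  have scoord: "smooth_punct (\<lambda>x::real^'n. x $ j)" for j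
    using smooth_punct_inner[of "axis j (1::real)"] by (simp add: inner_axis)
  have sR: "smooth_punct (R \<pi> F)" if "smooth_punct F" for \<pi> F
    unfolding R_def D_def by (intro smooth_punct_intros scoord that)
  have det2: "2 * det (\<chi> k. if k = i then x else grad (y k) x)
     = (\<Sum>\<pi>\<in>?P. of_int (sign \<pi>) * (R \<pi> (y l) x * Q \<pi> x))" for x
  proof -
    have U: "(UNIV :: 'n set) = insert i (insert l (- {i, l}))" by auto
    have pr: "prod f UNIV = f i * (f l * prod f (- {i, l}))" for f :: "'n \<Rightarrow> real"
      by (subst U) (use il in simp)
    have "det (\<chi> k. if k = i then x else grad (y k) x)
      = (\<Sum>\<pi>\<in>?P. of_int (sign \<pi>) * (x $ \<pi> i * D (\<pi> l) (y l) x * Q \<pi> x))"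
      unfolding det_def pr
    proof (rule sum.cong[OF refl])
      fix \<pi>
      have "(\<Prod>k\<in>- {i, l}. (\<chi> k. if k = i then x else grad (y k) x) $ k $ \<pi> k) = Q \<pi> x"
        unfolding Q_def by (rule prod.cong) (auto simp: grad_def D_def)
      then show "of_int (sign \<pi>) * ((\<chi> k. if k = i then x else grad (y k) x) $ i $ \<pi> i *
         ((\<chi> k. if k = i then x else grad (y k) x) $ l $ \<pi> l *
          (\<Prod>k\<in>- {i, l}. (\<chi> k. if k = i then x else grad (y k) x) $ k $ \<pi> k)))
        = of_int (sign \<pi>) * (x $ \<pi> i * D (\<pi> l) (y l) x * Q \<pi> x)"
        using il by (simp add: grad_def D_def)
    qed
    \<comment> \<open>Exchanging the values of \<pi> at \<open>i\<close> and \<open>l\<close> leaves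
      \<open>Q\<close> alone, so adding the two forms of the sum antisymmetrises the first two
      factors; this is the origin of the 2.\<close>
    moreover have "(\<Sum>\<pi>\<in>?P. of_int (sign \<pi>) * (x $ \<pi> i * D (\<pi> l) (y l) x * Q \<pi> x))
      = - (\<Sum>\<pi>\<in>?P. of_int (sign \<pi>) * (x $ \<pi> l * D (\<pi> i) (y l) x * Q \<pi> x))"
    proof -
      have "Q (\<pi> \<circ> Transposition.transpose i l) x = Q \<pi> x" for \<pi>
        unfolding Q_def by (rule prod.cong) auto
      then show ?thesis
        using sum_sign_transpose[OF il, of "\<lambda>\<pi>. x $ \<pi> i * D (\<pi> l) (y l) x * Q \<pi> x"] by simp
    qed
    ultimately have "2 * det (\<chi> k. if k = i then x else grad (y k) x)
       = (\<Sum>\<pi>\<in>?P. of_int (sign \<pi>) * (x $ \<pi> i * D (\<pi> l) (y l) x * Q \<pi> x))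
       - (\<Sum>\<pi>\<in>?P. of_int (sign \<pi>) * (x $ \<pi> l * D (\<pi> i) (y l) x * Q \<pi> x))" by simp
    then show ?thesis by (simp add: sum_subtractf[symmetric] R_def algebra_simps)
  qed
  \<comment> \<open>The counterpart of d(d y_m) = 0: the second derivative of \<open>y m\<close>
    carries two values of \<pi> and is symmetric under exchanging them.\<close>
  have closed: "(\<Sum>\<pi>\<in>?P. of_int (sign \<pi>) * R \<pi> (Q \<pi>) x) = 0" if x: "x \<noteq> 0" for x
  proof -
    \<comment> \<open>In \<open>g a b m\<close> the coordinate factor belongs to row
      \<open>a\<close>, and the derivative for row \<open>b\<close> falls on the factor of row
      \<open>m\<close>.\<close>
    define g where "g = (\<lambda>a b m \<pi>. x $ \<pi> a * (D (\<pi> b) (D (\<pi> m) (y m)) x * (\<Prod>k\<in>- {i, l} - {m}. D (\<pi> k) (y k) x)))"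
    have "R \<pi> (Q \<pi>) x = (\<Sum>m\<in>- {i, l}. g i l m \<pi> - g l i m \<pi>)" for \<pi>
    proof -
      have "D j (Q \<pi>) x = (\<Sum>m\<in>- {i, l}. D j (D (\<pi> m) (y m)) x * (\<Prod>k\<in>- {i, l} - {m}. D (\<pi> k) (y k) x))" for j
        unfolding Q_def using pd_prod[where x=x and I="- {i, l}" and F="\<lambda>k. D (\<pi> k) (y k)" and v="axis j 1"] x sD
        by (simp add: D_def)
      then show ?thesis by (simp add: R_def g_def sum_subtractf sum_distrib_left)
    qed
    then have "(\<Sum>\<pi>\<in>?P. of_int (sign \<pi>) * R \<pi> (Q \<pi>) x)
       = (\<Sum>m\<in>- {i, l}. (\<Sum>\<pi>\<in>?P. of_int (sign \<pi>) * g i l m \<pi>) - (\<Sum>\<pi>\<in>?P. of_int (sign \<pi>) * g l i m \<pi>))"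
      by (simp add: sum_distrib_left sum_subtractf[symmetric] right_diff_distrib, subst sum.swap) (rule refl)
    also have "\<dots> = 0"
    proof (rule sum.neutral, rule ballI)
      fix m assume m: "m \<in> - {i, l}"
      have comm: "D (\<pi> b) (D (\<pi> m) (y m)) x = D (\<pi> m) (D (\<pi> b) (y m)) x" for \<pi> :: "'n \<Rightarrow> 'n" and b
        unfolding D_def by (rule pd_commute[OF y x])
      have "g a b m (\<pi> \<circ> Transposition.transpose b m) = g a b m \<pi>" if "{a, b} = {i, l}" "a \<noteq> b" for a b \<pi>
      proof -
        have "a \<noteq> m" "b \<noteq> m" "b \<in> {i, l}" using that m by auto
        moreover have "(\<Prod>k\<in>- {i, l} - {m}. D ((\<pi> \<circ> Transposition.transpose b m) k) (y k) x) = (\<Prod>k\<in>- {i, l} - {m}. D (\<pi> k) (y k) x)"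
          by (rule prod.cong) (use \<open>b \<in> {i, l}\<close> in \<open>auto simp: Transposition.transpose_def\<close>)
        ultimately show ?thesis using that comm[of \<pi> b] by (simp add: g_def)
      qed
      then have "(\<Sum>\<pi>\<in>?P. of_int (sign \<pi>) * g a b m \<pi>) = 0" if "{a, b} = {i, l}" "a \<noteq> b" for a b
        using that m by (intro sum_sign_symmetric[of b m]) auto
      from this[of i l] this[of l i]
      show "(\<Sum>\<pi>\<in>?P. of_int (sign \<pi>) * g i l m \<pi>) - (\<Sum>\<pi>\<in>?P. of_int (sign \<pi>) * g l i m \<pi>) = 0"
        using il by (simp add: insert_commute)
    qed
    finally show ?thesis .
  qed
  have int: "integrable sphere_area F" if "smooth_punct F" for F :: "real^'n \<Rightarrow> real"
    by (rule integrable_sphere_area[OF smooth_punct_continuous_sphere[OF that]])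
  have Rprod: "R \<pi> (y l) x * Q \<pi> x = R \<pi> (\<lambda>x. y l x * Q \<pi> x) x - y l x * R \<pi> (Q \<pi>) x" if "x \<noteq> 0" for \<pi> x
    by (simp only: R_def D_def pd_mult[OF y sQ that]) (simp add: algebra_simps)
  have sum_eq: "2 * det (\<chi> k. if k = i then x else grad (y k) x)
     = (\<Sum>\<pi>\<in>?P. of_int (sign \<pi>) * R \<pi> (\<lambda>x. y l x * Q \<pi> x) x)" if x: "x \<noteq> 0" for x
  proof -
    have "2 * det (\<chi> k. if k = i then x else grad (y k) x)
      = (\<Sum>\<pi>\<in>?P. of_int (sign \<pi>) * R \<pi> (\<lambda>x. y l x * Q \<pi> x) x) - y l x * (\<Sum>\<pi>\<in>?P. of_int (sign \<pi>) * R \<pi> (Q \<pi>) x)"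
      unfolding det2 Rprod[OF x] by (simp add: sum_distrib_left sum_subtractf[symmetric] algebra_simps)
    then show ?thesis by (simp add: closed[OF x])
  qed
  have "(\<integral>x. 2 * det (\<chi> k. if k = i then x else grad (y k) x) \<partial>sphere_area)
    = (\<integral>x. (\<Sum>\<pi>\<in>?P. of_int (sign \<pi>) * R \<pi> (\<lambda>x. y l x * Q \<pi> x) x) \<partial>sphere_area)"
    by (rule Bochner_Integration.integral_cong[OF refl], rule sum_eq) (auto simp: space_sphere_area)
  also have "\<dots> = (\<Sum>\<pi>\<in>?P. of_int (sign \<pi>) * (\<integral>x. R \<pi> (\<lambda>x. y l x * Q \<pi> x) x \<partial>sphere_area))"
    by (subst Bochner_Integration.integral_sum) (auto intro!: int sR smooth_punct_mult y sQ)
  also have "\<dots> = 0"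
  proof (rule sum.neutral, rule ballI)
    fix \<pi> :: "'n \<Rightarrow> 'n" assume "\<pi> \<in> ?P"
    \<comment> \<open>Injectivity of \<pi> makes the two coordinate directions orthogonal, as the
      rotation identity requires.\<close>
    then have "\<pi> i \<noteq> \<pi> l" using il by (simp add: permutes_def) (metis)
    then have "axis (\<pi> i) (1::real) $ \<pi> l = 0" by (simp add: axis_def)
    then have "(\<integral>x. R \<pi> (\<lambda>x. y l x * Q \<pi> x) x \<partial>sphere_area) = 0"
      using integral_sphere_area_rot[OF smooth_punct_mult[OF y sQ], of "axis (\<pi> i) 1" "axis (\<pi> l) 1" l \<pi>]
      by (simp only: R_def D_def inner_axis inner_axis_axis norm_axis_1) simp
    then show "of_int (sign \<pi>) * (\<integral>x. R \<pi> (\<lambda>x. y l x * Q \<pi> x) x \<partial>sphere_area) = 0" by simp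
  qed
  finally show ?thesis by simp
qed

subsection \<open>Eigenbases and elementary symmetric functions\<close>

text \<open>A maximiser \<open>b\<close> of L v \<bullet> v on the unit sphere of \<open>W\<close>
  is an eigenvector, and \<open>L\<close> preserves the part of \<open>W\<close> orthogonal to
  \<open>b\<close>. Invariant subspaces serve both this induction and the tangent spaces.\<close>

lemma exists_orthonormal_eigenbasis:
  fixes L :: "'a::euclidean_space \<Rightarrow> 'a"
  assumes L: "linear L" and sym: "\<And>u v. L u \<bullet> v = u \<bullet> L v"
    and W: "subspace W" "\<And>w. w \<in> W \<Longrightarrow> L w \<in> W"
  shows "\<exists>B l. pairwise orthogonal B \<and> (\<forall>b\<in>B. norm b = 1) \<and> span B = W \<and> (\<forall>b\<in>B. L b = l b *\<^sub>R b)"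
  using W
proof (induction "dim W" arbitrary: W rule: less_induct)
  case less
  show ?case
  proof (cases "W = {0}")
    case True
    then show ?thesis by (intro exI[of _ "{}"]) auto
  next
    case False
    let ?S = "W \<inter> sphere 0 1"
    have c1: "compact ?S" by (intro closed_Int_compact closed_subspace less.prems compact_sphere)
    have c2: "?S \<noteq> {}"
    proof -
      obtain w where "w \<in> W" "w \<noteq> 0" using False subspace_0[OF less.prems(1)] by blast
      then have "w /\<^sub>R norm w \<in> ?S" using subspace_scale[OF less.prems(1)] by simp
      then show ?thesis by blast
    qed
    have c3: "continuous_on ?S (\<lambda>v. L v \<bullet> v)"
      using L by (intro continuous_intros linear_continuous_on linear_conv_bounded_linear[THEN iffD1])
    obtain b where b: "b \<in> ?S" "\<And>v. v \<in> ?S \<Longrightarrow> L v \<bullet> v \<le> L b \<bullet> b"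
      using continuous_attains_sup[OF c1 c2 c3] by blast
    define \<mu> where "\<mu> = L b \<bullet> b"
    have bW: "b \<in> W" and nb: "norm b = 1" and bb: "b \<bullet> b = 1" using b by (auto simp: dot_square_norm)
    have ray: "L v \<bullet> v \<le> \<mu> * (v \<bullet> v)" if "v \<in> W" for v
    proof (cases "v = 0")
      case False
      then have "v /\<^sub>R norm v \<in> ?S" using subspace_scale[OF less.prems(1) that] by simp
      from b(2)[OF this] have "inverse (norm v) * (inverse (norm v) * (L v \<bullet> v)) \<le> \<mu>"
        by (simp add: linear_scale[OF L] \<mu>_def)
      then show ?thesis using False by (simp add: dot_square_norm power2_eq_square field_simps)
    qed (simp add: linear_0[OF L])
    \<comment> \<open>First-order condition at the maximum: along b + t w the Rayleigh inequality
      bounds a term linear in t by a quadratic one, for all t.\<close>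
    have orth: "L b \<bullet> w = 0" if w: "w \<in> W" "w \<bullet> b = 0" for w
    proof (rule ccontr)
      assume ne: "L b \<bullet> w \<noteq> 0"
      define C where "C = \<mu> * (w \<bullet> w) - L w \<bullet> w"
      have ineq: "2 * t * (L b \<bullet> w) \<le> t\<^sup>2 * C" for t
      proof -
        have "b + t *\<^sub>R w \<in> W" using bW w less.prems(1) by (simp add: subspace_add subspace_scale)
        from ray[OF this] show ?thesis
          using w(2) sym[of w b] bb
          by (simp add: linear_add[OF L] linear_scale[OF L] inner_add_left inner_add_right inner_commute[of b w]
              inner_commute[of w "L b"] C_def \<mu>_def[symmetric] power2_eq_square algebra_simps)
      qed
      \<comment> \<open>With this \<open>t\<close> the linear term equals 2 t^2 (|C| + 1), which
        exceeds t^2 C; the added 1 keeps the denominator positive.\<close>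
      define t where "t = (L b \<bullet> w) / (\<bar>C\<bar> + 1)"
      have t: "t * (\<bar>C\<bar> + 1) = L b \<bullet> w" by (simp add: t_def add_nonneg_eq_0_iff)
      have "t \<noteq> 0" using ne t by auto
      then have t2: "t\<^sup>2 > 0" by simp
      have "2 * t\<^sup>2 * (\<bar>C\<bar> + 1) \<le> t\<^sup>2 * C"
        using ineq[of t] by (simp add: t[symmetric] power2_eq_square algebra_simps)
      then have "2 * (\<bar>C\<bar> + 1) \<le> C" using t2 by (simp add: mult.assoc mult.left_commute)
      then show False by (simp add: abs_if split: if_splits)
    qed
    have Lb: "L b = \<mu> *\<^sub>R b"
    proof -
      define w where "w = L b - \<mu> *\<^sub>R b"
      have "w \<in> W" using less.prems bW by (simp add: w_def subspace_diff subspace_scale)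
      moreover have wb: "w \<bullet> b = 0" by (simp add: w_def inner_diff_left bb \<mu>_def)
      ultimately have "L b \<bullet> w = 0" by (rule orth)
      then have "w \<bullet> w = 0" using wb by (simp add: w_def inner_diff_left inner_commute)
      then show ?thesis by (simp add: w_def)
    qed
    define W' where "W' = {w \<in> W. w \<bullet> b = 0}"
    have sW': "subspace W'"
      using less.prems(1) by (auto simp: W'_def subspace_def inner_add_left)
    have "W' \<subseteq> W" "b \<notin> W'" by (auto simp: W'_def bb)
    then have "span W' \<subset> span W" using bW less.prems(1) sW' by (metis psubsetI span_eq_iff)
    then have "dim W' < dim W" by (rule dim_psubset)
    moreover have "L w \<in> W'" if "w \<in> W'" for w
      using that less.prems(2) sym[of w b] by (auto simp: W'_def Lb)
    ultimately obtain B l where B: "pairwise orthogonal B" "\<forall>b\<in>B. norm b = 1" "span B = W'" "\<forall>b\<in>B. L b = l b *\<^sub>R b"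
      using less.hyps sW' by metis
    have BW': "B \<subseteq> W'" using B(3) span_superset by blast
    have "span (insert b B) = W"
    proof
      show "span (insert b B) \<subseteq> W"
        by (rule span_minimal) (use bW BW' less.prems(1) in \<open>auto simp: W'_def\<close>)
      show "W \<subseteq> span (insert b B)"
      proof
        fix w assume w: "w \<in> W"
        have "w - (w \<bullet> b) *\<^sub>R b \<in> W'"
          using w bW less.prems(1) by (simp add: W'_def subspace_diff subspace_scale inner_diff_left bb)
        then show "w \<in> span (insert b B)" unfolding B(3)[symmetric] by (metis span_breakdown_eq)
      qed
    qed
    moreover have "pairwise orthogonal (insert b B)"
      using B(1) BW' by (auto simp: pairwise_insert orthogonal_def W'_def inner_commute)
    moreover have "\<forall>v\<in>insert b B. L v = (if v = b then \<mu> else l v) *\<^sub>R v"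
      using B(4) Lb by auto
    ultimately show ?thesis
      by (intro exI[of _ "insert b B"] exI[of _ "\<lambda>v. if v = b then \<mu> else l v"]) (use B nb in auto)
  qed
qed

section \<open>Elementary symmetric functions as polynomial coefficients\<close>

lemma prod_add_elem_sym:
  fixes l :: "'a \<Rightarrow> real"
  assumes B: "finite B" "card B = n"
  shows "(\<Prod>b\<in>B. l b + s) = (\<Sum>i\<le>n. elem_sym (n - i) B l * s ^ i)"
proof -
  have "(\<Prod>b\<in>B. l b + s) = (\<Sum>I\<in>Pow B. (\<Prod>b\<in>I. l b) * (\<Prod>b\<in>B - I. s))"
    by (rule prod_add[OF B(1)])
  also have "\<dots> = (\<Sum>I\<in>Pow B. (\<Prod>b\<in>I. l b) * s ^ (n - card I))"
    using B by (intro sum.cong refl) (auto simp: card_Diff_subset finite_subset)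
  also have "\<dots> = (\<Sum>i\<le>n. \<Sum>I\<in>{I \<in> Pow B. n - card I = i}. (\<Prod>b\<in>I. l b) * s ^ (n - card I))"
    by (rule sum.group[symmetric]) (use B in auto)
  also have "\<dots> = (\<Sum>i\<le>n. elem_sym (n - i) B l * s ^ i)"
  proof (rule sum.cong[OF refl])
    fix i assume "i \<in> {..n}"
    then have i: "i \<le> n" by simp
    have "{I \<in> Pow B. n - card I = i} = {I. I \<subseteq> B \<and> card I = n - i}"
      using i B card_mono[OF B(1)] by auto
    then show "(\<Sum>I\<in>{I \<in> Pow B. n - card I = i}. (\<Prod>b\<in>I. l b) * s ^ (n - card I)) = elem_sym (n - i) B l * s ^ i"
      using i by (auto simp: elem_sym_def sum_distrib_right intro!: sum.cong)
  qed
  finally show ?thesis .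
qed

text \<open>The weights are the \<open>i\<close>-th coefficients of the Lagrange basis polynomials at \<open>0, \<dots>, n\<close>.\<close>

lemma coefficient_weights:
  obtains w :: "nat \<Rightarrow> real" where
    "\<And>c. (\<Sum>j\<le>n. w j * (\<Sum>i\<le>n. c i * real j ^ i)) = (if k \<le> n then c k else 0)"
proof -
  define l where "l = (\<lambda>j. \<Prod>m\<in>{..n} - {j}. [:- real m / (real j - real m), 1 / (real j - real m):])"
  have deg: "degree (l j) \<le> n" if "j \<le> n" for j
  proof -
    have "degree (l j) \<le> (\<Sum>m\<in>{..n} - {j}. degree [:- real m / (real j - real m), 1 / (real j - real m):])"
      unfolding l_def by (rule order_trans[OF degree_prod_sum_le]) auto
    also have "\<dots> \<le> (\<Sum>m\<in>{..n} - {j}. 1)" by (intro sum_mono) auto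
    also have "\<dots> = n" using that by simp
    finally show ?thesis .
  qed
  have lin: "poly [:- real m / (real j - real m), 1 / (real j - real m):] x = (x - real m) / (real j - real m)" for j m x
    by (simp add: diff_divide_distrib)
  have val: "poly (l j) (real i) = (if i = j then 1 else 0)" if "i \<le> n" "j \<le> n" for i j
  proof (cases "i = j")
    case True
    have "poly (l j) (real j) = (\<Prod>m\<in>{..n} - {j}. 1)"
      unfolding l_def poly_prod lin by (rule prod.cong) auto
    then show ?thesis using True by simp
  next
    case False
    then show ?thesis unfolding l_def poly_prod lin using that
      by (auto intro!: bexI[of _ i])
  qed
  show ?thesis
  proof (rule that[of "\<lambda>j. coeff (l j) k"])
    fix c :: "nat \<Rightarrow> real"
    define p where "p = (\<Sum>i\<le>n. monom (c i) i)"
    have pc: "poly p x = (\<Sum>i\<le>n. c i * x ^ i)" for x by (simp add: p_def poly_sum poly_monom)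
    define q where "q = (\<Sum>j\<le>n. smult (poly p (real j)) (l j))"
    \<comment> \<open>Both have degree at most n and agree at n + 1 nodes, so interpolation
      reproduces every coefficient.\<close>
    have "p = q"
    proof (rule poly_eqI_degree[of "real ` {..n}"])
      fix x assume "x \<in> real ` {..n}"
      then obtain i where i: "x = real i" "i \<le> n" by auto
      have "poly q x = (\<Sum>j\<le>n. if i = j then poly p (real j) else 0)"
        unfolding q_def poly_sum i(1) by (rule sum.cong) (auto simp: val i)
      then show "poly p x = poly q x" using i by simp
    next
      have c: "card (real ` {..n}) = Suc n" by (simp add: card_image)
      have "degree p \<le> n" unfolding p_def
        by (rule degree_sum_le) (auto intro: order_trans[OF degree_monom_le])
      then show "degree p < card (real ` {..n})" using c by simp
      have "degree q \<le> n" unfolding q_def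
        by (rule degree_sum_le) (auto intro!: order_trans[OF degree_smult_le] deg)
      then show "degree q < card (real ` {..n})" using c by simp
    qed
    then have "coeff p k = coeff q k" by simp
    also have "\<dots> = (\<Sum>j\<le>n. poly p (real j) * coeff (l j) k)"
      by (simp add: q_def coeff_sum)
    finally have "coeff p k = (\<Sum>j\<le>n. poly p (real j) * coeff (l j) k)" .
    moreover have "coeff p k = (if k \<le> n then c k else 0)"
      by (simp add: p_def coeff_sum)
    ultimately show "(\<Sum>j\<le>n. coeff (l j) k * (\<Sum>i\<le>n. c i * real j ^ i)) = (if k \<le> n then c k else 0)"
      by (simp add: pc mult.commute)
  qed
qed

text \<open>All eigenbases share the polynomial \<open>d\<close>, hence its coefficients, so the
  definite description in \<open>p_form\<close> has a unique value. Sampling at multiples of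
  \<open>r\<close> multiplies the coefficient of j^(n-m) by r^(n-m); r = 1 identifies
  \<open>p_form\<close>, and r = 1 / u is the intended use.\<close>

lemma p_form_eq:
  assumes ex: "eigenbasis W A B0 l0"
    and d: "\<And>B l s. eigenbasis W A B l \<Longrightarrow> d s = (\<Prod>b\<in>B. l b + s)"
    and card: "\<And>B l. eigenbasis W A B l \<Longrightarrow> finite B \<and> card B = n"
    and n: "dim W = n" and m: "m \<le> n"
    and w: "\<And>c. (\<Sum>j\<le>n. w j * (\<Sum>i\<le>n. c i * real j ^ i)) = (if n - m \<le> n then c (n - m) else 0)"
  shows "p_form W m A * real (n choose m) * r ^ (n - m) = (\<Sum>j\<le>n. w j * d (real j * r))"
proof -
  have e: "elem_sym m B l * r ^ (n - m) = (\<Sum>j\<le>n. w j * d (real j * r))" if "eigenbasis W A B l" for B l r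
  proof -
    have "d (real j * r) = (\<Sum>i\<le>n. (elem_sym (n - i) B l * r ^ i) * real j ^ i)" for j
      using card[OF that] prod_add_elem_sym[of B n l "real j * r"]
      by (simp add: d[OF that] power_mult_distrib mult_ac)
    then show ?thesis using w[of "\<lambda>i. elem_sym (n - i) B l * r ^ i"] m by simp
  qed
  have "p_form W m A = (\<Sum>j\<le>n. w j * d (real j)) / real (n choose m)"
    unfolding p_form_def
  proof (rule the_equality)
    show "\<exists>B l. eigenbasis W A B l \<and> (\<Sum>j\<le>n. w j * d (real j)) / real (n choose m) = elem_sym m B l / real (dim W choose m)"
      using ex e[OF ex, of 1] n by (intro exI[of _ B0] exI[of _ l0]) simp
    show "s = (\<Sum>j\<le>n. w j * d (real j)) / real (n choose m)"
      if ex': "\<exists>B l. eigenbasis W A B l \<and> s = elem_sym m B l / real (dim W choose m)" for s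
    proof -
      obtain B l where "eigenbasis W A B l" "s = elem_sym m B l / real (dim W choose m)"
        using ex' by blast
      then show ?thesis using e[of B l 1] n by simp
    qed
  qed
  moreover have "real (n choose m) \<noteq> 0" using m by simp
  ultimately have "p_form W m A * real (n choose m) = elem_sym m B0 l0"
    using e[OF ex, of 1] by simp
  then show ?thesis using e[OF ex] by simp
qed

lemma det_eigenbasis:
  fixes K :: "real^'n^'n"
  assumes B: "pairwise orthogonal B" "\<And>b. b \<in> B \<Longrightarrow> norm b = 1" "card B = CARD('n)"
    and K: "\<And>b. b \<in> B \<Longrightarrow> K *v b = m b *s b"
  shows "det K = (\<Prod>b\<in>B. m b)"
proof -
  have fin: "finite B" using B(3) by (metis card.infinite zero_less_card_finite less_irrefl)
  then obtain g where g: "bij_betw g (UNIV :: 'n set) B"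
    using finite_same_card_bij[of "UNIV :: 'n set" B] B(3) by auto
  define Q where "Q = (\<chi> i j. g j $ i)"
  have gB: "g j \<in> B" for j using g by (auto simp: bij_betw_def)
  have "column j Q = g j" for j by (simp add: column_def Q_def vec_eq_iff)
  moreover have "orthogonal (g i) (g j)" if "i \<noteq> j" for i j
    using B(1) gB g that unfolding pairwise_def bij_betw_def inj_on_def by blast
  ultimately have "orthogonal_matrix Q"
    by (simp add: orthogonal_matrix_orthonormal_columns B(2) gB)
  then have "det Q \<noteq> 0" using det_orthogonal_matrix[of Q] by auto
  define D where "D = ((\<chi> i j. if i = j then m (g i) else 0) :: real^'n^'n)"
  have "K ** Q = Q ** D"
  proof -
    have "(K ** Q) $ i $ j = (K *v g j) $ i" for i j
      by (simp add: matrix_matrix_mult_def matrix_vector_mult_def Q_def)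
    moreover have "(Q ** D) $ i $ j = (m (g j) *s g j) $ i" for i j
      by (simp add: matrix_matrix_mult_def Q_def D_def if_distrib mult.commute cong: if_cong)
    ultimately show ?thesis by (simp add: vec_eq_iff K gB)
  qed
  then have "det K * det Q = det Q * det D" by (metis det_mul)
  moreover have "det D = (\<Prod>i\<in>UNIV. m (g i))"
    using det_diagonal[of D] by (simp add: D_def)
  moreover have "(\<Prod>i\<in>UNIV. m (g i)) = (\<Prod>b\<in>B. m b)"
    by (rule prod.reindex_bij_betw[OF g])
  ultimately show ?thesis using \<open>det Q \<noteq> 0\<close> by simp
qed

subsection \<open>Homogeneous functions\<close>

text \<open>Integer degrees, since differentiation takes degree 0 to negative ones; positive
  scalings, so that the norm qualifies.\<close>

definition homogeneous :: "int \<Rightarrow> ('a::euclidean_space \<Rightarrow> real) \<Rightarrow> bool" where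
  "homogeneous k F \<longleftrightarrow> (\<forall>x t. x \<noteq> 0 \<longrightarrow> t > 0 \<longrightarrow> F (t *\<^sub>R x) = t powi k * F x)"

text \<open>The scaling law differentiated in x, where the chain rule contributes one factor
  t.\<close>

lemma homogeneous_pd:
  assumes F: "smooth_punct F" and h: "homogeneous k F"
  shows "homogeneous (k - 1) (pd v F)"
  unfolding homogeneous_def
proof (intro allI impI)
  fix x :: 'a and t :: real assume x: "x \<noteq> 0" and t: "t > 0"
  have tx: "t *\<^sub>R x \<noteq> 0" using x t by simp
  have "((\<lambda>y. F (t *\<^sub>R y)) has_derivative (\<lambda>v. pd (t *\<^sub>R v) F (t *\<^sub>R x))) (at x)"
    by (rule has_derivative_compose[where g=F and f="\<lambda>y. t *\<^sub>R y" and f'="\<lambda>v. t *\<^sub>R v" and g'="\<lambda>v. pd v F (t *\<^sub>R x)",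
          OF _ smooth_punct_deriv[OF F tx]]) (auto intro!: derivative_eq_intros)
  then have "pd v (\<lambda>y. F (t *\<^sub>R y)) x = pd (t *\<^sub>R v) F (t *\<^sub>R x)" by (rule pd_eqI)
  also have "\<dots> = t * pd v F (t *\<^sub>R x)" by (simp add: linear_scale[OF pd_linear[OF F tx]])
  finally have 1: "pd v (\<lambda>y. F (t *\<^sub>R y)) x = t * pd v F (t *\<^sub>R x)" .
  have "pd v (\<lambda>y. F (t *\<^sub>R y)) x = pd v (\<lambda>y. t powi k * F y) x"
    by (rule pd_cong) (use h t x in \<open>auto simp: homogeneous_def\<close>)
  also have "\<dots> = t powi k * pd v F x"
    using pd_mult[OF smooth_punct_const F x, of v "t powi k"] by simp
  finally have "t * pd v F (t *\<^sub>R x) = t powi k * pd v F x" using 1 by simp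
  then show "pd v F (t *\<^sub>R x) = t powi (k - 1) * pd v F x"
    using t by (simp add: power_int_diff field_simps)
qed

text \<open>The scaling law differentiated in t at 1; it is available for positive t, hence near
  1.\<close>

lemma homogeneous_euler:
  assumes F: "smooth_punct F" and h: "homogeneous k F" and x: "x \<noteq> 0"
  shows "pd x F x = of_int k * F x"
proof -
  have "((\<lambda>t. F (t *\<^sub>R x)) has_derivative (\<lambda>r. pd (r *\<^sub>R x) F (1 *\<^sub>R x))) (at 1)"
    by (rule has_derivative_compose[where g=F and f="\<lambda>t. t *\<^sub>R x" and f'="\<lambda>r. r *\<^sub>R x" and g'="\<lambda>v. pd v F (1 *\<^sub>R x)"])
       (use smooth_punct_deriv[OF F x] in \<open>auto intro!: derivative_eq_intros\<close>)
  then have "((\<lambda>t. F (t *\<^sub>R x)) has_real_derivative pd x F x) (at 1)"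
    by (simp add: has_field_derivative_def linear_scale[OF pd_linear[OF F x]] mult.commute[of _ "pd x F x"])
  moreover have "((\<lambda>t. t powi k * F x) has_real_derivative of_int k * F x) (at 1)"
    by (auto intro!: derivative_eq_intros)
  then have "((\<lambda>t. F (t *\<^sub>R x)) has_real_derivative of_int k * F x) (at 1)"
    by (rule DERIV_cong_ev[THEN iffD1, OF refl _ refl, rotated])
       (use eventually_gt_at_top h x in \<open>auto simp: homogeneous_def eventually_at_filter intro!: eventually_mono[OF eventually_nhds_in_open[of "{0<..}"]]\<close>)
  ultimately show ?thesis by (rule DERIV_unique)
qed

lemma radial_scale: "t > 0 \<Longrightarrow> (t *\<^sub>R x) /\<^sub>R norm (t *\<^sub>R x) = x /\<^sub>R norm (x::'a::real_normed_vector)"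
  by (simp add: mult.commute[of _ t] mult.assoc[symmetric])

lemma homogeneous_radial:
  "homogeneous 0 (\<lambda>x. f (x /\<^sub>R norm x))"
  "homogeneous 1 (\<lambda>x. norm x * f (x /\<^sub>R norm x))"
  by (auto simp: homogeneous_def radial_scale simp del: norm_scaleR inverse_mult_distrib scaleR_scaleR) simp

lemma pd_eq_inner_grad:
  assumes "smooth_punct F" "x \<noteq> 0"
  shows "pd v F x = v \<bullet> grad F x"
proof -
  have "pd v F x = pd (\<Sum>i\<in>UNIV. v $ i *\<^sub>R axis i 1) F x"
    using basis_expansion[of v] by (simp add: scalar_mult_eq_scaleR)
  also have "\<dots> = (\<Sum>i\<in>UNIV. v $ i * pd (axis i 1) F x)"
    by (simp add: linear_sum[OF pd_linear[OF assms]] linear_scale[OF pd_linear[OF assms]])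
  finally show ?thesis by (simp add: inner_vec_def grad_def)
qed

definition hess :: "(real^'n \<Rightarrow> real) \<Rightarrow> real^'n \<Rightarrow> real^'n^'n" where
  "hess F x = (\<chi> k. grad (pd (axis k 1) F) x)"

lemma hess_mult:
  assumes "smooth_punct F" "x \<noteq> 0"
  shows "(hess F x *v v) $ k = pd v (pd (axis k 1) F) x"
  using assms by (simp add: matrix_vector_mul_component hess_def pd_eq_inner_grad smooth_punct_pd inner_commute)

lemma hess_symmetric:
  assumes "smooth_punct F" "x \<noteq> 0"
  shows "transpose (hess F x) = hess F x"
  using pd_commute[OF assms] by (simp add: hess_def grad_def transpose_def vec_eq_iff)

lemma has_derivative_vecI:
  fixes f :: "'a::real_normed_vector \<Rightarrow> real^'n"
  assumes "\<And>i. ((\<lambda>y. f y $ i) has_derivative (\<lambda>v. D v $ i)) (at x)"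
  shows "(f has_derivative D) (at x)"
  unfolding has_derivative_componentwise_within[of f]
  using assms by (auto simp: Basis_vec_def inner_axis)

lemma has_derivative_grad:
  assumes "smooth_punct F" "x \<noteq> 0"
  shows "(grad F has_derivative (\<lambda>v. hess F x *v v)) (at x)"
proof (rule has_derivative_vecI)
  fix i
  have "((\<lambda>y. pd (axis i 1) F y) has_derivative (\<lambda>v. pd v (pd (axis i 1) F) x)) (at x)"
    by (rule smooth_punct_deriv) (use assms smooth_punct_pd in auto)
  then show "((\<lambda>y. grad F y $ i) has_derivative (\<lambda>v. (hess F x *v v) $ i)) (at x)"
    by (simp add: hess_mult[OF assms], simp add: grad_def)
qed

subsection \<open>Intrinsic derivatives on the sphere\<close>

text \<open>\<open>sphere_deriv\<close> selects some derivative within the sphere, and such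
  derivatives are not unique. Any two agree on tangent vectors, because composition with a great
  circle gives derivatives in one real variable, which are unique.\<close>

lemma sphere_deriv_eq:
  fixes f F :: "'a::euclidean_space \<Rightarrow> 'b::real_normed_vector"
  assumes F: "(F has_derivative D) (at x)" and eq: "\<And>y. y \<in> sphere 0 1 \<Longrightarrow> f y = F y"
    and x: "x \<in> sphere 0 1" and v: "v \<in> tangent_space x"
  shows "sphere_deriv f x v = D v"
proof -
  let ?S = "sphere 0 1 :: 'a set"
  have fD: "(f has_derivative D) (at x within ?S)"
    by (rule has_derivative_transform[OF x eq has_derivative_at_withinI[OF F]])
  then have "f differentiable (at x within ?S)" by (auto simp: differentiable_def)
  then have fE: "(f has_derivative frechet_derivative f (at x within ?S)) (at x within ?S)"
    by (simp add: frechet_derivative_works)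
  show ?thesis
  proof (cases "v = 0")
    case True
    then show ?thesis
      using linear_0[OF has_derivative_linear[OF fD]] linear_0[OF has_derivative_linear[OF fE]]
      by (simp add: sphere_deriv_def)
  next
    case False
    \<comment> \<open>The great circle needs a unit velocity, which is why \<open>v = 0\<close> is
      treated apart.\<close>
    define w where "w = v /\<^sub>R norm v"
    have w: "norm w = 1" "x \<bullet> w = 0" "x \<bullet> x = 1" "w \<bullet> w = 1"
      using False v x by (auto simp: w_def tangent_space_def inner_commute dot_square_norm)
    define c where "c = (\<lambda>t. cos t *\<^sub>R x + sin t *\<^sub>R w)"
    have cS: "c ` UNIV \<subseteq> ?S"
    proof (rule image_subsetI)
      fix t
      have "c t \<bullet> c t = 1"
        using w sin_cos_squared_add[of t]
        by (simp add: c_def inner_add_left inner_add_right inner_commute[of w x] power2_eq_square)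
      then show "c t \<in> ?S" by (simp add: norm_eq_sqrt_inner)
    qed
    have c: "(c has_derivative (\<lambda>r. r *\<^sub>R w)) (at 0)"
      unfolding c_def by (auto intro!: derivative_eq_intros)
    have c0: "c 0 = x" by (simp add: c_def)
    have comp: "((\<lambda>t. f (c t)) has_derivative (\<lambda>r. E (r *\<^sub>R w))) (at 0)"
      if "(f has_derivative E) (at x within ?S)" for E
      by (rule has_derivative_in_compose[where g=f and f=c and g'=E, OF c])
         (use has_derivative_subset[OF that cS] c0 in simp)
    have "(\<lambda>r. frechet_derivative f (at x within ?S) (r *\<^sub>R w)) = (\<lambda>r. D (r *\<^sub>R w))"
      by (rule has_derivative_unique[OF comp[OF fE] comp[OF fD]])
    from fun_cong[OF this, of "norm v"] show ?thesis
      using False by (simp add: w_def sphere_deriv_def)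
  qed
qed

lemma sphere_grad_eq:
  fixes f F :: "real^'n \<Rightarrow> real"
  assumes F: "smooth_punct F" and eq: "\<And>y. y \<in> sphere 0 1 \<Longrightarrow> f y = F y" and x: "x \<in> sphere 0 1"
  shows "sphere_grad f x = grad F x - (grad F x \<bullet> x) *\<^sub>R x"
proof -
  have x0: "x \<noteq> 0" and xx: "x \<bullet> x = 1" using x by (auto simp: dot_square_norm)
  have d: "sphere_deriv f x v = grad F x \<bullet> v" if "v \<in> tangent_space x" for v
    using sphere_deriv_eq[OF smooth_punct_deriv[OF F x0] eq x that]
    by (simp add: pd_eq_inner_grad[OF F x0] inner_commute)
  let ?g = "grad F x - (grad F x \<bullet> x) *\<^sub>R x"
  have g: "?g \<in> tangent_space x" by (simp add: tangent_space_def inner_diff_left xx)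
  show ?thesis
    unfolding sphere_grad_def
  proof (rule the_equality)
    show "?g \<in> tangent_space x \<and> (\<forall>v\<in>tangent_space x. ?g \<bullet> v = sphere_deriv f x v)"
      using g d by (auto simp: inner_diff_left tangent_space_def) (auto simp: inner_commute)
    fix h assume h: "h \<in> tangent_space x \<and> (\<forall>v\<in>tangent_space x. h \<bullet> v = sphere_deriv f x v)"
    have "h - ?g \<in> tangent_space x" using h g by (auto simp: tangent_space_def inner_diff_left)
    then have "h \<bullet> (h - ?g) = grad F x \<bullet> (h - ?g)" "x \<bullet> (h - ?g) = 0"
      using h d[of "h - ?g"] by (auto simp: tangent_space_def inner_commute)
    then have "(h - ?g) \<bullet> (h - ?g) = 0"
      by (simp only: inner_diff_left[of h] inner_diff_left[of "grad F x"] inner_scaleR_left)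
    then show "h = ?g" by simp
  qed
qed

text \<open>With p = grad u, Euler's relation p \<bullet> x = u gives D\<phi> = p - u x, |D\<phi>|^2
  = |p|^2 - u^2 and D^2 \<phi> = Hess u - u on tangent vectors; the multiples of u then cancel. What
  remains beside Hess u is \<beta> at c = -1.\<close>

lemma A_form_eq:
  fixes \<phi> u :: "real^'n \<Rightarrow> real"
  assumes u: "smooth_punct u" "homogeneous 1 u" and eq: "\<And>y. y \<in> sphere 0 1 \<Longrightarrow> \<phi> y = u y"
    and x: "x \<in> sphere 0 1" and ab: "a \<in> tangent_space x" "b \<in> tangent_space x" and ux: "u x \<noteq> 0"
  shows "A_form \<phi> x a b = (hess u x *v a) \<bullet> b + (- 1 - grad u x \<bullet> grad u x) / (2 * u x) * (a \<bullet> b)"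
proof -
  have x0: "x \<noteq> 0" and xx: "x \<bullet> x = 1" using x by (auto simp: dot_square_norm)
  have euler: "grad u y \<bullet> y = u y" if "y \<noteq> 0" for y
    using homogeneous_euler[OF u that] by (simp add: pd_eq_inner_grad[OF u(1) that] inner_commute)
  have g: "sphere_grad \<phi> y = grad u y - u y *\<^sub>R y" if "y \<in> sphere 0 1" for y
    using sphere_grad_eq[OF u(1) eq that] euler[of y] that by auto
  have "((\<lambda>y. grad u y - u y *\<^sub>R y) has_derivative (\<lambda>v. hess u x *v v - (u x *\<^sub>R v + pd v u x *\<^sub>R x))) (at x)"
    by (intro derivative_intros has_derivative_grad smooth_punct_deriv u x0)
  then have "sphere_deriv (sphere_grad \<phi>) x a = hess u x *v a - (u x *\<^sub>R a + pd a u x *\<^sub>R x)"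
    by (rule sphere_deriv_eq[OF _ g x ab(1)])
  then have h: "sphere_hess \<phi> x a b = (hess u x *v a) \<bullet> b - u x * (a \<bullet> b)"
    using ab by (simp add: sphere_hess_def cov_deriv_def tangential_part_def tangent_space_def inner_diff_left
        inner_add_left inner_commute[of x b])
  have n: "(norm (sphere_grad \<phi> x))\<^sup>2 = grad u x \<bullet> grad u x - (u x)\<^sup>2"
    unfolding g[OF x] power2_norm_eq_inner
    using euler[OF x0] xx by (simp add: inner_diff_left inner_diff_right inner_commute[of x "grad u x"] power2_eq_square)
  show ?thesis
    unfolding A_form_def h n eq[OF x] using ux by (simp add: field_simps power2_eq_square)
qed

subsection \<open>The horospherical map\<close>

text \<open>For 1-homogeneous u, the number \<beta> determined on the sphere by |p + \<beta> x|^2 -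
  \<beta>^2 = c with p = grad u, because p \<bullet> x = u.\<close>

definition conj_height :: "(real^'n \<Rightarrow> real) \<Rightarrow> real \<Rightarrow> real^'n \<Rightarrow> real" where
  "conj_height u c x = (c - grad u x \<bullet> grad u x) / (2 * u x)"

definition shape_mat :: "(real^'n \<Rightarrow> real) \<Rightarrow> real \<Rightarrow> real^'n \<Rightarrow> real^'n^'n" where
  "shape_mat u c x = hess u x + (\<chi> k. conj_height u c x *s axis k 1)"

text \<open>On the sphere and for 1-homogeneous u the rank-one term gives the normal
  \<open>x\<close> the eigenvalue 1, so the full determinant is the determinant on the tangent
  space.\<close>

definition full_mat :: "(real^'n \<Rightarrow> real) \<Rightarrow> real \<Rightarrow> real^'n \<Rightarrow> real^'n^'n" where
  "full_mat u c x = shape_mat u c x + (\<chi> k. ((1 - conj_height u c x) * x $ k) *s x)"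

lemma smooth_punct_coord: "smooth_punct (\<lambda>x::real^'n. x $ k)"
  using smooth_punct_inner[of "axis k (1::real)"] by (simp add: inner_axis)

lemma pd_coord: "pd v (\<lambda>x::real^'n. x $ k) x = v $ k"
  using pd_inner[of v "axis k (1::real)" x] by (simp add: inner_axis)

lemma smooth_punct_grad_sq: "smooth_punct u \<Longrightarrow> smooth_punct (\<lambda>x. grad u x \<bullet> grad u x)"
  unfolding inner_vec_def grad_def by (simp, intro smooth_punct_intros)

lemma smooth_punct_grad_nth: "smooth_punct u \<Longrightarrow> smooth_punct (\<lambda>x. grad u x $ k)"
  unfolding grad_def by (simp, intro smooth_punct_intros)

lemma smooth_punct_conj_height:
  assumes "smooth_punct u" "\<And>x. x \<noteq> 0 \<Longrightarrow> u x \<noteq> 0"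
  shows "smooth_punct (conj_height u c)"
  unfolding conj_height_def by (intro smooth_punct_intros smooth_punct_grad_sq assms) (use assms in auto)

lemma shape_mat_mult: "shape_mat u c x *v v = hess u x *v v + conj_height u c x *s v"
proof -
  have "(\<chi> k. conj_height u c x *s axis k 1) *v v = conj_height u c x *s v"
    by (simp add: vec_eq_iff matrix_vector_mul_component inner_axis' scalar_mult_eq_scaleR)
  then show ?thesis by (simp add: shape_mat_def matrix_vector_mult_add_rdistrib)
qed

lemma full_mat_mult: "full_mat u c x *v v = shape_mat u c x *v v + ((1 - conj_height u c x) * (x \<bullet> v)) *s x"
proof -
  have "(\<chi> k. ((1 - conj_height u c x) * x $ k) *s x) *v v = ((1 - conj_height u c x) * (x \<bullet> v)) *s x"
    by (simp add: vec_eq_iff matrix_vector_mul_component scalar_mult_eq_scaleR)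
  then show ?thesis by (simp add: full_mat_def matrix_vector_mult_add_rdistrib)
qed

text \<open>Differentiate 2 u \<beta> = c - |p|^2 with p = grad u. The terms with p and with Hess u
  p combine to (Hess u + \<beta> I) p, so the Jacobian of p + \<beta> x factors through Hess u +
  \<beta> I.\<close>

lemma grad_conj_height:
  assumes u: "smooth_punct u" "\<And>x. x \<noteq> 0 \<Longrightarrow> u x \<noteq> 0" and x: "x \<noteq> 0"
  shows "pd v (conj_height u c) x = - (v \<bullet> (shape_mat u c x *v grad u x)) / u x"
proof -
  have "((\<lambda>x. grad u x \<bullet> grad u x) has_derivative (\<lambda>v. grad u x \<bullet> (hess u x *v v) + (hess u x *v v) \<bullet> grad u x)) (at x)"
    by (intro has_derivative_inner has_derivative_grad u x)
  then have "pd v (\<lambda>x. grad u x \<bullet> grad u x) x = 2 * (grad u x \<bullet> (hess u x *v v))"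
    by (simp add: pd_eqI inner_commute)
  also have "grad u x \<bullet> (hess u x *v v) = v \<bullet> (hess u x *v grad u x)"
    using hess_symmetric[OF u(1) x] by (metis dot_lmul_matrix inner_commute transpose_matrix_vector)
  finally have 1: "pd v (\<lambda>x. grad u x \<bullet> grad u x) x = 2 * (v \<bullet> (hess u x *v grad u x))" .
  have "pd v (conj_height u c) x = pd v (\<lambda>x. (c - grad u x \<bullet> grad u x) / (2 * u x)) x"
    by (simp add: conj_height_def[abs_def])
  also have "\<dots> = (pd v (\<lambda>x. c - grad u x \<bullet> grad u x) x * (2 * u x) - (c - grad u x \<bullet> grad u x) * pd v (\<lambda>x. 2 * u x) x) / (2 * u x)\<^sup>2"
    by (rule pd_divide) (use u x in \<open>auto intro!: smooth_punct_intros smooth_punct_grad_sq\<close>)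
  also have "pd v (\<lambda>x. c - grad u x \<bullet> grad u x) x = - 2 * (v \<bullet> (hess u x *v grad u x))"
    by (simp add: pd_diff smooth_punct_const smooth_punct_grad_sq u x 1)
  also have "pd v (\<lambda>x. 2 * u x) x = 2 * (v \<bullet> grad u x)"
    by (simp add: pd_mult smooth_punct_const u x pd_eq_inner_grad)
  also have "c - grad u x \<bullet> grad u x = conj_height u c x * (2 * u x)"
    using u(2)[OF x] by (simp add: conj_height_def)
  also have "(- 2 * (v \<bullet> (hess u x *v grad u x)) * (2 * u x) - conj_height u c x * (2 * u x) * (2 * (v \<bullet> grad u x))) / (2 * u x)\<^sup>2
     = - (v \<bullet> (hess u x *v grad u x) + conj_height u c x * (v \<bullet> grad u x)) / u x"
    using u(2)[OF x] by (simp add: field_simps power2_eq_square)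
  finally show ?thesis
    by (simp add: shape_mat_mult inner_add_right scalar_mult_eq_scaleR)
qed

text \<open>The partial derivatives of \<open>u\<close> have degree 0, so their radial derivatives
  vanish by Euler's relation.\<close>

lemma hess_radial:
  assumes u: "smooth_punct u" "homogeneous 1 u" and x: "x \<noteq> 0"
  shows "hess u x *v x = 0"
proof -
  have "pd x (pd (axis k 1) u) x = 0" for k
    using homogeneous_euler[OF smooth_punct_pd[OF u(1)] homogeneous_pd[OF u] x] by simp
  then show ?thesis by (simp add: vec_eq_iff hess_mult[OF u(1) x])
qed

lemma shape_mat_symmetric:
  assumes "smooth_punct u" "x \<noteq> 0"
  shows "transpose (shape_mat u c x) = shape_mat u c x"
proof -
  have h: "hess u x $ i $ j = hess u x $ j $ i" for i j
    using pd_commute[OF assms] by (simp add: hess_def grad_def)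
  have "shape_mat u c x $ i $ j = shape_mat u c x $ j $ i" for i j
    by (cases "i = j") (simp_all add: shape_mat_def axis_def h[of i j])
  then show ?thesis unfolding transpose_def vec_eq_iff vec_lambda_beta by blast
qed

text \<open>Up to signs, \<open>(conj_height u c, grad u + conj_height u c x)\<close> is a hypersurface in a quadric of
  Minkowski space, parallel to the horospherically convex one with support function \<open>u\<close>; the
  integrals below are the components of the vanishing integral of its normal 2-vector.\<close>

lemma integral_horospherical:
  fixes u :: "real^'n \<Rightarrow> real"
  assumes u: "smooth_punct u" "homogeneous 1 u" "\<And>x. x \<noteq> 0 \<Longrightarrow> u x \<noteq> 0" and N: "CARD('n) \<ge> 2"
  shows "(\<integral>x. (grad u x $ i + (a \<bullet> x) * grad u x $ i - (a \<bullet> grad u x) * x $ i) / u x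
      * det (full_mat u c x) \<partial>sphere_area) = 0"
proof -
  have "\<exists>l. l \<noteq> i"
  proof (rule ccontr)
    assume "\<not> ?thesis"
    then have "UNIV = {i}" by auto
    then have "CARD('n) = 1" by (metis card_1_singleton_iff One_nat_def)
    then show False using N by simp
  qed
  then obtain l where l: "i \<noteq> l" by metis
  \<comment> \<open>The constant vector \<open>a\<close> mixes multiples of the height component
    \<beta> into the map p + \<beta> x, so that varying \<open>a\<close> reaches the components of
    the identity that involve the height.\<close>
  define y where "y = (\<lambda>k x. grad u x $ k + conj_height u c x * (x $ k + a $ k))"
  have sy: "smooth_punct (y k)" for k
    unfolding y_def using u
    by (intro smooth_punct_intros smooth_punct_conj_height smooth_punct_grad_nth smooth_punct_coord) auto
  have "(\<integral>x. det (\<chi> k. if k = i then x else grad (y k) x) \<partial>sphere_area) = 0"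
    by (rule integral_sphere_det_grad[OF sy l])
  moreover have "det (\<chi> k. if k = i then x else grad (y k) x)
     = (grad u x $ i + (a \<bullet> x) * grad u x $ i - (a \<bullet> grad u x) * x $ i) / u x * det (full_mat u c x)"
    if xs: "x \<in> sphere 0 1" for x
  proof -
    have x: "x \<noteq> 0" and xx: "x \<bullet> x = 1" using xs by (auto simp: dot_square_norm)
    let ?S = "shape_mat u c x" and ?p = "grad u x"
    \<comment> \<open>The Hessian row and \<beta> times the unit vector form a row of
      \<open>?S\<close>; the gradient of \<beta> contributes the multiple of
      \<open>?S *v ?p\<close>.\<close>
    have "grad (y k) x = ?S $ k - ((x + a) $ k / u x) *s (?S *v ?p)" for k
    proof -
      have "pd v (y k) x = pd v (pd (axis k 1) u) x + (- (v \<bullet> (?S *v ?p)) / u x * (x $ k + a $ k) + conj_height u c x * v $ k)" for v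
      proof -
        have "pd v (y k) x = pd v (\<lambda>x. grad u x $ k) x + pd v (\<lambda>x. conj_height u c x * (x $ k + a $ k)) x"
          unfolding y_def using u x
          by (intro pd_add smooth_punct_intros smooth_punct_conj_height smooth_punct_grad_nth smooth_punct_coord) auto
        also have "pd v (\<lambda>x. conj_height u c x * (x $ k + a $ k)) x
          = pd v (conj_height u c) x * (x $ k + a $ k) + conj_height u c x * pd v (\<lambda>x. x $ k + a $ k) x"
          using u x by (intro pd_mult smooth_punct_intros smooth_punct_conj_height smooth_punct_coord) auto
        also have "pd v (\<lambda>x. x $ k + a $ k) x = v $ k"
          using pd_add[OF smooth_punct_coord smooth_punct_const x, of v k "a $ k"] by (simp add: pd_coord)
        finally show ?thesis using grad_conj_height[OF u(1,3) x] by (simp add: grad_def)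
      qed
      then show ?thesis
        by (simp add: vec_eq_iff grad_def[of "y k"] shape_mat_def[of u c x] hess_def inner_axis' )
           (simp add: grad_def axis_def algebra_simps add_divide_distrib)
    qed
    then have 1: "(\<chi> k. if k = i then x else grad (y k) x)
        = (\<chi> k. if k = i then x else ?S $ k - ((x + a) $ k / u x) *s (?S *v ?p))"
      by (simp add: vec_eq_iff)
    have "?p \<bullet> x = u x"
      using homogeneous_euler[OF u(1,2) x] by (simp add: pd_eq_inner_grad[OF u(1) x] inner_commute)
    moreover have "?S *v x = conj_height u c x *s x"
      using hess_radial[OF u(1,2) x] by (simp add: shape_mat_mult)
    ultimately show ?thesis
      unfolding 1 full_mat_def
      using det_horospherical[OF shape_mat_symmetric[OF u(1) x] xx _ _ u(3)[OF x], of c "conj_height u c x" ?p i a] by simp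
  qed
  ultimately show ?thesis
    by (subst (asm) Bochner_Integration.integral_cong[OF refl]) (auto simp: space_sphere_area)
qed

subsection \<open>The curvature function as a combination of determinants\<close>

lemma subspace_tangent_space: "subspace (tangent_space x)"
  by (auto simp: tangent_space_def subspace_def inner_add_left)

lemma dim_tangent_space:
  fixes x :: "real^'n"
  assumes "x \<noteq> 0" "CARD('n) = n + 1"
  shows "dim (tangent_space x) = n"
proof -
  have "tangent_space x = {v. x \<bullet> v = 0}" by (auto simp: tangent_space_def inner_commute)
  then show ?thesis using dim_hyperplane[OF assms(1)] assms(2) by simp
qed

lemma eigenbasis_card:
  assumes "eigenbasis W A B l"
  shows "finite B" "card B = dim W" "B \<subseteq> W"
proof -
  have B: "pairwise orthogonal B" "0 \<notin> B" "span B = W" using assms by (auto simp: eigenbasis_def)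
  then have "independent B" by (simp add: pairwise_orthogonal_independent)
  then show "finite B" by (rule independent_imp_finite)
  show "card B = dim W" using B(3) dim_span[of B] dim_eq_card_independent[OF \<open>independent B\<close>] by simp
  show "B \<subseteq> W" using B(3) span_superset by blast
qed

lemma full_mat_normal:
  assumes u: "smooth_punct u" "homogeneous 1 u" and x: "x \<in> sphere 0 1"
  shows "full_mat u c x *v x = x"
proof -
  have x0: "x \<noteq> 0" and xx: "x \<bullet> x = 1" using x by (auto simp: dot_square_norm)
  show ?thesis by (simp add: full_mat_mult shape_mat_mult hess_radial[OF u x0] xx vec_eq_iff algebra_simps)
qed

lemma full_mat_tangent:
  assumes "v \<in> tangent_space x"
  shows "full_mat u c x *v v = hess u x *v v + conj_height u c x *s v"
  using assms by (simp add: full_mat_mult shape_mat_mult tangent_space_def inner_commute)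

text \<open>On tangent vectors \<open>A_form\<close> is the operator Hess u + q, with q the height
  at c = -1. Passing to c = 2 s u - 1 adds s to every tangential eigenvalue and keeps the eigenvalue
  1 at the normal, so the determinant is the product of all \<open>l b + s\<close>. For s = j / u
  the parameter is c = 2 j - 1, the same at every point, as integration requires.\<close>

lemma p_form_A_form:
  fixes u \<phi> :: "real^'n \<Rightarrow> real"
  assumes u: "smooth_punct u" "homogeneous 1 u" and eq: "\<And>y. y \<in> sphere 0 1 \<Longrightarrow> \<phi> y = u y"
    and x: "x \<in> sphere 0 1" and ux: "u x \<noteq> 0" and N: "CARD('n) = n + 1" and m: "m \<le> n"
    and w: "\<And>c. (\<Sum>j\<le>n. w j * (\<Sum>i\<le>n. c i * real j ^ i)) = (if n - m \<le> n then c (n - m) else 0)"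
  shows "p_form (tangent_space x) m (A_form \<phi> x) * real (n choose m) * (1 / u x) ^ (n - m)
    = (\<Sum>j\<le>n. w j * det (full_mat u (2 * real j - 1) x))"
proof -
  let ?T = "tangent_space x" and ?A = "A_form \<phi> x"
  define q where "q = conj_height u (- 1) x"
  define L where "L = (\<lambda>v. hess u x *v v + q *\<^sub>R v)"
  have x0: "x \<noteq> 0" and xx: "x \<bullet> x = 1" using x by (auto simp: dot_square_norm)
  have A: "?A a b = L a \<bullet> b" if "a \<in> ?T" "b \<in> ?T" for a b
    using A_form_eq[OF u eq x that ux] by (simp add: L_def q_def conj_height_def inner_add_left)
  have hs: "(hess u x *v a) \<bullet> b = a \<bullet> (hess u x *v b)" for a b
    using hess_symmetric[OF u(1) x0] by (metis dot_lmul_matrix inner_commute transpose_matrix_vector)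
  have linL: "linear L"
    unfolding L_def by (intro linear_compose_add matrix_vector_mul_linear linear_scale_self)
  have symL: "L a \<bullet> b = a \<bullet> L b" for a b by (simp add: L_def inner_add_left inner_add_right hs)
  have LT: "L a \<in> ?T" if "a \<in> ?T" for a
    using that hs[of a x] by (simp add: tangent_space_def L_def inner_add_left hess_radial[OF u x0])
  \<comment> \<open>The eigenbasis condition tests against tangent vectors only; this suffices
    because \<open>L b - l b *\<^sub>R b\<close> is itself tangent.\<close>
  have eig: "L b = l b *\<^sub>R b" if e: "eigenbasis ?T ?A B l" and b: "b \<in> B" for B l b
  proof -
    have bT: "b \<in> ?T" using eigenbasis_card(3)[OF e] b by blast
    define v where "v = L b - l b *\<^sub>R b"
    have vT: "v \<in> ?T" using LT[OF bT] bT subspace_tangent_space[of x] by (simp add: v_def subspace_diff subspace_scale)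
    have "L b \<bullet> v = l b * (b \<bullet> v)" using e b vT A[OF bT vT] by (simp add: eigenbasis_def)
    then have "v \<bullet> v = 0" unfolding v_def by (simp only: inner_diff_left[of "L b"] inner_scaleR_left)
    then show ?thesis by (simp add: v_def)
  qed
  obtain B0 l0 where B0: "pairwise orthogonal B0" "\<forall>b\<in>B0. norm b = 1" "span B0 = ?T" "\<forall>b\<in>B0. L b = l0 b *\<^sub>R b"
    using exists_orthonormal_eigenbasis[OF linL symL subspace_tangent_space LT] by blast
  have "B0 \<subseteq> ?T" using B0(3) span_superset by blast
  then have ex: "eigenbasis ?T ?A B0 l0"
    using B0 A by (auto simp: eigenbasis_def)
  define d where "d = (\<lambda>s. det (full_mat u (2 * s * u x - 1) x))"
  have d: "d s = (\<Prod>b\<in>B. l b + s)" if e: "eigenbasis ?T ?A B l" for B l s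
  proof -
    have BT: "B \<subseteq> ?T" and fB: "finite B" and cB: "card B = n"
      using eigenbasis_card[OF e] dim_tangent_space[OF x0 N] by auto
    have xB: "x \<notin> B" using BT xx by (auto simp: tangent_space_def)
    have h: "conj_height u (2 * s * u x - 1) x = q + s"
      using ux by (simp add: q_def conj_height_def field_simps)
    \<comment> \<open>The normal \<open>x\<close> completes \<open>B\<close> to an orthonormal
      eigenbasis of the whole space.\<close>
    have "d s = (\<Prod>b\<in>insert x B. if b = x then 1 else l b + s)"
      unfolding d_def
    proof (rule det_eigenbasis)
      show "pairwise orthogonal (insert x B)"
        using e BT by (auto simp: pairwise_insert eigenbasis_def orthogonal_def tangent_space_def inner_commute)
      show "norm b = 1" if "b \<in> insert x B" for b
        using that e x by (auto simp: eigenbasis_def)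
      show "card (insert x B) = CARD('n)" using fB xB cB N by simp
      show "full_mat u (2 * s * u x - 1) x *v b = (if b = x then 1 else l b + s) *s b"
        if "b \<in> insert x B" for b
      proof (cases "b = x")
        case True
        then show ?thesis using full_mat_normal[OF u x] by simp
      next
        case False
        then have b: "b \<in> B" "b \<in> ?T" using that BT by auto
        have "hess u x *v b + q *\<^sub>R b = l b *\<^sub>R b" using eig[OF e b(1)] by (simp add: L_def)
        then have hb: "hess u x *v b = l b *\<^sub>R b - q *\<^sub>R b" by (simp add: eq_diff_eq)
        show ?thesis unfolding full_mat_tangent[OF b(2)] h hb
          using False by (simp add: scalar_mult_eq_scaleR algebra_simps)
      qed
    qed
    also have "\<dots> = (\<Prod>b\<in>B. l b + s)"
      using fB xB by (simp, intro prod.cong) auto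
    finally show ?thesis .
  qed
  have "p_form ?T m ?A * real (n choose m) * (1 / u x) ^ (n - m) = (\<Sum>j\<le>n. w j * d (real j * (1 / u x)))"
    by (rule p_form_eq[OF ex d _ _ m w])
       (use eigenbasis_card dim_tangent_space[OF x0 N] in auto)
  also have "\<dots> = (\<Sum>j\<le>n. w j * det (full_mat u (2 * real j - 1) x))"
    using ux by (simp add: d_def)
  finally show ?thesis .
qed

lemma smooth_punct_det_full_mat:
  fixes u :: "real^'n \<Rightarrow> real"
  assumes u: "smooth_punct u" "\<And>x. x \<noteq> 0 \<Longrightarrow> u x \<noteq> 0"
  shows "smooth_punct (\<lambda>x. det (full_mat u c x))"
proof -
  have "smooth_punct (\<lambda>x. full_mat u c x $ i $ j)" for i j
    unfolding full_mat_def shape_mat_def hess_def grad_def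
    by (simp, intro smooth_punct_intros smooth_punct_conj_height smooth_punct_coord u)
  then show ?thesis unfolding det_def by (intro smooth_punct_intros)
qed

text \<open>The divergence theorem for \<open>h\<close> times the tangential part of the i-th unit
  vector, a field of divergence - n x_i with n = \<open>CARD('n) - 1\<close>. It arises by summing
  over j the rotation identities in the (j, i)-plane for \<open>x $ j * h x\<close>.\<close>

lemma integral_sphere_tangential_gradient:
  fixes h :: "real^'n \<Rightarrow> real"
  assumes h: "smooth_punct h"
  shows "(\<integral>x. grad h x $ i - x $ i * (x \<bullet> grad h x) - real (CARD('n) - 1) * (x $ i * h x) \<partial>sphere_area) = 0"
proof -
  let ?R = "\<lambda>j G x. x $ j * pd (axis i 1) G x - x $ i * pd (axis j 1) G (x::real^'n)"
  have sj: "smooth_punct (\<lambda>x. x $ j * h x)" for j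
    by (intro smooth_punct_intros smooth_punct_coord h)
  have sR: "smooth_punct (\<lambda>x. ?R j (\<lambda>x. x $ j * h x) x)" for j
    by (intro smooth_punct_intros smooth_punct_coord sj)
  have R0: "(\<integral>x. ?R j (\<lambda>x. x $ j * h x) x \<partial>sphere_area) = 0" for j
  proof (cases "j = i")
    case False
    then have "axis j (1::real) \<bullet> axis i 1 = 0" by (simp add: inner_axis_axis)
    then show ?thesis
      using integral_sphere_area_rot[OF sj[of j], of "axis j 1" "axis i 1"] by (simp add: inner_axis)
  qed simp
  have "grad h x $ i - x $ i * (x \<bullet> grad h x) - real (CARD('n) - 1) * (x $ i * h x)
      = (\<Sum>j\<in>UNIV. ?R j (\<lambda>x. x $ j * h x) x)"
    if xs: "x \<in> sphere 0 1" for x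
  proof -
    have x: "x \<noteq> 0" and xx: "x \<bullet> x = 1" using xs by (auto simp: dot_square_norm)
    have pj: "pd v (\<lambda>x. x $ j * h x) x = v $ j * h x + x $ j * pd v h x" for v j
      using pd_mult[OF smooth_punct_coord h x] by (simp add: pd_coord)
    have "(\<Sum>j\<in>UNIV. ?R j (\<lambda>x. x $ j * h x) x)
      = (\<Sum>j\<in>UNIV. x $ j * axis i 1 $ j * h x + x $ j * x $ j * pd (axis i 1) h x
          - x $ i * h x - x $ i * (x $ j * pd (axis j 1) h x))"
      unfolding pj by (rule sum.cong[OF refl]) (simp add: axis_def algebra_simps)
    also have "\<dots> = (\<Sum>j\<in>UNIV. x $ j * axis i 1 $ j) * h x + (x \<bullet> x) * pd (axis i 1) h x
          - real CARD('n) * x $ i * h x - x $ i * (x \<bullet> grad h x)"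
      by (simp add: sum_subtractf sum.distrib sum_distrib_left sum_distrib_right inner_vec_def grad_def)
    also have "(\<Sum>j\<in>UNIV. x $ j * axis i 1 $ j) = x $ i"
      using inner_axis[of x i "1::real"] by (simp add: inner_vec_def)
    finally show ?thesis by (simp add: xx grad_def[of h x] of_nat_diff Suc_leI algebra_simps)
  qed
  then have "(\<integral>x. grad h x $ i - x $ i * (x \<bullet> grad h x) - real (CARD('n) - 1) * (x $ i * h x) \<partial>sphere_area)
    = (\<integral>x. (\<Sum>j\<in>UNIV. ?R j (\<lambda>x. x $ j * h x) x) \<partial>sphere_area)"
    by (intro Bochner_Integration.integral_cong refl) (simp add: space_sphere_area)
  also have "\<dots> = (\<Sum>j\<in>UNIV. \<integral>x. ?R j (\<lambda>x. x $ j * h x) x \<partial>sphere_area)"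
    by (rule Bochner_Integration.integral_sum) (intro integrable_sphere_area smooth_punct_continuous_sphere sR)
  also have "\<dots> = 0" by (simp add: R0)
  finally show ?thesis .
qed

subsection \<open>The Kazdan-Warner identity for Moebius fields\<close>

text \<open>The data after extension to punctured space: \<open>u\<close> and \<open>F\<close> come
  from \<phi> and f, and \<open>m\<close> is n - k.\<close>

locale curvature_equation =
  fixes u F \<phi> :: "real^'n \<Rightarrow> real" and n m :: nat
  assumes u: "smooth_punct u" "homogeneous 1 u" "\<And>x. x \<noteq> 0 \<Longrightarrow> u x > 0"
    and F: "smooth_punct F" and N: "CARD('n) = n + 1" "n \<ge> 1" and m: "m \<le> n"
    and eq: "\<And>y. y \<in> sphere 0 1 \<Longrightarrow> \<phi> y = u y"
    and curv: "\<And>x. x \<in> sphere 0 1 \<Longrightarrow> F x = u x ^ m * p_form (tangent_space x) m (A_form \<phi> x)"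
begin

lemma u_nz: "x \<noteq> 0 \<Longrightarrow> u x \<noteq> 0"
  using u(3)[of x] by simp

lemma integrable_smooth: "smooth_punct G \<Longrightarrow> integrable sphere_area G"
  by (rule integrable_sphere_area[OF smooth_punct_continuous_sphere])

text \<open>The interpolation weights combine the horospherical integrals at c = 2 j - 1 into one
  for p_m. The power n + 1 of u consists of 1 from the determinant formula, n - m from sampling at
  multiples of 1 / u, and m from solving the curvature equation for p_m.\<close>

lemma weighted_integral:
  "(\<integral>x. (grad u x $ i + (a \<bullet> x) * grad u x $ i - (a \<bullet> grad u x) * x $ i) * (F x / u x ^ (n + 1)) \<partial>sphere_area) = 0"
proof -
  obtain w :: "nat \<Rightarrow> real" where
    w: "\<And>c. (\<Sum>j\<le>n. w j * (\<Sum>i\<le>n. c i * real j ^ i)) = (if n - m \<le> n then c (n - m) else 0)"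
    using coefficient_weights[of n "n - m"] by blast
  let ?v = "\<lambda>x. grad u x $ i + (a \<bullet> x) * grad u x $ i - (a \<bullet> grad u x) * x $ i"
  have sv: "smooth_punct (\<lambda>x. ?v x / u x * det (full_mat u c x))" for c
    unfolding inner_vec_def
    by (simp, intro smooth_punct_intros smooth_punct_grad_nth smooth_punct_coord smooth_punct_det_full_mat u u_nz)
  have N2: "CARD('n) \<ge> 2" using N by simp
  have C: "real (n choose m) \<noteq> 0" using m by simp
  have "?v x * (F x / u x ^ (n + 1))
     = (\<Sum>j\<le>n. w j / real (n choose m) * (?v x / u x * det (full_mat u (2 * real j - 1) x)))"
    if x: "x \<in> sphere 0 1" for x
  proof -
    have ux: "u x \<noteq> 0" using x by (intro u_nz) auto
    define p where "p = p_form (tangent_space x) m (A_form \<phi> x)"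
    have e: "p * real (n choose m) * (1 / u x) ^ (n - m) = (\<Sum>j\<le>n. w j * det (full_mat u (2 * real j - 1) x))"
      unfolding p_def by (rule p_form_A_form[OF u(1,2) eq x ux N(1) m w])
    have "(\<Sum>j\<le>n. w j / real (n choose m) * (?v x / u x * det (full_mat u (2 * real j - 1) x)))
      = ?v x / u x / real (n choose m) * (p * real (n choose m) * (1 / u x) ^ (n - m))"
      unfolding e sum_distrib_left by (rule sum.cong[OF refl], simp add: field_simps)
    also have "\<dots> = ?v x * (p * ((1 / u x) ^ (n - m) / u x))" using C by simp
    also have "p * ((1 / u x) ^ (n - m) / u x) = F x / u x ^ (n + 1)"
      using ux m power_add[of "u x" m "n - m"] curv[OF x] by (simp add: p_def field_simps)
    finally show ?thesis ..
  qed
  then have "(\<integral>x. ?v x * (F x / u x ^ (n + 1)) \<partial>sphere_area)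
    = (\<integral>x. (\<Sum>j\<le>n. w j / real (n choose m) * (?v x / u x * det (full_mat u (2 * real j - 1) x))) \<partial>sphere_area)"
    by (intro Bochner_Integration.integral_cong refl) (simp add: space_sphere_area)
  also have "\<dots> = (\<Sum>j\<le>n. w j / real (n choose m) * (\<integral>x. ?v x / u x * det (full_mat u (2 * real j - 1) x) \<partial>sphere_area))"
    by (subst Bochner_Integration.integral_sum, rule integrable_mult_right, rule integrable_smooth[OF sv])
       (simp only: integral_mult_right_zero)
  also have "\<dots> = 0" using integral_horospherical[OF u(1,2) u_nz N2, of i a] by simp
  finally show ?thesis .
qed

text \<open>The function to integrate by parts: its derivative is u^(-n) dF - n F u^(-n-1) du, and
  the second term is of the kind handled by \<open>weighted_integral\<close>.\<close>

definition wF where "wF = (\<lambda>x. F x * inverse (u x) ^ n)"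

lemma smooth_wF: "smooth_punct wF"
  unfolding wF_def by (intro smooth_punct_intros F u u_nz)

lemma pd_wF:
  assumes x: "x \<noteq> 0"
  shows "pd v wF x = pd v F x * inverse (u x) ^ n - real n * (pd v u x * (F x / u x ^ (n + 1)))"
proof -
  have "pd v (\<lambda>x. inverse (u x) ^ n) x = real n * pd v (\<lambda>x. inverse (u x)) x * inverse (u x) ^ (n - 1)"
    by (rule pd_power[OF smooth_punct_inverse[OF u(1) u_nz] x])
  also have "pd v (\<lambda>x. inverse (u x)) x = - (pd v u x * inverse (u x) ^ 2)"
    by (rule pd_inverse) (use x u u_nz in auto)
  also have "real n * - (pd v u x * inverse (u x) ^ 2) * inverse (u x) ^ (n - 1) = - (real n * pd v u x / u x ^ (n + 1))"
    using N(2) u_nz[OF x] by (cases n) (auto simp: field_simps power2_eq_square)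
  finally have "pd v (\<lambda>x. inverse (u x) ^ n) x = - (real n * pd v u x / u x ^ (n + 1))" .
  moreover have "pd v wF x = pd v F x * inverse (u x) ^ n + F x * pd v (\<lambda>x. inverse (u x) ^ n) x"
    unfolding wF_def by (rule pd_mult) (use x in \<open>auto intro!: smooth_punct_intros F u u_nz\<close>)
  ultimately show ?thesis by simp
qed

text \<open>Differentiate \<open>wF\<close> along the tangential part of a unit vector. The
  divergence term n x_i wF cancels the radial derivative of u^(-n), and the term with grad u is
  \<open>weighted_integral\<close> at a = 0.\<close>

lemma integral_gradient_field:
  "(\<integral>x. inverse (u x) ^ n * (grad F x $ i - x $ i * (x \<bullet> grad F x)) \<partial>sphere_area) = 0"
proof -
  let ?D = "\<lambda>x. grad wF x $ i - x $ i * (x \<bullet> grad wF x) - real (CARD('n) - 1) * (x $ i * wF x)"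
  have sD: "smooth_punct ?D"
    unfolding inner_vec_def
    by (simp, intro smooth_punct_intros smooth_punct_grad_nth smooth_punct_coord smooth_wF)
  have sw: "smooth_punct (\<lambda>x. grad u x $ i * (F x / u x ^ (n + 1)))"
    by (intro smooth_punct_intros smooth_punct_grad_nth F u) (use u_nz in auto)
  have "inverse (u x) ^ n * (grad F x $ i - x $ i * (x \<bullet> grad F x))
      = ?D x + real n * (grad u x $ i * (F x / u x ^ (n + 1)))"
    if xs: "x \<in> sphere 0 1" for x
  proof -
    have x: "x \<noteq> 0" using xs by auto
    have g: "grad wF x $ i = grad F x $ i * inverse (u x) ^ n - real n * (grad u x $ i * (F x / u x ^ (n + 1)))"
      using pd_wF[OF x, of "axis i 1"] by (simp add: grad_def)
    have "x \<bullet> grad wF x = pd x F x * inverse (u x) ^ n - real n * (pd x u x * (F x / u x ^ (n + 1)))"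
      using pd_wF[OF x, of x] by (simp only: pd_eq_inner_grad[OF smooth_wF x, symmetric])
    also have "pd x u x = u x" using homogeneous_euler[OF u(1,2) x] by simp
    also have "pd x F x = x \<bullet> grad F x" by (rule pd_eq_inner_grad[OF F x])
    finally have e: "x \<bullet> grad wF x = (x \<bullet> grad F x) * inverse (u x) ^ n - real n * (u x * (F x / u x ^ (n + 1)))" .
    have hx: "u x * (F x / u x ^ (n + 1)) = wF x" using u_nz[OF x] by (simp add: wF_def field_simps)
    show ?thesis unfolding g e hx by (simp add: N algebra_simps)
  qed
  then have "(\<integral>x. inverse (u x) ^ n * (grad F x $ i - x $ i * (x \<bullet> grad F x)) \<partial>sphere_area)
    = (\<integral>x. ?D x + real n * (grad u x $ i * (F x / u x ^ (n + 1))) \<partial>sphere_area)"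
    by (intro Bochner_Integration.integral_cong refl) (simp add: space_sphere_area)
  also have "\<dots> = (\<integral>x. ?D x \<partial>sphere_area) + real n * (\<integral>x. grad u x $ i * (F x / u x ^ (n + 1)) \<partial>sphere_area)"
    by (simp only: Bochner_Integration.integral_add[OF integrable_smooth[OF sD] integrable_mult_right[OF integrable_smooth[OF sw]]]
        integral_mult_right_zero)
  also have "(\<integral>x. ?D x \<partial>sphere_area) = 0" by (rule integral_sphere_tangential_gradient[OF smooth_wF])
  finally show ?thesis using weighted_integral[of i 0] by simp
qed

text \<open>Apply a rotation derivative to \<open>wF\<close>. With p = grad u, the term x_j p_i -
  x_i p_j is the difference of the weights at a = e_j and a = 0.\<close>

lemma integral_rotation_field:
  "(\<integral>x. inverse (u x) ^ n * (x $ j * grad F x $ i - x $ i * grad F x $ j) \<partial>sphere_area) = 0"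
proof (cases "j = i")
  case False
  let ?R = "\<lambda>G x. x $ j * pd (axis i 1) G x - x $ i * pd (axis j 1) G (x::real^'n)"
  have ij: "axis j (1::real) \<bullet> axis i 1 = 0" using False by (simp add: inner_axis_axis)
  let ?w = "\<lambda>a x. (grad u x $ i + (a \<bullet> x) * grad u x $ i - (a \<bullet> grad u x) * x $ i) * (F x / u x ^ (n + 1))"
  have sw: "smooth_punct (?w a)" for a
    unfolding inner_vec_def
    by (simp, intro smooth_punct_intros smooth_punct_grad_nth smooth_punct_coord F u) (use u_nz in auto)
  have sR: "smooth_punct (?R wF)" by (intro smooth_punct_intros smooth_punct_coord smooth_wF)
  have "inverse (u x) ^ n * (x $ j * grad F x $ i - x $ i * grad F x $ j)
    = ?R wF x + real n * (?w (axis j 1) x - ?w 0 x)" if "x \<in> sphere 0 1" for x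
  proof -
    have x: "x \<noteq> 0" using that by auto
    have ax: "axis j 1 \<bullet> x = x $ j" "axis j 1 \<bullet> grad u x = grad u x $ j"
      by (simp_all add: inner_commute[of "axis j 1"] inner_axis)
    show ?thesis
      unfolding pd_wF[OF x] ax by (simp add: grad_def algebra_simps)
  qed
  then have "(\<integral>x. inverse (u x) ^ n * (x $ j * grad F x $ i - x $ i * grad F x $ j) \<partial>sphere_area)
    = (\<integral>x. ?R wF x + real n * (?w (axis j 1) x - ?w 0 x) \<partial>sphere_area)"
    by (intro Bochner_Integration.integral_cong refl) (simp add: space_sphere_area)
  also have "\<dots> = (\<integral>x. ?R wF x \<partial>sphere_area)
      + real n * ((\<integral>x. ?w (axis j 1) x \<partial>sphere_area) - (\<integral>x. ?w 0 x \<partial>sphere_area))"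
    using integrable_smooth[OF sR] integrable_smooth[OF sw[of "axis j 1"]] integrable_smooth[OF sw[of 0]] by simp
  also have "(\<integral>x. ?R wF x \<partial>sphere_area) = 0"
    using integral_sphere_area_rot[OF smooth_wF, of "axis j 1" "axis i 1"] ij by (simp add: inner_axis)
  also have "0 + real n * ((\<integral>x. ?w (axis j 1) x \<partial>sphere_area) - (\<integral>x. ?w 0 x \<partial>sphere_area)) = 0"
    unfolding weighted_integral by simp
  finally show ?thesis .
qed simp

lemma integral_moebius_field:
  fixes \<Omega> :: "real^'n^'n" and b :: "real^'n"
  assumes \<Omega>: "\<And>i j. \<Omega> $ i $ j = - \<Omega> $ j $ i"
  shows "has_bochner_integral sphere_area
    (\<lambda>x. inverse (u x) ^ n * ((\<Omega> *v x + b - (b \<bullet> x) *\<^sub>R x) \<bullet> grad F x)) 0"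
proof -
  let ?g = "\<lambda>i x. inverse (u x) ^ n * (grad F x $ i - x $ i * (x \<bullet> grad F x))"
  let ?r = "\<lambda>i j x. inverse (u x) ^ n * (x $ j * grad F x $ i - x $ i * grad F x $ j)"
  have sg: "smooth_punct (?g i)" for i
    unfolding inner_vec_def
    by (simp, intro smooth_punct_intros smooth_punct_grad_nth smooth_punct_coord F u u_nz)
  have sr: "smooth_punct (?r i j)" for i j
    by (intro smooth_punct_intros smooth_punct_grad_nth smooth_punct_coord F u u_nz)
  have g: "has_bochner_integral sphere_area (\<lambda>x. b $ i * ?g i x) (b $ i * 0)" for i
    by (intro has_bochner_integral_mult_right)
       (simp only: has_bochner_integral_iff integrable_smooth[OF sg] integral_gradient_field simp_thms)
  \<comment> \<open>Each rotation plane occurs as (i, j) and as (j, i); hence the factor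
    1/2.\<close>
  have r: "has_bochner_integral sphere_area (\<lambda>x. \<Omega> $ i $ j / 2 * ?r i j x) (\<Omega> $ i $ j / 2 * 0)" for i j
    by (intro has_bochner_integral_mult_right)
       (simp only: has_bochner_integral_iff integrable_smooth[OF sr] integral_rotation_field simp_thms)
  have "has_bochner_integral sphere_area
     (\<lambda>x. (\<Sum>i\<in>UNIV. b $ i * ?g i x) + (\<Sum>i\<in>UNIV. \<Sum>j\<in>UNIV. \<Omega> $ i $ j / 2 * ?r i j x))
     ((\<Sum>i\<in>UNIV. b $ i * 0) + (\<Sum>i\<in>UNIV. \<Sum>j\<in>UNIV. \<Omega> $ i $ j / 2 * 0))"
    by (intro has_bochner_integral_add has_bochner_integral_sum g r)
  moreover have "(\<Sum>i\<in>UNIV. b $ i * ?g i x) + (\<Sum>i\<in>UNIV. \<Sum>j\<in>UNIV. \<Omega> $ i $ j / 2 * ?r i j x)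
     = inverse (u x) ^ n * ((\<Omega> *v x + b - (b \<bullet> x) *\<^sub>R x) \<bullet> grad F x)" for x
  proof -
    have 1: "(\<Sum>i\<in>UNIV. b $ i * ?g i x) = inverse (u x) ^ n * ((b - (b \<bullet> x) *\<^sub>R x) \<bullet> grad F x)"
      by (simp add: inner_diff_left inner_vec_def[of b] sum_distrib_left sum_distrib_right sum_subtractf algebra_simps)
    have "(\<Sum>i\<in>UNIV. \<Sum>j\<in>UNIV. \<Omega> $ i $ j / 2 * (x $ j * grad F x $ i - x $ i * grad F x $ j))
      = (\<Sum>i\<in>UNIV. \<Sum>j\<in>UNIV. \<Omega> $ i $ j / 2 * (x $ j * grad F x $ i))
       - (\<Sum>i\<in>UNIV. \<Sum>j\<in>UNIV. \<Omega> $ i $ j / 2 * (x $ i * grad F x $ j))"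
      by (simp add: sum_subtractf right_diff_distrib)
    also have "(\<Sum>i\<in>UNIV. \<Sum>j\<in>UNIV. \<Omega> $ i $ j / 2 * (x $ i * grad F x $ j))
       = (\<Sum>i\<in>UNIV. \<Sum>j\<in>UNIV. \<Omega> $ j $ i / 2 * (x $ j * grad F x $ i))"
      by (rule sum.swap)
    also have "\<dots> = - (\<Sum>i\<in>UNIV. \<Sum>j\<in>UNIV. \<Omega> $ i $ j / 2 * (x $ j * grad F x $ i))"
      unfolding sum_negf[symmetric]
    proof (intro sum.cong refl)
      fix i j
      show "\<Omega> $ j $ i / 2 * (x $ j * grad F x $ i) = - (\<Omega> $ i $ j / 2 * (x $ j * grad F x $ i))"
        using \<Omega>[of j i] by simp
    qed
    finally have "(\<Sum>i\<in>UNIV. \<Sum>j\<in>UNIV. \<Omega> $ i $ j / 2 * (x $ j * grad F x $ i - x $ i * grad F x $ j))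
       = (\<Sum>i\<in>UNIV. \<Sum>j\<in>UNIV. \<Omega> $ i $ j * (x $ j * grad F x $ i))"
      by (simp only: minus_minus diff_minus_eq_add sum.distrib[symmetric]) (intro sum.cong refl, simp)
    also have "\<dots> = (\<Omega> *v x) \<bullet> grad F x"
      by (simp only: inner_vec_def[of "\<Omega> *v x"]) (simp add: matrix_vector_mult_def sum_distrib_left sum_distrib_right mult_ac)
    finally have 2: "(\<Sum>i\<in>UNIV. \<Sum>j\<in>UNIV. \<Omega> $ i $ j / 2 * (x $ j * grad F x $ i - x $ i * grad F x $ j))
      = (\<Omega> *v x) \<bullet> grad F x" .
    have "(\<Sum>i\<in>UNIV. \<Sum>j\<in>UNIV. \<Omega> $ i $ j / 2 * ?r i j x) = inverse (u x) ^ n * ((\<Omega> *v x) \<bullet> grad F x)"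
      unfolding 2[symmetric] sum_distrib_left by (intro sum.cong refl) (rule mult.left_commute)
    with 1 show ?thesis by (simp add: inner_add_left inner_diff_left algebra_simps)
  qed
  ultimately show ?thesis by simp
qed

end

subsection \<open>Harmonic functions on punctured space\<close>

text \<open>In dimension at least 2 the punctured space is connected.\<close>

lemma constant_on_punct:
  fixes G :: "real^'n \<Rightarrow> real"
  assumes G: "smooth_punct G" and N: "CARD('n) \<ge> 2" and z: "\<And>x v. x \<noteq> 0 \<Longrightarrow> pd v G x = 0"
  obtains c where "\<And>x. x \<noteq> 0 \<Longrightarrow> G x = c"
proof -
  have con: "connected (- {0 :: real^'n})" using N by (intro connected_punctured_universe) simp
  let ?e = "axis undefined 1 :: real^'n"
  have e: "?e \<noteq> 0" by (simp add: axis_eq_0_iff)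
  show ?thesis
  proof (rule that[of "G ?e"])
    fix x :: "real^'n" assume x: "x \<noteq> 0"
    show "G x = G ?e"
    proof (rule has_derivative_zero_unique_connected[OF _ con])
      show "(G has_derivative (\<lambda>v. 0)) (at y)" if "y \<in> - {0}" for y
        using smooth_punct_deriv[OF G, of y] z[of y] that by simp
    qed (use x e in auto)
  qed
qed

lemma homogeneous_radial_eq:
  assumes "homogeneous k F" "x \<noteq> 0"
  shows "F x = norm x powi k * F (x /\<^sub>R norm x)"
  using assms(1)[unfolded homogeneous_def, rule_format, of "x /\<^sub>R norm x" "norm x"] assms(2) by simp

definition laplacian :: "(real^'n \<Rightarrow> real) \<Rightarrow> real^'n \<Rightarrow> real" where
  "laplacian F x = (\<Sum>j\<in>UNIV. pd (axis j 1) (pd (axis j 1) F) x)"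

text \<open>Energy argument: the tangential divergence identities for \<open>G\<close> times its
  partial derivatives add up to |grad G|^2 plus \<open>G\<close> times its Laplacian, since the
  radial terms vanish by Euler's relation. So the gradient vanishes on the sphere, and its degree -1
  carries this to all other points.\<close>

lemma harmonic_homogeneous_0_constant:
  fixes G :: "real^'n \<Rightarrow> real"
  assumes G: "smooth_punct G" "homogeneous 0 G" and harm: "\<And>x. x \<noteq> 0 \<Longrightarrow> laplacian G x = 0"
    and x: "x \<noteq> 0"
  shows "pd v G x = 0"
proof -
  let ?g = "\<lambda>i x. G x * pd (axis i 1) G (x::real^'n)"
  let ?D = "\<lambda>i x. grad (?g i) x $ i - x $ i * (x \<bullet> grad (?g i) x) - real (CARD('n) - 1) * (x $ i * ?g i x)"
  have sg: "smooth_punct (?g i)" for i by (intro smooth_punct_intros G)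
  have sD: "smooth_punct (?D i)" for i
    unfolding inner_vec_def
    by (simp, intro smooth_punct_intros smooth_punct_grad_nth smooth_punct_coord G)
  have s2: "smooth_punct (\<lambda>x. grad G x \<bullet> grad G x)" by (rule smooth_punct_grad_sq[OF G(1)])
  have D: "(\<Sum>i\<in>UNIV. ?D i y) = grad G y \<bullet> grad G y" if y: "y \<noteq> 0" for y
  proof -
    have pg: "pd w (?g i) y = pd w G y * pd (axis i 1) G y + G y * pd w (pd (axis i 1) G) y" for w i
      by (rule pd_mult[OF G(1) smooth_punct_pd[OF G(1)] y])
    have e0: "pd y G y = 0" using homogeneous_euler[OF G y] by simp
    have e1: "pd y (pd (axis i 1) G) y = - pd (axis i 1) G y" for i
      using homogeneous_euler[OF smooth_punct_pd[OF G(1)] homogeneous_pd[OF G] y] by simp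
    have sumG: "(\<Sum>i\<in>UNIV. y $ i * pd (axis i 1) G y) = 0"
      using pd_eq_inner_grad[OF G(1) y, of y] e0 by (simp add: inner_vec_def grad_def)
    have "?D i y = pd (axis i 1) G y * pd (axis i 1) G y + G y * pd (axis i 1) (pd (axis i 1) G) y
        + (1 - real (CARD('n) - 1)) * G y * (y $ i * pd (axis i 1) G y)" for i
    proof -
      have "y \<bullet> grad (?g i) y = - (G y * pd (axis i 1) G y)"
        using pd_eq_inner_grad[OF sg y, of y i] pg[of y i] by (simp add: e0 e1)
      moreover have "grad (?g i) y $ i = pd (axis i 1) (?g i) y" by (simp add: grad_def)
      ultimately show ?thesis by (simp add: pg algebra_simps)
    qed
    then have "(\<Sum>i\<in>UNIV. ?D i y) = (\<Sum>i\<in>UNIV. pd (axis i 1) G y * pd (axis i 1) G y) + G y * laplacian G y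
       + (1 - real (CARD('n) - 1)) * G y * (\<Sum>i\<in>UNIV. y $ i * pd (axis i 1) G y)"
      by (simp only: sum.distrib sum_distrib_left laplacian_def)
    then show ?thesis by (simp add: harm[OF y] sumG inner_vec_def grad_def)
  qed
  have "(\<integral>x. grad G x \<bullet> grad G x \<partial>sphere_area) = (\<integral>x. (\<Sum>i\<in>UNIV. ?D i x) \<partial>sphere_area)"
    by (rule Bochner_Integration.integral_cong[OF refl], rule D[symmetric]) (auto simp: space_sphere_area)
  also have "\<dots> = (\<Sum>i\<in>UNIV. \<integral>x. ?D i x \<partial>sphere_area)"
    by (rule Bochner_Integration.integral_sum) (intro integrable_sphere_area smooth_punct_continuous_sphere sD)
  also have "\<dots> = 0" unfolding integral_sphere_tangential_gradient[OF sg] by simp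
  finally have int0: "(\<integral>x. grad G x \<bullet> grad G x \<partial>sphere_area) = 0" .
  have "grad G (x /\<^sub>R norm x) \<bullet> grad G (x /\<^sub>R norm x) = 0"
    by (rule integral_sphere_area_eq_0[OF smooth_punct_continuous_sphere[OF s2] _ int0]) (use x in auto)
  then have "pd v G (x /\<^sub>R norm x) = 0"
    using pd_eq_inner_grad[OF G(1), of "x /\<^sub>R norm x" v] x by simp
  then show ?thesis using homogeneous_radial_eq[OF homogeneous_pd[OF G] x] by simp
qed

lemma laplacian_mult:
  assumes "smooth_punct F" "smooth_punct G" "x \<noteq> 0"
  shows "laplacian (\<lambda>x. F x * G x) x = laplacian F x * G x + 2 * (grad F x \<bullet> grad G x) + F x * laplacian G x"
proof -
  have "pd e (pd e (\<lambda>x. F x * G x)) x = pd e (pd e F) x * G x + 2 * (pd e F x * pd e G x) + F x * pd e (pd e G) x" for e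
  proof -
    have "pd e (pd e (\<lambda>x. F x * G x)) x = pd e (\<lambda>x. pd e F x * G x + F x * pd e G x) x"
      by (rule pd_cong[OF _ assms(3)]) (simp add: pd_mult assms)
    also have "\<dots> = pd e (\<lambda>x. pd e F x * G x) x + pd e (\<lambda>x. F x * pd e G x) x"
      by (intro pd_add smooth_punct_mult smooth_punct_pd assms)
    finally show ?thesis
      using pd_mult[OF smooth_punct_pd[OF assms(1)] assms(2,3)] pd_mult[OF assms(1) smooth_punct_pd[OF assms(2)] assms(3)]
      by simp
  qed
  then show ?thesis
    by (simp add: laplacian_def sum.distrib sum_distrib_left sum_distrib_right inner_vec_def grad_def)
qed

text \<open>The position field has divergence equal to the dimension, and Euler's relation turns x
  \<bullet> grad G into k G.\<close>

lemma divergence_radial: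
  fixes G :: "real^'n \<Rightarrow> real"
  assumes G: "smooth_punct G" "homogeneous k G" and x: "x \<noteq> 0"
  shows "(\<Sum>j\<in>UNIV. pd (axis j 1) (\<lambda>x. G x * x $ j) x) = (of_int k + real CARD('n)) * G x"
proof -
  have "pd (axis j 1) (\<lambda>x. G x * x $ j) x = pd (axis j 1) G x * x $ j + G x" for j
    using pd_mult[OF G(1) smooth_punct_coord x] by (simp add: pd_coord axis_def)
  then have "(\<Sum>j\<in>UNIV. pd (axis j 1) (\<lambda>x. G x * x $ j) x) = x \<bullet> grad G x + real CARD('n) * G x"
    by (simp add: sum.distrib inner_vec_def grad_def mult.commute)
  also have "x \<bullet> grad G x = of_int k * G x"
    using homogeneous_euler[OF G x] by (simp add: pd_eq_inner_grad[OF G(1) x])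
  finally show ?thesis by (simp add: algebra_simps)
qed

lemma homogeneous_mult:
  "homogeneous k F \<Longrightarrow> homogeneous l G \<Longrightarrow> homogeneous (k + l) (\<lambda>x. F x * G x)"
  by (auto simp: homogeneous_def power_int_add)

lemma homogeneous_inverse_norm: "homogeneous (- 1) (\<lambda>x. inverse (norm x))"
  by (auto simp: homogeneous_def power_int_minus)

lemma homogeneous_norm: "homogeneous 1 norm"
  by (auto simp: homogeneous_def)

lemma homogeneous_coord: "homogeneous 1 (\<lambda>x::real^'n. x $ k)"
  by (auto simp: homogeneous_def)

lemma homogeneous_sum: "(\<And>i. i \<in> I \<Longrightarrow> homogeneous k (F i)) \<Longrightarrow> homogeneous k (\<lambda>x. \<Sum>i\<in>I. F i x)"
  by (auto simp: homogeneous_def sum_distrib_left)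

lemma homogeneous_const: "homogeneous 0 (\<lambda>x. c)"
  by (auto simp: homogeneous_def)

lemma pd_axis_norm: "x \<noteq> 0 \<Longrightarrow> pd (axis j 1) norm (x::real^'n) = inverse (norm x) * x $ j"
  using pd_norm[of x "axis j 1"] by (simp add: inner_commute[of "axis j 1"] inner_axis divide_inverse mult.commute)

lemma laplacian_norm:
  fixes x :: "real^'n"
  assumes x: "x \<noteq> 0"
  shows "laplacian norm x = real (CARD('n) - 1) / norm x"
proof -
  have "pd (axis j 1) (pd (axis j 1) norm) x = pd (axis j 1) (\<lambda>x. inverse (norm x) * x $ j) x" for j
    by (rule pd_cong[OF _ x]) (rule pd_axis_norm)
  then show ?thesis
    using divergence_radial[OF smooth_punct_inverse_norm homogeneous_inverse_norm x]
    by (simp add: laplacian_def of_nat_diff Suc_leI divide_inverse)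
qed

subsection \<open>Conformal fields of the sphere\<close>

text \<open>The 1-homogeneous extension of a conformal field, componentwise, with \<open>s\<close> the conformal factor.\<close>

locale conformal_extension =
  fixes X :: "'n::finite \<Rightarrow> real^'n \<Rightarrow> real" and s :: "real^'n \<Rightarrow> real"
  assumes X: "\<And>k. smooth_punct (X k)" "\<And>k. homogeneous 1 (X k)"
    and s: "smooth_punct s" "homogeneous 0 s"
    and N: "CARD('n) \<ge> 3"
    and conf: "\<And>x j k. x \<noteq> 0 \<Longrightarrow> pd (axis j 1) (X k) x + pd (axis k 1) (X j) x
      = 2 * (s x * ((if j = k then 1 else 0) - x $ j * x $ k * inverse (norm x) ^ 2))"
begin

text \<open>The trace of \<open>conf\<close>: the projection orthogonal to x has trace
  \<open>CARD('n) - 1\<close>.\<close>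

lemma divergence_X:
  assumes x: "x \<noteq> 0"
  shows "(\<Sum>k\<in>UNIV. pd (axis k 1) (X k) x) = real (CARD('n) - 1) * s x"
proof -
  have "(\<Sum>k\<in>UNIV. pd (axis k 1) (X k) x) = (\<Sum>k\<in>UNIV. s x * (1 - x $ k * x $ k * inverse (norm x) ^ 2))"
    using conf[OF x, of k k for k] by (intro sum.cong refl) simp
  also have "\<dots> = s x * (real CARD('n) - (x \<bullet> x) * inverse (norm x) ^ 2)"
    by (simp add: sum_distrib_left[symmetric] sum_subtractf inner_vec_def sum_distrib_right)
  also have "(x \<bullet> x) * inverse (norm x) ^ 2 = 1" using x by (simp add: dot_square_norm power2_eq_square field_simps)
  finally show ?thesis by (simp add: of_nat_diff Suc_leI algebra_simps)
qed

text \<open>The double divergence of the conformal equation determines the Laplacian of \<open>s\<close>.\<close>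

lemma laplacian_s:
  assumes x: "x \<noteq> 0"
  shows "laplacian s x = - real (CARD('n) - 1) * s x * inverse (norm x) ^ 2"
proof -
  let ?n = "real (CARD('n) - 1)"
  let ?d = "\<lambda>j. pd (axis j (1::real)) :: (real^'n \<Rightarrow> real) \<Rightarrow> real^'n \<Rightarrow> real"
  have nN: "real CARD('n) = ?n + 1" using N by simp
  \<comment> \<open>The radial part of \<open>conf\<close> becomes \<tau> x_j x_k; since \<tau> has
    degree -2, both contractions are instances of \<open>divergence_radial\<close>.\<close>
  define \<tau> where "\<tau> = (\<lambda>x. s x * inverse (norm x) ^ 2)"
  have st: "smooth_punct \<tau>" unfolding \<tau>_def by (intro smooth_punct_intros s)
  have "homogeneous (0 + (- 1 + (- 1))) (\<lambda>x. s x * (inverse (norm x) * inverse (norm (x::real^'n))))"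
    by (intro homogeneous_mult s homogeneous_inverse_norm)
  then have ht: "homogeneous (- 2) \<tau>" by (simp add: \<tau>_def power2_eq_square)
  have sE: "smooth_punct (\<lambda>x. ?d j (X k) x)" for j k by (intro smooth_punct_pd X)
  have stj: "smooth_punct (\<lambda>x. \<tau> x * x $ j)" for j by (intro smooth_punct_mult st smooth_punct_coord)
  have htj: "homogeneous (- 1) (\<lambda>x. \<tau> x * x $ j)" for j
    using homogeneous_mult[OF ht homogeneous_coord[of j]] by simp
  have stjk: "smooth_punct (\<lambda>x. \<tau> x * x $ j * x $ k)" for j k by (intro smooth_punct_mult stj smooth_punct_coord)
  have dd: "?d j (\<lambda>y. \<Sum>k\<in>UNIV. ?d k (?d j (X k)) y) x + ?d j (\<lambda>y. \<Sum>k\<in>UNIV. ?d k (?d k (X j)) y) x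
     = 2 * ?d j (?d j s) x - 2 * ?n * ?d j (\<lambda>y. \<tau> y * y $ j) x" for j
  proof -
    have "(\<Sum>k\<in>UNIV. ?d k (?d j (X k)) y) + (\<Sum>k\<in>UNIV. ?d k (?d k (X j)) y)
        = 2 * ?d j s y - 2 * ?n * (\<tau> y * y $ j)" if y: "y \<noteq> 0" for y
    proof -
      have "?d k (?d j (X k)) y + ?d k (?d k (X j)) y
          = 2 * (if j = k then ?d k s y else 0) - 2 * ?d k (\<lambda>y. \<tau> y * y $ j * y $ k) y" for k
      proof -
        have "?d k (?d j (X k)) y + ?d k (?d k (X j)) y = ?d k (\<lambda>y. ?d j (X k) y + ?d k (X j) y) y"
          by (rule pd_add[symmetric]) (intro sE, intro sE, rule y)
        also have "\<dots> = ?d k (\<lambda>y. 2 * ((if j = k then 1 else 0) * s y - \<tau> y * y $ j * y $ k)) y"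
          by (rule pd_cong[OF _ y]) (simp add: conf \<tau>_def algebra_simps)
        also have "\<dots> = 2 * ?d k (\<lambda>y. (if j = k then 1 else 0) * s y - \<tau> y * y $ j * y $ k) y"
          by (subst pd_mult) (auto intro!: smooth_punct_intros s stjk y)
        also have "?d k (\<lambda>y. (if j = k then 1 else 0) * s y - \<tau> y * y $ j * y $ k) y
            = ?d k (\<lambda>y. (if j = k then 1 else 0) * s y) y - ?d k (\<lambda>y. \<tau> y * y $ j * y $ k) y"
          by (intro pd_diff smooth_punct_mult smooth_punct_const s stjk y)
        also have "?d k (\<lambda>y. (if j = k then 1 else 0) * s y) y = (if j = k then ?d k s y else 0)"
          by simp
        finally show ?thesis by simp
      qed
      then have "(\<Sum>k\<in>UNIV. ?d k (?d j (X k)) y) + (\<Sum>k\<in>UNIV. ?d k (?d k (X j)) y)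
         = 2 * ?d j s y - 2 * (\<Sum>k\<in>UNIV. ?d k (\<lambda>y. \<tau> y * y $ j * y $ k) y)"
        by (simp add: sum.distrib[symmetric] sum_subtractf sum_distrib_left[symmetric])
      also have "(\<Sum>k\<in>UNIV. ?d k (\<lambda>y. \<tau> y * y $ j * y $ k) y) = ?n * (\<tau> y * y $ j)"
        using divergence_radial[OF stj htj y] unfolding nN by simp
      finally show ?thesis by simp
    qed
    then have "?d j (\<lambda>y. (\<Sum>k\<in>UNIV. ?d k (?d j (X k)) y) + (\<Sum>k\<in>UNIV. ?d k (?d k (X j)) y)) x
        = ?d j (\<lambda>y. 2 * ?d j s y - 2 * ?n * (\<tau> y * y $ j)) x"
      by (rule pd_cong[OF _ x])
    also have "\<dots> = ?d j (\<lambda>y. 2 * ?d j s y) x - ?d j (\<lambda>y. 2 * ?n * (\<tau> y * y $ j)) x"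
      by (intro pd_diff smooth_punct_mult smooth_punct_const smooth_punct_pd s st smooth_punct_coord x)
    also have "?d j (\<lambda>y. 2 * ?d j s y) x = 2 * ?d j (?d j s) x"
      by (subst pd_mult) (auto intro!: smooth_punct_intros s x)
    also have "?d j (\<lambda>y. 2 * ?n * (\<tau> y * y $ j)) x = 2 * ?n * ?d j (\<lambda>y. \<tau> y * y $ j) x"
      by (subst pd_mult) (auto intro!: smooth_punct_intros stj x)
    finally show ?thesis
      by (subst (asm) pd_add) (auto intro!: smooth_punct_intros X x)
  qed
  \<comment> \<open>Reordering third derivatives turns both contractions into second derivatives of
    the terms D_k X_k of the divergence.\<close>
  have comm: "?d j (\<lambda>y. ?d k (?d j (X k)) y) x = ?d j (?d j (?d k (X k))) x"
    "?d j (\<lambda>y. ?d k (?d k (X j)) y) x = ?d k (?d k (?d j (X j))) x" for j k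
  proof -
    show "?d j (\<lambda>y. ?d k (?d j (X k)) y) x = ?d j (?d j (?d k (X k))) x"
      by (rule pd_cong[OF _ x]) (rule pd_commute[OF X(1)])
    have "?d j (\<lambda>y. ?d k (?d k (X j)) y) x = ?d k (?d j (?d k (X j))) x"
      by (rule pd_commute[OF smooth_punct_pd[OF X(1)] x])
    also have "\<dots> = ?d k (?d k (?d j (X j))) x"
      by (rule pd_cong[OF _ x]) (rule pd_commute[OF X(1)])
    finally show "?d j (\<lambda>y. ?d k (?d k (X j)) y) x = ?d k (?d k (?d j (X j))) x" .
  qed
  have lapdiv: "(\<Sum>j\<in>UNIV. \<Sum>k\<in>UNIV. ?d j (?d j (?d k (X k))) x) = ?n * laplacian s x"
  proof -
    have "(\<Sum>k\<in>UNIV. ?d j (?d j (?d k (X k))) x) = ?n * ?d j (?d j s) x" for j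
    proof -
      have "(\<Sum>k\<in>UNIV. ?d j (?d j (?d k (X k))) x) = ?d j (\<lambda>y. \<Sum>k\<in>UNIV. ?d j (?d k (X k)) y) x"
        by (rule pd_sum[symmetric]) (intro smooth_punct_pd X, rule x)
      also have "\<dots> = ?d j (\<lambda>y. ?n * ?d j s y) x"
      proof (rule pd_cong[OF _ x])
        fix y :: "real^'n" assume y: "y \<noteq> 0"
        have "(\<Sum>k\<in>UNIV. ?d j (?d k (X k)) y) = ?d j (\<lambda>y. \<Sum>k\<in>UNIV. ?d k (X k) y) y"
          by (rule pd_sum[symmetric]) (intro smooth_punct_pd X, rule y)
        also have "\<dots> = ?d j (\<lambda>y. ?n * s y) y" by (rule pd_cong[OF _ y]) (rule divergence_X)
        also have "\<dots> = ?n * ?d j s y" by (subst pd_mult) (auto intro!: smooth_punct_const s y)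
        finally show "(\<Sum>k\<in>UNIV. ?d j (?d k (X k)) y) = ?n * ?d j s y" .
      qed
      also have "\<dots> = ?n * ?d j (?d j s) x" by (subst pd_mult) (auto intro!: smooth_punct_intros s x)
      finally show ?thesis .
    qed
    then show ?thesis by (simp add: laplacian_def sum_distrib_left)
  qed
  have "?d j (\<lambda>y. \<Sum>k\<in>UNIV. ?d k (?d j (X k)) y) x = (\<Sum>k\<in>UNIV. ?d j (?d j (?d k (X k))) x)" for j
    by (subst pd_sum) (auto intro!: smooth_punct_pd X x sum.cong comm(1))
  moreover have "?d j (\<lambda>y. \<Sum>k\<in>UNIV. ?d k (?d k (X j)) y) x = (\<Sum>k\<in>UNIV. ?d k (?d k (?d j (X j))) x)" for j
    by (subst pd_sum) (auto intro!: smooth_punct_pd X x sum.cong comm(2))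
  ultimately have "(\<Sum>k\<in>UNIV. ?d j (?d j (?d k (X k))) x) + (\<Sum>k\<in>UNIV. ?d k (?d k (?d j (X j))) x)
     = 2 * ?d j (?d j s) x - 2 * ?n * ?d j (\<lambda>y. \<tau> y * y $ j) x" for j using dd[of j] by simp
  then have "(\<Sum>j\<in>UNIV. (\<Sum>k\<in>UNIV. ?d j (?d j (?d k (X k))) x) + (\<Sum>k\<in>UNIV. ?d k (?d k (?d j (X j))) x))
     = 2 * laplacian s x - 2 * ?n * (\<Sum>j\<in>UNIV. ?d j (\<lambda>y. \<tau> y * y $ j) x)"
    by (simp add: sum_subtractf sum_distrib_left laplacian_def)
  moreover have "(\<Sum>j\<in>UNIV. ?d j (\<lambda>y. \<tau> y * y $ j) x) = (?n - 1) * \<tau> x"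
    using divergence_radial[OF st ht x] unfolding nN by simp
  moreover have "(\<Sum>j\<in>UNIV. \<Sum>k\<in>UNIV. ?d k (?d k (?d j (X j))) x) = ?n * laplacian s x"
    unfolding lapdiv[symmetric] by (rule sum.swap)
  ultimately have "2 * ?n * laplacian s x = 2 * laplacian s x - 2 * ?n * ((?n - 1) * \<tau> x)"
    by (simp add: sum.distrib lapdiv algebra_simps)
  then have "(?n - 1) * (laplacian s x + ?n * \<tau> x) = 0" by algebra
  \<comment> \<open>This factor would vanish on the circle, where every tangent field is
    conformal.\<close>
  moreover have "?n - 1 \<noteq> 0" using N by auto
  ultimately have "laplacian s x + ?n * \<tau> x = 0" by simp
  then have "laplacian s x = - (?n * \<tau> x)" by (rule eq_neg_iff_add_eq_0[THEN iffD2])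
  then show ?thesis by (simp only: \<tau>_def mult.assoc mult_minus_left)
qed

text \<open>Hence \<open>norm x * s x\<close> is harmonic and 1-homogeneous, so that its derivatives are constant.\<close>

lemma s_linear:
  obtains b where "\<And>x. x \<noteq> 0 \<Longrightarrow> s x = (b \<bullet> x) * inverse (norm x)"
proof -
  define w where "w = (\<lambda>x. norm x * s x)"
  have sw: "smooth_punct w" unfolding w_def by (intro smooth_punct_intros s)
  have hw: "homogeneous 1 w" using homogeneous_mult[OF homogeneous_norm s(2)] by (simp add: w_def)
  have lw: "laplacian w x = 0" if x: "x \<noteq> 0" for x
  proof -
    \<comment> \<open>The cross term of the product rule is a radial derivative of \<open>s\<close>,
      which has degree 0.\<close>
    have "grad norm x = inverse (norm x) *\<^sub>R x"
      by (simp add: grad_def vec_eq_iff pd_axis_norm[OF x])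
    then have "grad norm x \<bullet> grad s x = inverse (norm x) * pd x s x"
      by (simp add: pd_eq_inner_grad[OF s(1) x])
    also have "pd x s x = 0" using homogeneous_euler[OF s x] by simp
    finally have "grad norm x \<bullet> grad s x = 0" by simp
    then show ?thesis
      unfolding w_def laplacian_mult[OF smooth_punct_norm s(1) x] laplacian_norm[OF x] laplacian_s[OF x]
      using x by (simp add: field_simps power2_eq_square)
  qed
  \<comment> \<open>Differentiation commutes with the Laplacian, so each partial derivative of
    \<open>w\<close> is harmonic of degree 0.\<close>
  have "\<exists>c. \<forall>x. x \<noteq> 0 \<longrightarrow> pd (axis i 1) w x = c" for i
  proof -
    let ?h = "pd (axis i 1) w"
    have sh: "smooth_punct ?h" by (rule smooth_punct_pd[OF sw])
    have hh: "homogeneous 0 ?h" using homogeneous_pd[OF sw hw] by simp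
    have "laplacian ?h x = 0" if x: "x \<noteq> 0" for x
    proof -
      have "pd (axis j 1) (pd (axis j 1) ?h) x = pd (axis i 1) (pd (axis j 1) (pd (axis j 1) w)) x" for j
      proof -
        have "pd (axis j 1) (pd (axis j 1) ?h) x = pd (axis j 1) (pd (axis i 1) (pd (axis j 1) w)) x"
          by (rule pd_cong[OF _ x]) (rule pd_commute[OF sw])
        also have "\<dots> = pd (axis i 1) (pd (axis j 1) (pd (axis j 1) w)) x"
          by (rule pd_commute[OF smooth_punct_pd[OF sw] x])
        finally show ?thesis .
      qed
      then have "laplacian ?h x = (\<Sum>j\<in>UNIV. pd (axis i 1) (pd (axis j 1) (pd (axis j 1) w)) x)"
        by (simp add: laplacian_def)
      also have "\<dots> = pd (axis i 1) (\<lambda>y. \<Sum>j\<in>UNIV. pd (axis j 1) (pd (axis j 1) w) y) x"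
        by (rule pd_sum[symmetric]) (intro smooth_punct_pd sw, rule x)
      also have "\<dots> = pd (axis i 1) (\<lambda>y. 0) x"
        by (rule pd_cong[OF _ x]) (use lw in \<open>simp add: laplacian_def\<close>)
      finally show ?thesis by simp
    qed
    then have "pd v ?h x = 0" if "x \<noteq> 0" for x v
      using harmonic_homogeneous_0_constant[OF sh hh _ that] by blast
    moreover have "CARD('n) \<ge> 2" using N by simp
    ultimately show ?thesis using constant_on_punct[OF sh] by metis
  qed
  then obtain c where c: "\<And>i x. x \<noteq> 0 \<Longrightarrow> pd (axis i 1) w x = c i" by metis
  show ?thesis
  proof (rule that[of "\<chi> i. c i"])
    fix x :: "real^'n" assume x: "x \<noteq> 0"
    have "w x = x \<bullet> grad w x" using homogeneous_euler[OF sw hw x] pd_eq_inner_grad[OF sw x] by simp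
    also have "grad w x = (\<chi> i. c i)" by (simp add: grad_def c[OF x])
    finally show "s x = ((\<chi> i. c i) \<bullet> x) * inverse (norm x)"
      using x by (simp add: w_def inner_commute field_simps)
  qed
qed

text \<open>Subtracting the extended gradient field of - b \<bullet> x, whose conformal factor is b
  \<bullet> x, leaves a field \<open>K\<close> that satisfies the Euclidean Killing equation off the
  origin. Its first derivatives are constant and skew, so by homogeneity it is linear.\<close>

lemma X_moebius:
  obtains \<Omega> :: "real^'n^'n" and b :: "real^'n" where
    "\<And>i j. \<Omega> $ i $ j = - \<Omega> $ j $ i"
    "\<And>x k. x \<in> sphere 0 1 \<Longrightarrow> X k x = (\<Omega> *v x + b - (b \<bullet> x) *\<^sub>R x) $ k"
proof -
  obtain b where b: "\<And>x. x \<noteq> 0 \<Longrightarrow> s x = (b \<bullet> x) * inverse (norm x)" using s_linear by blast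
  define K where "K = (\<lambda>k x. X k x + norm x * b $ k - (x \<bullet> b) * x $ k * inverse (norm x))"
  let ?d = "\<lambda>j. pd (axis j (1::real)) :: (real^'n \<Rightarrow> real) \<Rightarrow> real^'n \<Rightarrow> real"
  have sK: "smooth_punct (K k)" for k
    unfolding K_def by (intro smooth_punct_intros X smooth_punct_coord)
  have hK: "homogeneous 1 (K k)" for k
    using X(2)[of k] by (auto simp: homogeneous_def K_def field_simps)
  have dK: "?d j (K k) x = ?d j (X k) x + x $ j * b $ k * inverse (norm x)
      - (b $ j * x $ k * inverse (norm x) + (b \<bullet> x) * (if j = k then 1 else 0) * inverse (norm x)
          - (b \<bullet> x) * x $ k * x $ j * inverse (norm x) ^ 3)" if x: "x \<noteq> 0" for j k x
  proof -
    have pn: "?d j (\<lambda>x. norm x) x = x $ j * inverse (norm x)"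
      using pd_axis_norm[OF x] by (simp add: mult.commute)
    have "?d j (K k) x = ?d j (\<lambda>x. X k x + norm x * b $ k) x - ?d j (\<lambda>x. (x \<bullet> b) * x $ k * inverse (norm x)) x"
      unfolding K_def by (intro pd_diff smooth_punct_intros X smooth_punct_coord x)
    also have "?d j (\<lambda>x. X k x + norm x * b $ k) x = ?d j (X k) x + ?d j (\<lambda>x. norm x * b $ k) x"
      by (intro pd_add smooth_punct_intros X x)
    also have "?d j (\<lambda>x. norm x * b $ k) x = x $ j * inverse (norm x) * b $ k"
      using pd_mult[OF smooth_punct_norm smooth_punct_const x, of "axis j 1" "b $ k"] by (simp add: pn)
    also have "?d j (\<lambda>x. (x \<bullet> b) * x $ k * inverse (norm x)) x
      = ?d j (\<lambda>x. (x \<bullet> b) * x $ k) x * inverse (norm x) + (x \<bullet> b) * x $ k * ?d j (\<lambda>x. inverse (norm x)) x"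
      by (intro pd_mult smooth_punct_intros smooth_punct_coord x)
    also have "?d j (\<lambda>x. inverse (norm x)) x = - (x $ j * inverse (norm x) * inverse (norm x) ^ 2)"
      using pd_inverse[OF smooth_punct_norm _ x, of "axis j 1"] x by (simp add: pn)
    also have "?d j (\<lambda>x. (x \<bullet> b) * x $ k) x = ?d j (\<lambda>x. x \<bullet> b) x * x $ k + (x \<bullet> b) * ?d j (\<lambda>x. x $ k) x"
      by (intro pd_mult smooth_punct_inner smooth_punct_coord x)
    also have "?d j (\<lambda>x. x \<bullet> b) x = b $ j"
      by (simp add: inner_commute[of "axis j 1"] inner_axis)
    also have "?d j (\<lambda>x. x $ k) x = (if j = k then 1 else 0)" by (simp add: pd_coord axis_def)
    finally show ?thesis
      by (simp add: inner_commute[of x b] power2_eq_square power3_eq_cube algebra_simps)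
  qed
  have killing: "?d j (K k) x + ?d k (K j) x = 0" if x: "x \<noteq> 0" for j k x
    using conf[OF x, of j k] unfolding dK[OF x] b[OF x]
    by (auto simp: power2_eq_square power3_eq_cube algebra_simps)
  \<comment> \<open>D_i D_j K_k is symmetric in i, j and skew in j, k; six alternating exchanges
    return it with the opposite sign.\<close>
  have d2: "?d i (?d j (K k)) x = 0" if x: "x \<noteq> 0" for i j k x
  proof -
    have c: "?d i (?d j (K k)) x = ?d j (?d i (K k)) x" for i j k by (rule pd_commute[OF sK x])
    have a: "?d i (?d j (K k)) x = - ?d i (?d k (K j)) x" for i j k
    proof -
      have "?d i (\<lambda>y. ?d j (K k) y + ?d k (K j) y) x = ?d i (\<lambda>y. 0) x"
        by (rule pd_cong[OF _ x]) (rule killing)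
      then show ?thesis by (subst (asm) pd_add) (auto intro!: smooth_punct_pd sK x)
    qed
    show ?thesis using a[of i j k] c[of i k j] a[of k i j] c[of k j i] a[of j k i] c[of j i k] by simp
  qed
  have "pd v (?d j (K k)) x = 0" if x: "x \<noteq> 0" for v j k x
  proof -
    have "grad (?d j (K k)) x = 0" using d2[OF x] by (simp add: grad_def vec_eq_iff)
    then show ?thesis using pd_eq_inner_grad[OF smooth_punct_pd[OF sK] x, of v "axis j 1" k] by simp
  qed
  moreover have "CARD('n) \<ge> 2" using N by simp
  ultimately have "\<exists>c. \<forall>x. x \<noteq> 0 \<longrightarrow> ?d j (K k) x = c" for j k
    using constant_on_punct[OF smooth_punct_pd[OF sK]] by metis
  then obtain c where c: "\<And>j k x. x \<noteq> 0 \<Longrightarrow> ?d j (K k) x = c j k" by metis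
  define \<Omega> where "\<Omega> = (\<chi> k j. c j k)"
  \<comment> \<open>The witness is \<open>- b\<close> because on the sphere the subtracted field is
    - b + (b \<bullet> x) x.\<close>
  show ?thesis
  proof (rule that[of \<Omega> "- b"])
    have e: "(axis undefined 1 :: real^'n) \<noteq> 0" by (simp add: axis_eq_0_iff)
    show "\<Omega> $ i $ j = - \<Omega> $ j $ i" for i j
      using killing[OF e, of j i] by (simp add: c[OF e] \<Omega>_def)
    fix x :: "real^'n" and k assume xs: "x \<in> sphere 0 1"
    then have x: "x \<noteq> 0" and n: "norm x = 1" by auto
    have "K k x = x \<bullet> grad (K k) x"
      using homogeneous_euler[OF sK hK x] pd_eq_inner_grad[OF sK x] by simp
    also have "\<dots> = (\<Omega> *v x) $ k"
      by (simp add: inner_vec_def grad_def c[OF x] \<Omega>_def matrix_vector_mult_def mult.commute)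
    finally show "X k x = (\<Omega> *v x + - b - (- b \<bullet> x) *\<^sub>R x) $ k"
      by (simp add: K_def n inner_commute)
  qed
qed

end

section \<open>From the covariant conformal equation to the Euclidean one\<close>

lemma Ck_on_linear_image:
  assumes "open U" "bounded_linear l" "Ck_on r f U"
  shows "Ck_on r (\<lambda>x. l (f x)) U"
  using assms(3)
proof (induction r arbitrary: f)
  case 0
  then show ?case using bounded_linear.continuous_on[OF assms(2)] by simp
next
  case (Suc r)
  show ?case
    by (rule Ck_on_SucI[OF assms(1) bounded_linear.has_derivative[OF assms(2) Ck_on_SucD[OF Suc.prems]]])
       (use Suc in auto)
qed

lemma smooth_on_sphere_component:
  fixes V :: "'a::euclidean_space \<Rightarrow> real^'n"
  assumes "smooth_on_sphere V"
  shows "smooth_on_sphere (\<lambda>x. V x $ k)"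
  unfolding smooth_on_sphere_def
proof
  fix x :: 'a assume "x \<in> sphere 0 1"
  from assms[unfolded smooth_on_sphere_def, rule_format, OF this]
  obtain U g where g: "x \<in> U" "smooth_on_open g U" "\<forall>y\<in>U \<inter> sphere 0 1. g y = V y"
    by (elim exE conjE)
  have "smooth_on_open (\<lambda>y. g y $ k) U"
    unfolding smooth_on_open_def
  proof (intro conjI allI)
    show "open U" using g(2) by (simp add: smooth_on_open_def)
    show "Ck_on r (\<lambda>y. g y $ k) U" for r
      by (rule Ck_on_linear_image[OF _ bounded_linear_vec_nth]) (use g(2) in \<open>auto simp: smooth_on_open_def\<close>)
  qed
  then show "\<exists>U g. x \<in> U \<and> smooth_on_open g U \<and> (\<forall>y\<in>U \<inter> sphere 0 1. g y = V y $ k)"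
    using g(1,3) by (intro exI[of _ U] exI[of _ "\<lambda>y. g y $ k"]) auto
qed

lemma inner_tangential_part:
  assumes "w \<in> tangent_space x"
  shows "tangential_part x v \<bullet> w = v \<bullet> w"
  using assms by (simp add: tangential_part_def tangent_space_def inner_diff_left inner_commute[of x w])

text \<open>The covariant equation controls tangent directions. For the derivative D of the
  1-homogeneous extension the radial ones follow from Euler's relation D x = V x and from
  differentiating X \<bullet> x = 0. Together they give the equation of
  \<open>conformal_extension\<close>.\<close>

lemma conformal_field_moebius:
  fixes V :: "real^'n \<Rightarrow> real^'n"
  assumes V: "conformal_field V" and N: "CARD('n) \<ge> 3"
  obtains \<Omega> :: "real^'n^'n" and b :: "real^'n" where
    "\<And>i j. \<Omega> $ i $ j = - \<Omega> $ j $ i"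
    "\<And>x. x \<in> sphere 0 1 \<Longrightarrow> V x = \<Omega> *v x + b - (b \<bullet> x) *\<^sub>R x"
proof -
  have sV: "smooth_on_sphere V" and tV: "\<And>x. x \<in> sphere 0 1 \<Longrightarrow> V x \<in> tangent_space x"
    using V by (auto simp: conformal_field_def)
  from V obtain \<psi> where "\<forall>x\<in>sphere 0 1. \<forall>u\<in>tangent_space x. \<forall>w\<in>tangent_space x. lie_metric V x u w = 2 * \<psi> x * (u \<bullet> w)"
    unfolding conformal_field_def by blast
  then have \<psi>: "lie_metric V x a b = 2 * \<psi> x * (a \<bullet> b)"
    if "x \<in> sphere 0 1" "a \<in> tangent_space x" "b \<in> tangent_space x" for x a b
    using that by blast
  define X where "X = (\<lambda>k x. norm x * (V (x /\<^sub>R norm x) $ k))"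
  \<comment> \<open>The factor \<psi> comes with no regularity; the normalised divergence is smooth
    and agrees with it on the sphere.\<close>
  define s where "s = (\<lambda>x. (\<Sum>k\<in>UNIV. pd (axis k 1) (X k) x) * inverse (real (CARD('n) - 1)))"
  have sX: "smooth_punct (X k)" for k
    unfolding X_def
    by (intro smooth_punct_mult smooth_punct_norm smooth_punct_radial smooth_on_sphere_component sV)
  have hX: "homogeneous 1 (X k)" for k
    unfolding X_def by (rule homogeneous_radial(2)[of "\<lambda>x. V x $ k"])
  have ss: "smooth_punct s" unfolding s_def by (intro smooth_punct_intros sX)
  have hpd: "homogeneous 0 (pd v (X k))" for v k using homogeneous_pd[OF sX hX, of v k] by simp
  have hs: "homogeneous 0 s"
    using homogeneous_mult[OF homogeneous_sum[of UNIV 0, OF hpd] homogeneous_const] unfolding s_def by simp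
  have XV: "X k x = V x $ k" if "x \<in> sphere 0 1" for x k using that by (simp add: X_def)
  have xX: "(\<Sum>k\<in>UNIV. x $ k * X k x) = 0" if x: "x \<noteq> 0" for x
  proof -
    have "V (x /\<^sub>R norm x) \<bullet> (x /\<^sub>R norm x) = 0"
      using tV[of "x /\<^sub>R norm x"] x by (simp add: tangent_space_def)
    then have "V (x /\<^sub>R norm x) \<bullet> x = 0" using x by simp
    then show ?thesis
      by (simp add: X_def inner_vec_def mult_ac sum_distrib_left[symmetric])
  qed
  have conf1: "pd (axis j 1) (X k) x + pd (axis k 1) (X j) x
      = 2 * (\<psi> x * ((if j = k then 1 else 0) - x $ j * x $ k))" if xs: "x \<in> sphere 0 1" for x j k
  proof -
    have x: "x \<noteq> 0" and xx: "x \<bullet> x = 1" using xs by (auto simp: dot_square_norm)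
    define D where "D = (\<lambda>v. \<chi> k. pd v (X k) x)"
    have dW: "((\<lambda>y. \<chi> k. X k y) has_derivative D) (at x)"
      by (rule has_derivative_vecI) (simp add: D_def smooth_punct_deriv[OF sX x])
    have linD: "linear D" using has_derivative_linear[OF dW] .
    have dV: "sphere_deriv V x v = D v" if "v \<in> tangent_space x" for v
      by (rule sphere_deriv_eq[OF dW _ xs that]) (simp add: vec_eq_iff XV)
    have Dx: "D x = V x" using homogeneous_euler[OF sX hX x] by (simp add: D_def vec_eq_iff XV[OF xs])
    have xD: "x \<bullet> D v = - (v \<bullet> V x)" for v
    proof -
      have "pd v (\<lambda>y. \<Sum>k\<in>UNIV. y $ k * X k y) x = pd v (\<lambda>y. 0) x"
        by (rule pd_cong[OF _ x]) (rule xX)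
      moreover have "pd v (\<lambda>y. \<Sum>k\<in>UNIV. y $ k * X k y) x = (\<Sum>k\<in>UNIV. v $ k * X k x + x $ k * pd v (X k) x)"
        by (subst pd_sum) (auto intro!: smooth_punct_mult smooth_punct_coord sX x sum.cong
            simp: pd_mult[OF smooth_punct_coord sX x] pd_coord)
      ultimately show ?thesis by (simp add: sum.distrib inner_vec_def D_def XV[OF xs])
    qed
    have tang: "D a \<bullet> b + D b \<bullet> a = 2 * \<psi> x * (a \<bullet> b)" if "a \<in> tangent_space x" "b \<in> tangent_space x" for a b
      using \<psi>[OF xs that] that by (simp add: lie_metric_def cov_deriv_def dV inner_tangential_part inner_commute[of a])
    have Vx: "V x \<bullet> x = 0" using tV[OF xs] by (simp add: tangent_space_def)
    \<comment> \<open>Split \<open>a\<close> and \<open>b\<close> into tangential and radial parts;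
      the radial contributions cancel, since D x = V x is tangent and x \<bullet> D v = - v
      \<bullet> V x.\<close>
    have gen: "D a \<bullet> b + D b \<bullet> a = 2 * \<psi> x * (a \<bullet> b - (a \<bullet> x) * (b \<bullet> x))" for a b
    proof -
      define a' b' where "a' = a - (a \<bullet> x) *\<^sub>R x" and "b' = b - (b \<bullet> x) *\<^sub>R x"
      have t: "a' \<in> tangent_space x" "b' \<in> tangent_space x"
        by (simp_all add: a'_def b'_def tangent_space_def inner_diff_left xx)
      have Da: "D a' = D a - (a \<bullet> x) *\<^sub>R V x" "D b' = D b - (b \<bullet> x) *\<^sub>R V x"
        by (simp_all add: a'_def b'_def linear_diff[OF linD] linear_scale[OF linD] Dx)
      have "D a' \<bullet> b' + D b' \<bullet> a' = D a \<bullet> b + D b \<bullet> a"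
        unfolding Da using xD[of a] xD[of b] Vx
        by (simp add: a'_def b'_def inner_diff_left inner_diff_right inner_commute[of _ x] inner_commute[of "V x"])
      moreover have "a' \<bullet> b' = a \<bullet> b - (a \<bullet> x) * (b \<bullet> x)"
        by (simp add: a'_def b'_def inner_diff_left inner_diff_right xx inner_commute[of x b])
      ultimately show ?thesis using tang[OF t] by simp
    qed
    have "axis j (1::real) $ k = (if j = k then 1 else 0)" by (simp add: axis_def)
    then show ?thesis using gen[of "axis j 1" "axis k 1"]
      by (simp add: D_def inner_axis inner_commute[of "axis _ _" x] inner_axis_axis mult.assoc)
  qed
  have s\<psi>: "s x = \<psi> x" if xs: "x \<in> sphere 0 1" for x
  proof -
    have xx: "x \<bullet> x = 1" using xs by (auto simp: dot_square_norm)
    have "(\<Sum>k\<in>UNIV. pd (axis k 1) (X k) x) = (\<Sum>k\<in>UNIV. \<psi> x * (1 - x $ k * x $ k))"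
      using conf1[OF xs, of k k for k] by (intro sum.cong refl) simp
    also have "\<dots> = \<psi> x * (real CARD('n) - x \<bullet> x)"
      by (simp add: sum_distrib_left[symmetric] sum_subtractf inner_vec_def)
    also have "real CARD('n) - x \<bullet> x = real (CARD('n) - 1)" using N xx by simp
    finally show ?thesis using N by (simp add: s_def)
  qed
  interpret conformal_extension X s
  proof
    fix x :: "real^'n" and j k assume x: "x \<noteq> 0"
    let ?x = "x /\<^sub>R norm x"
    have xs: "?x \<in> sphere 0 1" using x by simp
    \<comment> \<open>Both sides have degree 0 in x, so unit vectors suffice.\<close>
    have "pd (axis j 1) (X k) x + pd (axis k 1) (X j) x = pd (axis j 1) (X k) ?x + pd (axis k 1) (X j) ?x"
      using homogeneous_radial_eq[OF hpd x] by simp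
    also have "\<dots> = 2 * (s ?x * ((if j = k then 1 else 0) - ?x $ j * ?x $ k))"
      unfolding conf1[OF xs] s\<psi>[OF xs] ..
    also have "s ?x = s x" using homogeneous_radial_eq[OF hs x] by simp
    also have "?x $ j * ?x $ k = x $ j * x $ k * inverse (norm x) ^ 2" by (simp add: power2_eq_square mult_ac)
    finally show "pd (axis j 1) (X k) x + pd (axis k 1) (X j) x
      = 2 * (s x * ((if j = k then 1 else 0) - x $ j * x $ k * inverse (norm x) ^ 2))" .
  qed (use sX hX ss hs N in auto)
  show ?thesis
    using X_moebius that XV by (metis vec_eq_iff)
qed

theorem theorem9p1:
  fixes n k :: nat and f \<phi> :: "real ^ 'm::finite \<Rightarrow> real"
  assumes "CARD('m) = n + 1" and "2 \<le> n" and "k \<le> n - 1"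
    and "smooth_on_sphere f" and "\<forall>x\<in>sphere 0 1. f x > 0"
    and "smooth_on_sphere \<phi>" and "\<forall>x\<in>sphere 0 1. \<phi> x > 0"
    and "\<forall>x\<in>sphere 0 1. pos_def_on (tangent_space x) (A_form \<phi> x)"
    and "\<forall>x\<in>sphere 0 1. \<phi> x ^ (n - k) * p_form (tangent_space x) (n - k) (A_form \<phi> x) = f x"
  shows "(\<forall>i. has_bochner_integral sphere_area
            (\<lambda>x. \<phi> x powi (- int n) * (sphere_grad f x \<bullet> sphere_grad (\<lambda>y. y $ i) x)) 0)
       \<and> (\<forall>V. conformal_field V \<longrightarrow>
            has_bochner_integral sphere_area
              (\<lambda>x. \<phi> x powi (- int n) * sphere_deriv f x (V x)) 0)"
proof -
  define u where "u = (\<lambda>x. norm x * \<phi> (x /\<^sub>R norm x))"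
  define F where "F = (\<lambda>x. f (x /\<^sub>R norm x))"
  have su: "smooth_punct u"
    unfolding u_def by (intro smooth_punct_mult smooth_punct_norm smooth_punct_radial assms(6))
  have sF: "smooth_punct F" unfolding F_def by (rule smooth_punct_radial[OF assms(4)])
  have hF: "homogeneous 0 F" unfolding F_def by (rule homogeneous_radial)
  have eqF: "f x = F x" and equ: "\<phi> x = u x" if "x \<in> sphere 0 1" for x
    using that by (simp_all add: F_def u_def)
  interpret curvature_equation u F \<phi> n "n - k"
  proof
    show "homogeneous 1 u" unfolding u_def by (rule homogeneous_radial)
    show "u x > 0" if "x \<noteq> 0" for x using that assms(7) by (simp add: u_def)
    show "F x = u x ^ (n - k) * p_form (tangent_space x) (n - k) (A_form \<phi> x)" if "x \<in> sphere 0 1" for x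
      using assms(9)[rule_format, OF that] by (simp only: eqF[OF that] equ[OF that])
  qed (use su sF equ assms(1,2) in auto)
  have moebius: "has_bochner_integral sphere_area (\<lambda>x. \<phi> x powi (- int n) * (W x \<bullet> grad F x)) 0"
    if \<Omega>: "\<And>i j. \<Omega> $ i $ j = - \<Omega> $ j $ i" and W: "\<And>x. x \<in> sphere 0 1 \<Longrightarrow> W x = \<Omega> *v x + b - (b \<bullet> x) *\<^sub>R x"
    for \<Omega> :: "real^'m^'m" and b and W :: "real^'m \<Rightarrow> real^'m"
  proof -
    have e: "inverse (u x) ^ n * ((\<Omega> *v x + b - (b \<bullet> x) *\<^sub>R x) \<bullet> grad F x) = \<phi> x powi (- int n) * (W x \<bullet> grad F x)"
      if "x \<in> space sphere_area" for x
      using that W[of x] equ[of x] by (simp add: space_sphere_area power_int_minus power_inverse)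
    show ?thesis
      by (rule has_bochner_integral_cong[THEN iffD1, OF refl e refl integral_moebius_field[OF \<Omega>]])
  qed
  \<comment> \<open>\<open>F\<close> has degree 0, so its Euclidean gradient is already
    tangent.\<close>
  have grad_f: "sphere_grad f x = grad F x" if x: "x \<in> sphere 0 1" for x
  proof -
    have "x \<noteq> 0" using x by auto
    then have "grad F x \<bullet> x = 0"
      using homogeneous_euler[OF sF hF] pd_eq_inner_grad[OF sF, of x x] by (simp add: inner_commute)
    then show ?thesis using sphere_grad_eq[OF sF eqF x] by simp
  qed
  \<comment> \<open>The gradient of a coordinate is the field with \<Omega> = 0 and b a unit vector;
    \<open>0 *v x\<close> is kept to match \<open>moebius\<close>.\<close>
  have grad_coord: "sphere_grad (\<lambda>y. y $ i) x = 0 *v x + axis i 1 - (axis i 1 \<bullet> x) *\<^sub>R x" if x: "x \<in> sphere 0 1"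
    for i and x :: "real^'m"
  proof -
    have "grad (\<lambda>y. y $ i) x = axis i 1" by (simp add: grad_def pd_coord vec_eq_iff axis_def eq_commute)
    then show ?thesis using sphere_grad_eq[OF smooth_punct_coord refl x, of i] by simp
  qed
  show ?thesis
  proof (intro conjI allI impI)
    fix i
    have "has_bochner_integral sphere_area (\<lambda>x. \<phi> x powi (- int n) * (sphere_grad (\<lambda>y. y $ i) x \<bullet> grad F x)) 0"
      by (rule moebius[OF _ grad_coord]) simp_all
    then show "has_bochner_integral sphere_area (\<lambda>x. \<phi> x powi (- int n) * (sphere_grad f x \<bullet> sphere_grad (\<lambda>y. y $ i) x)) 0"
      by (rule has_bochner_integral_cong[THEN iffD1, rotated -1]) (auto simp: space_sphere_area grad_f inner_commute)
  next
    fix V :: "real^'m \<Rightarrow> real^'m" assume V: "conformal_field V"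
    have "CARD('m) \<ge> 3" using assms(1,2) by simp
    then obtain \<Omega> b where \<Omega>: "\<And>i j. \<Omega> $ i $ j = - \<Omega> $ j $ i"
      "\<And>x. x \<in> sphere 0 1 \<Longrightarrow> V x = \<Omega> *v x + b - (b \<bullet> x) *\<^sub>R x"
      using conformal_field_moebius[OF V] by blast
    have "sphere_deriv f x (V x) = V x \<bullet> grad F x" if x: "x \<in> sphere 0 1" for x
    proof -
      have "x \<noteq> 0" using x by auto
      moreover have "V x \<in> tangent_space x" using V x by (simp add: conformal_field_def)
      ultimately show ?thesis
        using sphere_deriv_eq[OF smooth_punct_deriv[OF sF] eqF x] pd_eq_inner_grad[OF sF] by simp
    qed
    then show "has_bochner_integral sphere_area (\<lambda>x. \<phi> x powi (- int n) * sphere_deriv f x (V x)) 0"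
      by (intro has_bochner_integral_cong[THEN iffD1, OF refl _ refl moebius[OF \<Omega>]]) (auto simp: space_sphere_area)
  qed
qed

end
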